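(* Let $f_0\in L^2(\mathbb S^2,\mu)$ and $u\in L^2(0,T;L^2(\mathbb S^2,\mu))$. Let $\overline{\omega}=\{(x_1,x_2,x_3)\in\mathbb S^2 \mid \alpha<|x_3|<\beta\}$ with $0\le\alpha<\beta<1$. Consider the equation $$\begin{cases}\partial_t f-\mathcal L f=u\,\mathbf 1_{\overline{\omega}} & \text{in }(0,T)\times\mathbb S^2,\\ f|_{t=0}=f_0 & \text{in }\mathbb S^2.\end{cases}$$ Then the minimal time of null controllability from $\overline{\omega}$ satisfies $T_{\min}\ge\log\big(1/\sqrt{1-\alpha^2}\big)$. Moreover, there exists $T^*>0$ such that, for every $T\ge T^*$, the system is null controllable from $\overline{\omega}$ in time $T$.
   Context: $\mathbb S^2=\{(x_1,x_2,x_3)\in\mathbb R^3: x_1^2+x_2^2+x_3^2=1\}$ and $\mu$ is the standard Riemannian volume measure on $\mathbb S^2$ induced by the Euclidean structure. Consider the vector fields on $\mathbb S^2$ (restrictions of vector fields of $\mathbb R^3$) $$X=-x_3\partial_{x_2}+x_2\partial_{x_3},\qquad Y=-x_3\partial_{x_1}+x_1\partial_{x_3}.$$ The operator $\mathcal L$ is $\mathcal L=-X^{+}X-Y^{+}Y$, where $X^+,Y^+$ are the formal adjoints of $X,Y$ in $L^2(\mathbb S^2,\mu)$. It is essentially self-adjoint on $C^\infty(\mathbb S^2)$, and $\mathcal L$ denotes its self-adjoint realization in $L^2(\mathbb S^2,\mu)$, with domain $D(\mathcal L)=\{u\in L^2(\mathbb S^2,\mu):\mathcal L u\in L^2(\mathbb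 S^2,\mu)\}$. It generates a semigroup $(e^{t\mathcal L})_{t\ge0}$, and the solution of the equation is given by Duhamel's formula $f(t)=e^{t\mathcal L}f_0+\int_0^t e^{(t-s)\mathcal L}\big(u(s)\mathbf 1_{\overline\omega}\big)\,ds$. The system is null controllable from $\overline\omega$ in time $T>0$ if for every $f_0\in L^2(\mathbb S^2,\mu)$ there exists $u\in L^2(0,T;L^2(\mathbb S^2,\mu))$, supported in $(0,T)\times\overline\omega$, such that the solution satisfies $f(T,\cdot)=0$. The minimal time of null controllability is $T_{\min}=\inf\{T>0:\text{the system is null controllable from }\overline\omega\text{ in time }T\}$. *)

theory Defs
  imports "HOL-Analysis.Analysis"
begin

abbreviation S2 :: "(real^3) set" where
  "S2 \<equiv> sphere 0 1"

definition chart :: "real \<times> real \<Rightarrow> real^3" where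
  "chart p = vector [sin (fst p) * cos (snd p), sin (fst p) * sin (snd p), cos (fst p)]"

definition chart_dom :: "(real \<times> real) set" where
  "chart_dom = {0<..<pi} \<times> {0<..<2*pi}"

definition d1_chart :: "real \<times> real \<Rightarrow> real^3" where
  "d1_chart p = vector_derivative (\<lambda>t. chart (t, snd p)) (at (fst p))"

definition d2_chart :: "real \<times> real \<Rightarrow> real^3" where
  "d2_chart p = vector_derivative (\<lambda>t. chart (fst p, t)) (at (snd p))"

text \<open>Square root of the determinant of the metric tensor in the chart.\<close>

definition vol_density :: "real \<times> real \<Rightarrow> real" where
  "vol_density p = sqrt ((d1_chart p \<bullet> d1_chart p) * (d2_chart p \<bullet> d2_chart p)
                         - (d1_chart p \<bullet> d2_chart p)\<^sup>2)"

text \<open>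
  The measure is a Borel measure on \<open>real^3\<close> that is concentrated on \<^const>\<open>sphere\<close>.
  The chart misses only a half great circle, which is a null set.
\<close>

definition \<mu> :: "(real^3) measure" where
  "\<mu> = distr (density lborel (\<lambda>p. ennreal (indicator chart_dom p * vol_density p))) borel chart"

lemma chart_nth [simp]:
  "chart p $ 1 = sin (fst p) * cos (snd p)"
  "chart p $ 2 = sin (fst p) * sin (snd p)"
  "chart p $ 3 = cos (fst p)"
  by (simp_all add: chart_def)

lemma has_vector_derivative_vec3I:
  fixes f :: "real \<Rightarrow> real^3"
  assumes "((\<lambda>t. f t $ 1) has_real_derivative a) (at t)"
    "((\<lambda>t. f t $ 2) has_real_derivative b) (at t)"
    "((\<lambda>t. f t $ 3) has_real_derivative c) (at t)"
  shows "(f has_vector_derivative vector [a, b, c]) (at t)"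
  unfolding has_vector_derivative_def has_derivative_componentwise_within[of f]
  using assms
  by (auto simp: Basis_vec_def inner_axis has_field_derivative_def forall_3 mult.commute[of _ a]
      mult.commute[of _ b] mult.commute[of _ c] ac_simps mult_commute_abs)

lemma d1_chart_eq:
  "d1_chart p = vector [cos (fst p) * cos (snd p), cos (fst p) * sin (snd p), - sin (fst p)]"
  unfolding d1_chart_def
  by (rule vector_derivative_at, rule has_vector_derivative_vec3I) (auto intro!: derivative_eq_intros)

lemma d2_chart_eq:
  "d2_chart p = vector [- (sin (fst p) * sin (snd p)), sin (fst p) * cos (snd p), 0]"
  unfolding d2_chart_def
  by (rule vector_derivative_at, rule has_vector_derivative_vec3I) (auto intro!: derivative_eq_intros)

lemma vol_density_eq: "vol_density p = \<bar>sin (fst p)\<bar>"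
proof -
  let ?s = "sin (fst p)" and ?c = "cos (fst p)" and ?S = "sin (snd p)" and ?C = "cos (snd p)"
  have 1: "?s\<^sup>2 + ?c\<^sup>2 = 1" and 2: "?S\<^sup>2 + ?C\<^sup>2 = 1" by simp_all
  have "d1_chart p \<bullet> d1_chart p = (?c * ?C)\<^sup>2 + (?c * ?S)\<^sup>2 + ?s\<^sup>2"
    by (simp add: d1_chart_eq inner_vec_def sum_3 power2_eq_square)
  also have "\<dots> = 1" using 1 2 by algebra
  finally have a: "d1_chart p \<bullet> d1_chart p = 1" .
  have "d2_chart p \<bullet> d2_chart p = (?s * ?S)\<^sup>2 + (?s * ?C)\<^sup>2"
    by (simp add: d2_chart_eq inner_vec_def sum_3 power2_eq_square)
  also have "\<dots> = ?s\<^sup>2" using 2 by algebra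
  finally have b: "d2_chart p \<bullet> d2_chart p = ?s\<^sup>2" .
  have c: "d1_chart p \<bullet> d2_chart p = 0"
    by (simp add: d1_chart_eq d2_chart_eq inner_vec_def sum_3 algebra_simps)
  show ?thesis unfolding vol_density_def a b c by simp
qed

lemma chart_measurable [measurable]: "chart \<in> borel_measurable borel"
proof (rule borel_measurable_continuous_onI)
  have "continuous_on UNIV (\<lambda>p. chart p $ i)" for i
    using exhaust_3[of i] by (elim disjE; simp) (intro continuous_intros)+
  then show "continuous_on UNIV chart"
    using continuous_on_vec_lambda[of UNIV "\<lambda>i p. chart p $ i"] by simp
qed

lemma vol_density_measurable [measurable]: "vol_density \<in> borel_measurable borel"
  unfolding vol_density_eq[abs_def]
  by (intro borel_measurable_continuous_onI continuous_intros)

lemma chart_dom_measurable [measurable]: "chart_dom \<in> sets borel"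
  unfolding chart_dom_def by (intro borel_open open_Times) auto

lemma sets_\<mu> [simp, measurable_cong]: "sets \<mu> = sets borel"
  by (simp add: \<mu>_def)

lemma space_\<mu> [simp]: "space \<mu> = UNIV"
  by (simp add: \<mu>_def)

lemma chart_in_S2: "chart p \<in> S2"
proof -
  have "(sin (fst p))\<^sup>2 + (cos (fst p))\<^sup>2 = 1" "(sin (snd p))\<^sup>2 + (cos (snd p))\<^sup>2 = 1" by simp_all
  then have "(sin (fst p) * cos (snd p))\<^sup>2 + (sin (fst p) * sin (snd p))\<^sup>2 + (cos (fst p))\<^sup>2 = 1"
    by algebra
  then show ?thesis by (simp add: norm_eq_sqrt_inner inner_vec_def sum_3 power2_eq_square)
qed

lemma AE_\<mu>_S2: "AE x in \<mu>. x \<in> S2"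
  unfolding \<mu>_def by (subst AE_distr_iff) (auto simp: chart_in_S2[simplified])

lemma finite_measure_\<mu>: "finite_measure \<mu>"
proof
  have "emeasure \<mu> UNIV = (\<integral>\<^sup>+p. ennreal (indicator chart_dom p * vol_density p) \<partial>lborel)"
    by (simp add: \<mu>_def emeasure_distr emeasure_density)
  also have "\<dots> \<le> (\<integral>\<^sup>+p. indicator (cbox (0,0) (pi,2*pi)) p \<partial>lborel)"
    by (intro nn_integral_mono)
       (auto simp: vol_density_eq indicator_def chart_dom_def cbox_Pair_eq ennreal_le_1)
  also have "\<dots> < \<infinity>"
    by (simp add: emeasure_lborel_cbox_eq del: cbox_Pair_eq)
  finally show "emeasure \<mu> (space \<mu>) \<noteq> \<infinity>" by simp
qed

interpretation \<mu>: finite_measure \<mu>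
  by (rule finite_measure_\<mu>)

definition square_integrable :: "(real^3 \<Rightarrow> complex) \<Rightarrow> bool" where
  "square_integrable f \<longleftrightarrow> f \<in> borel_measurable \<mu> \<and> integrable \<mu> (\<lambda>x. (norm (f x))\<^sup>2)"

definition L2_rel :: "(real^3 \<Rightarrow> complex) \<Rightarrow> (real^3 \<Rightarrow> complex) \<Rightarrow> bool" where
  "L2_rel f g \<longleftrightarrow> square_integrable f \<and> square_integrable g \<and> (AE x in \<mu>. f x = g x)"

quotient_type L2 = "real^3 \<Rightarrow> complex" / partial: L2_rel
  morphisms rep_L2 abs_L2
proof (rule part_equivpI)
  show "\<exists>x. L2_rel x x"
    by (intro exI[of _ "\<lambda>_. 0"]) (simp add: L2_rel_def square_integrable_def)
  show "symp L2_rel"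
    by (auto simp: L2_rel_def symp_def elim: eventually_mono)
  show "transp L2_rel"
    by (auto simp: L2_rel_def transp_def elim: eventually_elim2)
qed

lemma square_integrable_measurable [measurable_dest]:
  "square_integrable f \<Longrightarrow> f \<in> borel_measurable \<mu>"
  by (simp add: square_integrable_def)

lemma square_integrable_add:
  assumes "square_integrable f" "square_integrable g"
  shows "square_integrable (\<lambda>x. f x + g x)"
  unfolding square_integrable_def
proof
  have [measurable]: "f \<in> borel_measurable \<mu>" "g \<in> borel_measurable \<mu>"
    using assms by (auto simp: square_integrable_def)
  show "(\<lambda>x. f x + g x) \<in> borel_measurable \<mu>" by measurable
  show "integrable \<mu> (\<lambda>x. (norm (f x + g x))\<^sup>2)"
  proof (rule Bochner_Integration.integrable_bound)
    show "integrable \<mu> (\<lambda>x. 2 * (norm (f x))\<^sup>2 + 2 * (norm (g x))\<^sup>2)"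
      using assms by (auto simp: square_integrable_def)
    have "(norm (a + b))\<^sup>2 \<le> 2 * (norm a)\<^sup>2 + 2 * (norm b)\<^sup>2" for a b :: complex
    proof -
      have "(norm (a + b))\<^sup>2 \<le> (norm a + norm b)\<^sup>2"
        by (intro power_mono norm_triangle_ineq) auto
      also have "\<dots> \<le> 2 * (norm a)\<^sup>2 + 2 * (norm b)\<^sup>2"
        using zero_le_power2[of "norm a - norm b"] by (simp add: power2_eq_square algebra_simps)
      finally show ?thesis .
    qed
    then show "AE x in \<mu>. norm ((norm (f x + g x))\<^sup>2) \<le> norm (2 * (norm (f x))\<^sup>2 + 2 * (norm (g x))\<^sup>2)"
      by simp
  qed measurable
qed

lemma square_integrable_mult:
  "square_integrable f \<Longrightarrow> square_integrable (\<lambda>x. c * f x)"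
  by (auto simp: square_integrable_def norm_mult power_mult_distrib)

lemma square_integrable_scaleR:
  "square_integrable f \<Longrightarrow> square_integrable (\<lambda>x. r *\<^sub>R f x)"
  using square_integrable_mult[of f "of_real r"] by (simp add: scaleR_conv_of_real)

lemma square_integrable_uminus:
  "square_integrable f \<Longrightarrow> square_integrable (\<lambda>x. - f x)"
  using square_integrable_scaleR[of f "-1"] by simp

lemma square_integrable_diff:
  "square_integrable f \<Longrightarrow> square_integrable g \<Longrightarrow> square_integrable (\<lambda>x. f x - g x)"
  using square_integrable_add[of f "\<lambda>x. - g x"] square_integrable_uminus[of g] by simp

lemma square_integrable_mult_integrable:
  assumes "square_integrable f" "square_integrable g"
  shows "integrable \<mu> (\<lambda>x. f x * cnj (g x))"
proof (rule Bochner_Integration.integrable_bound)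
  show "integrable \<mu> (\<lambda>x. (norm (f x))\<^sup>2 + (norm (g x))\<^sup>2)"
    using assms by (auto simp: square_integrable_def)
  have [measurable]: "f \<in> borel_measurable \<mu>" "g \<in> borel_measurable \<mu>"
    using assms by (auto simp: square_integrable_def)
  show "(\<lambda>x. f x * cnj (g x)) \<in> borel_measurable \<mu>"
    by (intro borel_measurable_times borel_measurable_continuous_on[where f=cnj])
       (auto intro!: continuous_intros)
  have "norm (a * cnj b) \<le> (norm a)\<^sup>2 + (norm b)\<^sup>2" for a b :: complex
  proof -
    have "2 * (norm a * norm b) \<le> (norm a)\<^sup>2 + (norm b)\<^sup>2"
      using zero_le_power2[of "norm a - norm b"] by (simp add: power2_eq_square algebra_simps)
    moreover have "0 \<le> norm a * norm b" by simp
    ultimately show ?thesis unfolding norm_mult complex_mod_cnj by linarith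
  qed
  then show "AE x in \<mu>. norm (f x * cnj (g x)) \<le> norm ((norm (f x))\<^sup>2 + (norm (g x))\<^sup>2)"
    by (auto intro!: AE_I2 order_trans[OF _ abs_ge_self])
qed

lemma inner_eq_Re_cnj: "(a::complex) \<bullet> b = Re (a * cnj b)"
  by (simp add: inner_complex_def)

lemma square_integrable_inner_integrable:
  assumes "square_integrable f" "square_integrable g"
  shows "integrable \<mu> (\<lambda>x. f x \<bullet> g x)"
  unfolding inner_eq_Re_cnj
  using square_integrable_mult_integrable[OF assms] by (rule integrable_Re)

text \<open>
  The real part of the Hermitian inner product. It induces the \<open>L\<^sup>2\<close> norm and topology.
\<close>

instantiation L2 :: real_inner
begin

lift_definition zero_L2 :: L2 is "\<lambda>_. 0"
  by (simp add: L2_rel_def square_integrable_def)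

lift_definition plus_L2 :: "L2 \<Rightarrow> L2 \<Rightarrow> L2" is "\<lambda>f g x. f x + g x"
  by (auto simp: L2_rel_def intro!: square_integrable_add elim: eventually_elim2)

lift_definition minus_L2 :: "L2 \<Rightarrow> L2 \<Rightarrow> L2" is "\<lambda>f g x. f x - g x"
  by (auto simp: L2_rel_def intro!: square_integrable_diff elim: eventually_elim2)

lift_definition uminus_L2 :: "L2 \<Rightarrow> L2" is "\<lambda>f x. - f x"
  by (auto simp: L2_rel_def intro!: square_integrable_uminus elim: eventually_mono)

lift_definition scaleR_L2 :: "real \<Rightarrow> L2 \<Rightarrow> L2" is "\<lambda>r f x. r *\<^sub>R f x"
  by (auto simp: L2_rel_def intro!: square_integrable_scaleR elim: eventually_mono)

lift_definition inner_L2 :: "L2 \<Rightarrow> L2 \<Rightarrow> real" is "\<lambda>f g. \<integral>x. f x \<bullet> g x \<partial>\<mu>"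
proof -
  fix f f' g g' assume *: "L2_rel f f'" "L2_rel g g'"
  then have [measurable]: "f \<in> borel_measurable \<mu>" "f' \<in> borel_measurable \<mu>"
      "g \<in> borel_measurable \<mu>" "g' \<in> borel_measurable \<mu>"
    by (auto simp: L2_rel_def square_integrable_def)
  have "AE x in \<mu>. f x = f' x" "AE x in \<mu>. g x = g' x" using * by (auto simp: L2_rel_def)
  then have "AE x in \<mu>. f x \<bullet> g x = f' x \<bullet> g' x" by eventually_elim simp
  then show "(\<integral>x. f x \<bullet> g x \<partial>\<mu>) = (\<integral>x. f' x \<bullet> g' x \<partial>\<mu>)"
    by (intro integral_cong_AE) auto
qed

definition norm_L2 :: "L2 \<Rightarrow> real" where "norm f = sqrt (f \<bullet> f)" for f :: L2
definition dist_L2 :: "L2 \<Rightarrow> L2 \<Rightarrow> real" where "dist f g = norm (f - g)" for f g :: L2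
definition sgn_L2 :: "L2 \<Rightarrow> L2" where "sgn f = inverse (norm f) *\<^sub>R f" for f :: L2
definition uniformity_L2 :: "(L2 \<times> L2) filter" where
  "uniformity_L2 = (INF e\<in>{0<..}. principal {(x, y). dist x y < e})"
definition open_L2 :: "L2 set \<Rightarrow> bool" where
  "open_L2 U = (\<forall>x\<in>U. eventually (\<lambda>(x', y). x' = x \<longrightarrow> y \<in> U) uniformity)"

instance
proof
  fix f g h :: L2 and r s :: real
  show "f + g + h = f + (g + h)"
    by transfer (auto simp: L2_rel_def add.assoc intro!: square_integrable_add)
  show "f + g = g + f"
    by transfer (auto simp: L2_rel_def add.commute intro!: square_integrable_add)
  show "0 + f = f"
    by transfer (auto simp: L2_rel_def)
  show "- f + f = 0"
    by transfer (auto simp: L2_rel_def square_integrable_def)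
  show "f - g = f + - g"
    by transfer (auto simp: L2_rel_def intro!: square_integrable_diff)
  show "r *\<^sub>R (f + g) = r *\<^sub>R f + r *\<^sub>R g"
    by transfer (auto simp: L2_rel_def scaleR_add_right intro!: square_integrable_add square_integrable_scaleR)
  show "(r + s) *\<^sub>R f = r *\<^sub>R f + s *\<^sub>R f"
    by transfer (auto simp: L2_rel_def scaleR_add_left intro!: square_integrable_add square_integrable_scaleR)
  show "r *\<^sub>R s *\<^sub>R f = (r * s) *\<^sub>R f"
    by transfer (auto simp: L2_rel_def intro!: square_integrable_scaleR)
  show "1 *\<^sub>R f = f"
    by transfer (auto simp: L2_rel_def)
  show "dist f g = norm (f - g)" by (rule dist_L2_def)
  show "sgn f = inverse (norm f) *\<^sub>R f" by (rule sgn_L2_def)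
  show "uniformity = (INF e\<in>{0<..}. principal {(x::L2, y). dist x y < e})"
    by (rule uniformity_L2_def)
  show "open U = (\<forall>x\<in>U. eventually (\<lambda>(x', y). x' = x \<longrightarrow> y \<in> U) uniformity)" for U :: "L2 set"
    by (rule open_L2_def)
  show "inner f g = inner g f"
    by transfer (simp add: inner_commute)
  show "inner (f + g) h = inner f h + inner g h"
    by transfer (auto simp: L2_rel_def inner_add_left square_integrable_inner_integrable)
  show "inner (r *\<^sub>R f) g = r * inner f g"
    by transfer (auto simp: L2_rel_def)
  show "0 \<le> inner f f"
    by transfer simp
  show "inner f f = 0 \<longleftrightarrow> f = 0"
  proof transfer
    fix f assume f: "L2_rel f f"
    then have "integrable \<mu> (\<lambda>x. f x \<bullet> f x)"
      by (auto simp: L2_rel_def square_integrable_inner_integrable)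
    then have "(\<integral>x. f x \<bullet> f x \<partial>\<mu>) = 0 \<longleftrightarrow> (AE x in \<mu>. f x \<bullet> f x = 0)"
      by (rule integral_nonneg_eq_0_iff_AE) simp
    then show "(\<integral>x. f x \<bullet> f x \<partial>\<mu>) = 0 \<longleftrightarrow> L2_rel f (\<lambda>_. 0)"
      using f by (simp add: L2_rel_def square_integrable_def)
  qed
  show "norm f = sqrt (inner f f)" by (rule norm_L2_def)
qed

end


lemma L2_rel_refl [simp]: "L2_rel f f \<longleftrightarrow> square_integrable f"
  by (simp add: L2_rel_def)

lemma abs_L2_eq_iff:
  assumes "square_integrable f" "square_integrable g"
  shows "abs_L2 f = abs_L2 g \<longleftrightarrow> (AE x in \<mu>. f x = g x)"
  using Quotient3_rel[OF Quotient3_L2, of f g] assms by (simp add: L2_rel_def)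

lemma square_integrable_rep_L2 [simp]: "square_integrable (rep_L2 u)"
  using Quotient3_rep_reflp[OF Quotient3_L2, of u] by simp

lemma abs_rep_L2 [simp]: "abs_L2 (rep_L2 u) = u"
  by (rule Quotient3_abs_rep[OF Quotient3_L2])

lemma rep_abs_L2: "square_integrable f \<Longrightarrow> AE x in \<mu>. rep_L2 (abs_L2 f) x = f x"
  using abs_L2_eq_iff[of "rep_L2 (abs_L2 f)" f] by simp

lemma L2_cases [case_names abs]:
  obtains f where "square_integrable f" "u = abs_L2 f"
  using square_integrable_rep_L2 abs_rep_L2 by metis

lemma abs_L2_diff:
  "square_integrable f \<Longrightarrow> square_integrable g \<Longrightarrow> abs_L2 f - abs_L2 g = abs_L2 (\<lambda>x. f x - g x)"
  by (simp add: minus_L2.abs_eq)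

lemma abs_L2_add:
  "square_integrable f \<Longrightarrow> square_integrable g \<Longrightarrow> abs_L2 f + abs_L2 g = abs_L2 (\<lambda>x. f x + g x)"
  by (simp add: plus_L2.abs_eq)

lemma abs_L2_scaleR:
  "square_integrable f \<Longrightarrow> r *\<^sub>R abs_L2 f = abs_L2 (\<lambda>x. r *\<^sub>R f x)"
  by (simp add: scaleR_L2.abs_eq)

lemma norm_abs_L2:
  "square_integrable f \<Longrightarrow> norm (abs_L2 f) = sqrt (\<integral>x. (norm (f x))\<^sup>2 \<partial>\<mu>)"
  by (simp add: norm_eq_sqrt_inner[of "abs_L2 f"] inner_L2.abs_eq power2_norm_eq_inner)

lemma norm_abs_L2_sq:
  "square_integrable f \<Longrightarrow> (norm (abs_L2 f))\<^sup>2 = (\<integral>x. (norm (f x))\<^sup>2 \<partial>\<mu>)"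
  by (simp add: norm_abs_L2)


lemma square_integrable_const: "square_integrable (\<lambda>_. c)"
  by (simp add: square_integrable_def)

lemma square_integrable_bounded_by:
  assumes "f \<in> borel_measurable \<mu>" "(\<integral>\<^sup>+x. ennreal ((norm (f x))\<^sup>2) \<partial>\<mu>) \<le> ennreal c"
  shows "square_integrable f"
  unfolding square_integrable_def
  using assms by (auto intro!: integrableI_bounded le_less_trans[OF _ ennreal_less_top])

lemma nn_integral_norm_sq:
  assumes "square_integrable f"
  shows "(\<integral>\<^sup>+x. ennreal ((norm (f x))\<^sup>2) \<partial>\<mu>) = ennreal ((norm (abs_L2 f))\<^sup>2)"
  using assms unfolding norm_abs_L2_sq[OF assms]
  by (intro nn_integral_eq_integral) (auto simp: square_integrable_def)

instance L2 :: banach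
proof
  fix X :: "nat \<Rightarrow> L2" assume X: "Cauchy X"
  have "\<exists>r. \<forall>k. (\<forall>n\<ge>r k. norm (X n - X (r k)) < (1/2)^k) \<and> r k < r (Suc k)"
  proof (rule dependent_nat_choice)
    have *: "\<exists>N>m. \<forall>n\<ge>N. norm (X n - X N) < (1/2)^k" for k m :: nat
    proof -
      obtain M where M: "\<forall>i\<ge>M. \<forall>j\<ge>M. norm (X i - X j) < (1/2)^k"
        using CauchyD[OF X, of "(1/2)^k"] by auto
      show ?thesis by (rule exI[of _ "max M (Suc m)"]) (use M in auto)
    qed
    show "\<exists>x. \<forall>n\<ge>x. norm (X n - X x) < (1/2) ^ 0" using *[of 0 0] by blast
    show "\<exists>y. (\<forall>n\<ge>y. norm (X n - X y) < (1/2) ^ Suc k) \<and> x < y" for x k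
      using *[of x "Suc k"] by blast
  qed
  then obtain r where r: "\<And>k n. n \<ge> r k \<Longrightarrow> norm (X n - X (r k)) < (1/2)^k"
    and r_mono: "strict_mono r" unfolding strict_mono_Suc_iff by blast
  define Y where "Y = (\<lambda>k. X (r k))"
  define f where "f = (\<lambda>k. rep_L2 (Y k))"
  have sq: "square_integrable (f k)" for k by (simp add: f_def)
  then have meas [measurable]: "f k \<in> borel_measurable borel" for k
    using square_integrable_measurable[OF sq[of k]] measurable_cong_sets[OF sets_\<mu> refl] by blast
  have Y: "Y k = abs_L2 (f k)" for k by (simp add: f_def)
  have dY: "norm (Y m - Y k) < (1/2)^k" if "m \<ge> k" for m k
    using r[of k "r m"] that r_mono by (simp add: Y_def strict_mono_less_eq)
  have d_int: "(\<integral>\<^sup>+x. ennreal ((norm (f m x - f k x))\<^sup>2) \<partial>\<mu>) \<le> ennreal (((1/2)^k)\<^sup>2)"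
    if "m \<ge> k" for m k
    using nn_integral_norm_sq[OF square_integrable_diff[OF sq[of m] sq[of k]]] dY[OF that]
    by (auto simp: Y abs_L2_diff[OF sq sq] intro!: ennreal_leI power_mono)
  have "AE x in \<mu>. (\<Sum>k. ennreal (norm (f (Suc k) x - f k x))) \<noteq> \<infinity>"
  proof (rule nn_integral_PInf_AE)
    have le: "(\<integral>\<^sup>+x. ennreal (norm (f (Suc k) x - f k x)) \<partial>\<mu>) \<le> ennreal ((measure \<mu> UNIV + 1) * (1/2)^k)" for k
    proof -
      define e :: real where "e = (1/2)^k"
      have e: "e > 0" by (simp add: e_def)
      have am: "t \<le> e + t\<^sup>2 / e" for t :: real
      proof (cases "t \<le> e")
        case True then show ?thesis using e by (smt (verit) zero_le_power2 divide_nonneg_pos)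
      next
        case False
        then have "t * e \<le> t\<^sup>2" using e by (simp add: power2_eq_square)
        then have "t \<le> t\<^sup>2 / e" using e by (simp add: pos_le_divide_eq)
        then show ?thesis using e by simp
      qed
      have "(\<integral>\<^sup>+x. ennreal (norm (f (Suc k) x - f k x)) \<partial>\<mu>)
          \<le> (\<integral>\<^sup>+x. ennreal e + ennreal (1/e) * ennreal ((norm (f (Suc k) x - f k x))\<^sup>2) \<partial>\<mu>)"
      proof (rule nn_integral_mono)
        fix x
        have "ennreal (norm (f (Suc k) x - f k x)) \<le> ennreal (e + 1/e * (norm (f (Suc k) x - f k x))\<^sup>2)"
          using am[of "norm (f (Suc k) x - f k x)"] by (intro ennreal_leI) simp
        also have "\<dots> = ennreal e + ennreal (1/e) * ennreal ((norm (f (Suc k) x - f k x))\<^sup>2)"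
          using e by (subst ennreal_plus) (auto simp: ennreal_mult[symmetric])
        finally show "ennreal (norm (f (Suc k) x - f k x)) \<le> \<dots>" .
      qed
      also have "\<dots> = ennreal e * emeasure \<mu> UNIV + ennreal (1/e) * (\<integral>\<^sup>+x. ennreal ((norm (f (Suc k) x - f k x))\<^sup>2) \<partial>\<mu>)"
        by (subst nn_integral_add) (auto simp: nn_integral_cmult)
      also have "\<dots> \<le> ennreal e * emeasure \<mu> UNIV + ennreal (1/e) * ennreal (e\<^sup>2)"
        using d_int[of k "Suc k"] unfolding e_def by (intro add_left_mono mult_left_mono) auto
      also have "\<dots> = ennreal ((measure \<mu> UNIV + 1) * e)"
        using e by (simp add: \<mu>.emeasure_eq_measure ennreal_mult[symmetric] power2_eq_square algebra_simps
            flip: ennreal_plus)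
      finally show ?thesis by (simp add: e_def)
    qed
    have "(\<integral>\<^sup>+x. (\<Sum>k. ennreal (norm (f (Suc k) x - f k x))) \<partial>\<mu>)
        = (\<Sum>k. \<integral>\<^sup>+x. ennreal (norm (f (Suc k) x - f k x)) \<partial>\<mu>)"
      by (rule nn_integral_suminf) measurable
    also have "\<dots> \<le> (\<Sum>k. ennreal ((measure \<mu> UNIV + 1) * (1/2)^k))"
      by (intro suminf_le le summableI)
    also have "\<dots> < \<infinity>"
    proof -
      have "summable (\<lambda>k. (measure \<mu> UNIV + 1) * (1/2::real)^k)"
        by (intro summable_mult summable_geometric) simp
      then show ?thesis by (simp add: suminf_ennreal2)
    qed
    finally show "(\<integral>\<^sup>+x. (\<Sum>k. ennreal (norm (f (Suc k) x - f k x))) \<partial>\<mu>) \<noteq> \<infinity>" by simp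
  qed measurable
  then have conv: "AE x in \<mu>. (\<lambda>k. f k x) \<longlonglongrightarrow> lim (\<lambda>k. f k x)"
  proof eventually_elim
    case (elim x)
    then have "summable (\<lambda>k. norm (f (Suc k) x - f k x))"
      by (intro summable_suminf_not_top) auto
    then have "summable (\<lambda>k. f (Suc k) x - f k x)" by (rule summable_norm_cancel)
    then have "convergent (\<lambda>n. \<Sum>k<n. f (Suc k) x - f k x)"
      by (simp add: summable_iff_convergent)
    then have "convergent (\<lambda>n. f n x - f 0 x)" by (simp only: sum_lessThan_telescope[of "\<lambda>n. f n x"])
    then have "convergent (\<lambda>n. f n x)"
      using convergent_diff_const_right_iff[of "\<lambda>n. f n x" "f 0 x"] by simp
    then show ?case by (simp add: convergent_LIMSEQ_iff)
  qed
  define g where "g = (\<lambda>x. lim (\<lambda>k. f k x))"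
  have g_meas [measurable]: "g \<in> borel_measurable borel" unfolding g_def by measurable
  have fatou: "(\<integral>\<^sup>+x. ennreal ((norm (g x - f k x))\<^sup>2) \<partial>\<mu>) \<le> ennreal (((1/2)^k)\<^sup>2)" for k
  proof -
    have "(\<integral>\<^sup>+x. ennreal ((norm (g x - f k x))\<^sup>2) \<partial>\<mu>)
        = (\<integral>\<^sup>+x. liminf (\<lambda>m. ennreal ((norm (f m x - f k x))\<^sup>2)) \<partial>\<mu>)"
    proof (intro nn_integral_cong_AE, use conv in eventually_elim)
      case (elim x)
      then have "(\<lambda>m. ennreal ((norm (f m x - f k x))\<^sup>2)) \<longlonglongrightarrow> ennreal ((norm (g x - f k x))\<^sup>2)"
        unfolding g_def by (intro tendsto_ennrealI tendsto_intros)
      from lim_imp_Liminf[OF _ this] show ?case by simp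
    qed
    also have "\<dots> \<le> liminf (\<lambda>m. \<integral>\<^sup>+x. ennreal ((norm (f m x - f k x))\<^sup>2) \<partial>\<mu>)"
      by (rule nn_integral_liminf) measurable
    also have "\<dots> \<le> liminf (\<lambda>m. ennreal (((1/2)^k)\<^sup>2))"
      by (intro Liminf_mono eventually_sequentiallyI[of k] d_int)
    also have "\<dots> = ennreal (((1/2)^k)\<^sup>2)" by (simp add: Liminf_const)
    finally show ?thesis .
  qed
  have sqd: "square_integrable (\<lambda>x. g x - f k x)" for k
    by (rule square_integrable_bounded_by[OF _ fatou[of k]]) measurable
  have sqg: "square_integrable g"
    using square_integrable_add[OF sqd[of 0] sq[of 0]] by simp
  have bound: "norm (abs_L2 g - Y k) \<le> (1/2)^k" for k
  proof -
    have "ennreal ((norm (abs_L2 g - Y k))\<^sup>2) \<le> ennreal (((1/2)^k)\<^sup>2)"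
      using fatou[of k] nn_integral_norm_sq[OF sqd[of k]] by (simp add: Y abs_L2_diff[OF sqg sq])
    then have "(norm (abs_L2 g - Y k))\<^sup>2 \<le> ((1/2)^k)\<^sup>2" by (simp add: ennreal_le_iff)
    then show ?thesis by (rule power2_le_imp_le) simp
  qed
  have "X \<longlonglongrightarrow> abs_L2 g"
  proof (rule LIMSEQ_I)
    fix e :: real assume "e > 0"
    then obtain k where k: "(1/2)^k < e / 2"
      using real_arch_pow_inv[of "e/2" "1/2"] by auto
    have "norm (X n - abs_L2 g) < e" if "n \<ge> r k" for n
    proof -
      have "norm (X n - abs_L2 g) \<le> norm (X n - Y k) + norm (Y k - abs_L2 g)"
        using norm_triangle_ineq[of "X n - Y k" "Y k - abs_L2 g"] by simp
      also have "\<dots> < e"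
        using r[OF that] bound[of k] k by (simp add: Y_def norm_minus_commute)
      finally show ?thesis .
    qed
    then show "\<exists>N. \<forall>n\<ge>N. norm (X n - abs_L2 g) < e" by blast
  qed
  then show "convergent X" by (rule convergentI)
qed

lemma square_integrable_indicator:
  "A \<in> sets borel \<Longrightarrow> square_integrable (\<lambda>x. indicator A x *\<^sub>R c)"
proof -
  assume A: "A \<in> sets borel"
  have "(\<lambda>x. (norm (indicator A x *\<^sub>R c))\<^sup>2) = (\<lambda>x. indicator A x * (norm c)\<^sup>2)"
    by (auto simp: indicator_def)
  then show ?thesis
    using A by (simp add: square_integrable_def \<mu>.emeasure_eq_measure)
qed

lemma norm_abs_L2_indicator:
  assumes "A \<in> sets borel"
  shows "(norm (abs_L2 (\<lambda>x. indicator A x *\<^sub>R c)))\<^sup>2 = measure \<mu> A * (norm c)\<^sup>2"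
proof -
  have "(\<lambda>x. (norm (indicator A x *\<^sub>R c))\<^sup>2) = (\<lambda>x. indicator A x * (norm c)\<^sup>2)"
    by (auto simp: indicator_def)
  then show ?thesis
    using assms by (simp add: norm_abs_L2_sq square_integrable_indicator)
qed

text \<open>Separability: rational combinations of indicators of finite unions of basic open sets.\<close>

lemma separable_L2: "\<exists>D :: L2 set. countable D \<and> closure D = UNIV"
proof -
  obtain B :: "(real^3) set set" where B: "countable B" "topological_basis B"
    using ex_countable_basis by blast
  define I where "I = (\<lambda>(A, c). abs_L2 (\<lambda>x. indicator A x *\<^sub>R (c::complex)))"
  define G where "G = I ` ((Union ` {F. finite F \<and> F \<subseteq> B}) \<times> {1, \<i>})"
  define lc where "lc = (\<lambda>l. \<Sum>(q, b)\<leftarrow>l. q *\<^sub>R (b::L2))"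
  define D where "D = lc ` lists (\<rat> \<times> G)"
  have cG: "countable G"
    unfolding G_def using B(1) by (intro countable_image countable_SIGMA countable_Collect_finite_subset) auto
  have cD: "countable D"
    unfolding D_def using cG by (intro countable_image countable_lists countable_SIGMA countable_rat)
  define K where "K = closure D"
  have K_lim: "x \<in> K" if "\<And>e. e > 0 \<Longrightarrow> \<exists>y\<in>K. norm (y - x) < e" for x
    using that closure_approachable[of x "closure D"] by (simp add: K_def dist_norm)
  have K_tendsto: "x \<in> K" if F: "(\<lambda>n::nat. norm (F n - x)) \<longlonglongrightarrow> 0" "\<And>n. F n \<in> K" for F x
  proof (rule K_lim)
    fix e :: real assume "e > 0"
    then obtain n where "norm (F n - x) < e"
      using LIMSEQ_D[OF F(1), of e] by auto
    then show "\<exists>y\<in>K. norm (y - x) < e" using F(2) by blast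
  qed
  have D_add: "x + y \<in> D" if xy: "x \<in> D" "y \<in> D" for x y
  proof -
    obtain l where "x = lc l" "l \<in> lists (\<rat> \<times> G)" using xy(1) unfolding D_def by (rule imageE)
    moreover obtain m where "y = lc m" "m \<in> lists (\<rat> \<times> G)" using xy(2) unfolding D_def by (rule imageE)
    ultimately have "x + y = lc (l @ m)" "l @ m \<in> lists (\<rat> \<times> G)" by (auto simp: lc_def)
    then show ?thesis unfolding D_def by blast
  qed
  have D_scale: "q *\<^sub>R x \<in> D" if xq: "x \<in> D" "q \<in> \<rat>" for x q
  proof -
    obtain l where l: "x = lc l" "l \<in> lists (\<rat> \<times> G)"
      using xq(1) unfolding D_def by (rule imageE)
    have "q *\<^sub>R lc l = lc (map (\<lambda>(p, b). (q * p, b)) l)"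
      by (induction l) (auto simp: lc_def scaleR_add_right)
    moreover have "map (\<lambda>(p, b). (q * p, b)) l \<in> lists (\<rat> \<times> G)"
      using l(2) xq(2) by (auto simp: in_lists_conv_set Rats_mult)
    ultimately show ?thesis unfolding D_def l(1) by blast
  qed
  have K_add: "x + y \<in> K" if xy: "x \<in> K" "y \<in> K" for x y
  proof -
    obtain a b where "\<forall>n. a n \<in> D" "a \<longlonglongrightarrow> x" "\<forall>n. b n \<in> D" "b \<longlonglongrightarrow> y"
      using xy unfolding K_def closure_sequential by blast
    then show ?thesis unfolding K_def closure_sequential
      by (intro exI[of _ "\<lambda>n. a n + b n"]) (auto intro!: D_add tendsto_add)
  qed
  have K_scale: "r *\<^sub>R x \<in> K" if x: "x \<in> K" for x r
  proof -
    obtain a where a: "\<forall>n. a n \<in> D" "a \<longlonglongrightarrow> x"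
      using x unfolding K_def closure_sequential by blast
    have "r \<in> closure \<rat>" by (simp add: Rats_closure_real)
    then obtain q where q: "\<forall>n. q n \<in> \<rat>" "q \<longlonglongrightarrow> r"
      unfolding closure_sequential by blast
    show ?thesis unfolding K_def closure_sequential
      by (intro exI[of _ "\<lambda>n. q n *\<^sub>R a n"]) (use a q in \<open>auto intro!: D_scale tendsto_scaleR\<close>)
  qed
  have G_K: "G \<subseteq> K"
  proof
    fix g assume "g \<in> G"
    then have "lc [(1, g)] \<in> D" unfolding D_def by (intro imageI) auto
    then show "g \<in> K" using closure_subset[of D] by (auto simp: K_def lc_def)
  qed
  have zero_K: "0 \<in> K"
  proof -
    have "lc [] \<in> D" unfolding D_def by (intro imageI) auto
    then show ?thesis using closure_subset[of D] by (auto simp: K_def lc_def)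
  qed
  have I_diff: "norm (I (A, c) - I (A', c)) = sqrt (measure \<mu> (A' - A))"
    if "A \<subseteq> A'" "A \<in> sets borel" "A' \<in> sets borel" "norm c = 1" for A A' c
  proof -
    have "norm (I (A, c) - I (A', c)) = norm (I (A', c) - I (A, c))" by (rule norm_minus_commute)
    also have "I (A', c) - I (A, c) = abs_L2 (\<lambda>x. indicator (A' - A) x *\<^sub>R c)"
    proof -
      have "(\<lambda>x. indicator A' x *\<^sub>R c - indicator A x *\<^sub>R c) = (\<lambda>x. indicator (A' - A) x *\<^sub>R c)"
        using that(1) by (auto simp: fun_eq_iff indicator_def)
      then show ?thesis
        using that by (simp add: I_def abs_L2_diff square_integrable_indicator)
    qed
    also have "norm \<dots> = sqrt ((norm \<dots>)\<^sup>2)" by simp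
    also have "\<dots> = sqrt (measure \<mu> (A' - A))"
      using that by (subst norm_abs_L2_indicator) auto
    finally show ?thesis .
  qed
  have open_K: "I (U, c) \<in> K" if U: "open U" and c: "c \<in> {1, \<i>}" for U c
  proof (cases "U = {}")
    case True
    have "I ({}, c) \<in> G" unfolding G_def using c by (intro imageI) auto
    then show ?thesis using True G_K by auto
  next
    case False
    obtain B' where B': "B' \<subseteq> B" "\<Union>B' = U"
      using B(2) U unfolding topological_basis_def by blast
    have ne: "B' \<noteq> {}" using False B'(2) by auto
    have cB': "countable B'" using B' B(1) countable_subset by blast
    define V where "V = (\<lambda>n. \<Union>(from_nat_into B' ` {..n}))"
    have V_sets: "V n \<in> sets borel" for n
    proof -
      have "from_nat_into B' i \<in> sets borel" for i
        using from_nat_into[OF ne, of i] B'(1) B(2) by (auto simp: topological_basis_open)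
      then show ?thesis unfolding V_def by auto
    qed
    have V_U: "(\<Union>n. V n) = U"
    proof -
      have "(\<Union>n. V n) = \<Union>(range (from_nat_into B'))" by (auto simp: V_def)
      then show ?thesis using range_from_nat_into[OF ne cB'] B' by simp
    qed
    have "(\<lambda>n. measure \<mu> (V n)) \<longlonglongrightarrow> measure \<mu> (\<Union>n. V n)"
    proof (rule \<mu>.finite_Lim_measure_incseq)
      show "range V \<subseteq> sets \<mu>" using V_sets by auto
      show "incseq V" unfolding incseq_def V_def by (intro allI impI Union_mono image_mono) auto
    qed
    then have lim: "(\<lambda>n. measure \<mu> (V n)) \<longlonglongrightarrow> measure \<mu> U" by (simp add: V_U)
    have "(\<lambda>n. sqrt (measure \<mu> U - measure \<mu> (V n))) \<longlonglongrightarrow> sqrt (measure \<mu> U - measure \<mu> U)"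
      by (intro tendsto_intros lim)
    moreover have "norm (I (V n, c) - I (U, c)) = sqrt (measure \<mu> U - measure \<mu> (V n))" for n
    proof -
      have "V n \<subseteq> U" using V_U by blast
      moreover have "norm c = 1" using c by auto
      ultimately show ?thesis
        using V_sets U by (simp add: I_diff \<mu>.finite_measure_Diff)
    qed
    ultimately have "(\<lambda>n. norm (I (V n, c) - I (U, c))) \<longlonglongrightarrow> 0" by simp
    moreover have "I (V n, c) \<in> K" for n
    proof -
      have "from_nat_into B' ` {..n} \<subseteq> B" using from_nat_into[OF ne] B'(1) by auto
      then have "V n \<in> Union ` {F. finite F \<and> F \<subseteq> B}" unfolding V_def by (intro imageI) auto
      then have "I (V n, c) \<in> G" using c unfolding G_def by blast
      then show ?thesis using G_K by blast
    qed
    ultimately show ?thesis by (rule K_tendsto)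
  qed
  have borel_K: "I (A, c) \<in> K" if A: "A \<in> sets borel" and c: "c \<in> {1, \<i>}" for A c
  proof (rule K_lim)
    fix e :: real assume e: "e > 0"
    have "emeasure \<mu> A = (INF U\<in>{U. A \<subseteq> U \<and> open U}. emeasure \<mu> U)"
      using A by (intro outer_regular) auto
    moreover have "emeasure \<mu> A < emeasure \<mu> A + ennreal (e\<^sup>2)"
      using e by (simp add: \<mu>.emeasure_eq_measure ennreal_less_iff flip: ennreal_plus)
    ultimately have "(INF U\<in>{U. A \<subseteq> U \<and> open U}. emeasure \<mu> U) < emeasure \<mu> A + ennreal (e\<^sup>2)" by simp
    then obtain U where U: "A \<subseteq> U" "open U" "emeasure \<mu> U < emeasure \<mu> A + ennreal (e\<^sup>2)"
      unfolding INF_less_iff by blast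
    then have "ennreal (measure \<mu> U) < ennreal (measure \<mu> A + e\<^sup>2)"
      by (simp add: \<mu>.emeasure_eq_measure)
    then have "measure \<mu> U < measure \<mu> A + e\<^sup>2"
      by (simp add: ennreal_less_iff del: ennreal_plus)
    then have "measure \<mu> (U - A) < e\<^sup>2"
      using U A by (simp add: \<mu>.finite_measure_Diff)
    then have "sqrt (measure \<mu> (U - A)) < e"
      using e by (simp add: real_less_lsqrt)
    then have "norm (I (U, c) - I (A, c)) < e"
      using U A c I_diff[of A U c] by (auto simp: norm_minus_commute)
    then show "\<exists>y\<in>K. norm (y - I (A, c)) < e" using open_K[OF U(2) c] by blast
  qed
  have ind_K: "abs_L2 (\<lambda>x. indicator A x *\<^sub>R c) \<in> K" if A: "A \<in> sets borel" for A c
  proof -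
    have eq: "(\<lambda>x. indicator A x *\<^sub>R c) = (\<lambda>x. Re c *\<^sub>R (indicator A x *\<^sub>R 1) + Im c *\<^sub>R (indicator A x *\<^sub>R \<i>))"
      by (auto simp: indicator_def complex_eq_iff)
    have "abs_L2 (\<lambda>x. indicator A x *\<^sub>R c) = Re c *\<^sub>R I (A, 1) + Im c *\<^sub>R I (A, \<i>)"
    proof -
      note sq = square_integrable_indicator[OF A]
      have "Re c *\<^sub>R I (A, 1) + Im c *\<^sub>R I (A, \<i>) =
          abs_L2 (\<lambda>x. Re c *\<^sub>R (indicator A x *\<^sub>R 1) + Im c *\<^sub>R (indicator A x *\<^sub>R \<i>))"
        unfolding I_def split_conv abs_L2_scaleR[OF sq]
        by (rule abs_L2_add) (intro square_integrable_scaleR sq)+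
      then show ?thesis by (simp only: eq[symmetric])
    qed
    then show ?thesis using borel_K[OF A] by (auto intro!: K_add K_scale)
  qed
  have sum_K: "square_integrable (\<lambda>x. \<Sum>y\<in>S. indicator (A y) x *\<^sub>R y) \<and>
      abs_L2 (\<lambda>x. \<Sum>y\<in>S. indicator (A y) x *\<^sub>R y) \<in> K"
    if "finite S" "\<And>y. y \<in> S \<Longrightarrow> A y \<in> sets borel" for S :: "complex set" and A
    using that
  proof (induction S)
    case empty
    have "abs_L2 (\<lambda>_. 0) = 0" by (simp add: zero_L2_def)
    then show ?case using zero_K by (simp add: square_integrable_const)
  next
    case (insert y S)
    define h where "h = (\<lambda>x. \<Sum>y\<in>S. indicator (A y) x *\<^sub>R y)"
    have h: "square_integrable h" "abs_L2 h \<in> K"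
      using insert unfolding h_def by auto
    have y: "square_integrable (\<lambda>x. indicator (A y) x *\<^sub>R y)"
      using insert by (intro square_integrable_indicator) auto
    have "(\<lambda>x. \<Sum>y\<in>insert y S. indicator (A y) x *\<^sub>R y) = (\<lambda>x. indicator (A y) x *\<^sub>R y + h x)"
      unfolding h_def by (rule ext, rule sum.insert) (rule insert.hyps)+
    moreover have "abs_L2 (\<lambda>x. indicator (A y) x *\<^sub>R y + h x) \<in> K"
      unfolding abs_L2_add[OF y h(1), symmetric]
      using insert.prems by (intro K_add h(2) ind_K) auto
    ultimately show ?case using square_integrable_add[OF y h(1)] by (simp only: simp_thms)
  qed
  have "u \<in> K" for u
  proof (cases u rule: L2_cases)
    case (abs f)
    then have [measurable]: "f \<in> borel_measurable \<mu>" by (simp add: square_integrable_def)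
    obtain F where F: "\<And>i. simple_function \<mu> (F i)" "\<And>x. (\<lambda>i. F i x) \<longlonglongrightarrow> f x"
        "\<And>i x. norm (F i x) \<le> 2 * norm (f x)"
      using borel_measurable_implies_sequence_metric[of f \<mu> 0] by (auto simp: dist_norm)
    have [measurable]: "F i \<in> borel_measurable \<mu>" for i
      using F(1) by (rule borel_measurable_simple_function)
    have FK: "square_integrable (F i) \<and> abs_L2 (F i) \<in> K" for i
    proof -
      have eq: "F i = (\<lambda>x. \<Sum>y \<in> F i ` UNIV. indicator (F i -` {y}) x *\<^sub>R y)"
        using simple_function_indicator_representation_banach[OF F(1)[of i]]
        by (intro ext) (simp only: space_\<mu> Int_UNIV_right UNIV_I)
      have "finite (F i ` UNIV)" using simple_functionD(1)[OF F(1)[of i]] by simp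
      moreover have "F i -` {y} \<in> sets borel" for y
        using simple_functionD(2)[OF F(1)[of i], of "{y}"] by simp
      ultimately show ?thesis using sum_K[of "F i ` UNIV" "\<lambda>y. F i -` {y}"]
        by (simp only: eq[symmetric])
    qed
    have "(\<lambda>i. \<integral>x. (norm (F i x - f x))\<^sup>2 \<partial>\<mu>) \<longlonglongrightarrow> (\<integral>x. 0 \<partial>\<mu>)"
    proof (rule integral_dominated_convergence[where w="\<lambda>x. 9 * (norm (f x))\<^sup>2"])
      show "integrable \<mu> (\<lambda>x. 9 * (norm (f x))\<^sup>2)" using abs by (auto simp: square_integrable_def)
      show "AE x in \<mu>. (\<lambda>i. (norm (F i x - f x))\<^sup>2) \<longlonglongrightarrow> 0"
      proof (rule AE_I2)
        fix x
        have "(\<lambda>i. (norm (F i x - f x))\<^sup>2) \<longlonglongrightarrow> (norm (f x - f x))\<^sup>2"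
          by (intro tendsto_intros F(2))
        then show "(\<lambda>i. (norm (F i x - f x))\<^sup>2) \<longlonglongrightarrow> 0" by simp
      qed
      show "AE x in \<mu>. norm ((norm (F i x - f x))\<^sup>2) \<le> 9 * (norm (f x))\<^sup>2" for i
      proof (rule AE_I2)
        fix x
        have "norm (F i x - f x) \<le> 3 * norm (f x)"
          using F(3)[of i x] norm_triangle_ineq4[of "F i x" "f x"] by simp
        then have "(norm (F i x - f x))\<^sup>2 \<le> (3 * norm (f x))\<^sup>2" by (intro power_mono) auto
        then show "norm ((norm (F i x - f x))\<^sup>2) \<le> 9 * (norm (f x))\<^sup>2" by (simp add: power_mult_distrib)
      qed
    qed measurable
    then have "(\<lambda>i. sqrt (\<integral>x. (norm (F i x - f x))\<^sup>2 \<partial>\<mu>)) \<longlonglongrightarrow> sqrt 0"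
      by (intro tendsto_real_sqrt) simp
    then have "(\<lambda>i. norm (abs_L2 (F i) - u)) \<longlonglongrightarrow> 0"
    proof -
      have "norm (abs_L2 (F i) - u) = sqrt (\<integral>x. (norm (F i x - f x))\<^sup>2 \<partial>\<mu>)" for i
        unfolding abs(2) abs_L2_diff[OF conjunct1[OF FK] abs(1)]
        by (rule norm_abs_L2[OF square_integrable_diff[OF conjunct1[OF FK] abs(1)]])
      then show ?thesis using \<open>(\<lambda>i. sqrt (\<integral>x. (norm (F i x - f x))\<^sup>2 \<partial>\<mu>)) \<longlonglongrightarrow> sqrt 0\<close> by simp
    qed
    then show ?thesis by (rule K_tendsto) (use FK in blast)
  qed
  then show ?thesis using cD unfolding K_def by blast
qed

instance L2 :: second_countable_topology
proof
  obtain D :: "L2 set" where D: "countable D" "closure D = UNIV"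
    using separable_L2 by blast
  define B where "B = (\<lambda>(d, q). ball d q) ` (D \<times> (\<rat> \<inter> {0<..}))"
  have B: "countable B" unfolding B_def using D(1)
    by (intro countable_image countable_SIGMA) (auto intro: countable_subset[OF _ countable_rat])
  have "topological_basis B"
  proof (rule topological_basisI)
    show "open b" if "b \<in> B" for b using that by (auto simp: B_def)
    fix U :: "L2 set" and x assume U: "open U" "x \<in> U"
    then obtain e where e: "e > 0" "ball x e \<subseteq> U" using open_contains_ball by blast
    obtain q where q: "q \<in> \<rat>" "0 < q" "q < e / 2" using Rats_dense_in_real[of 0 "e/2"] e by auto
    obtain d where d: "d \<in> D" "dist d x < q"
      using D(2) q closure_approachable[of x D] by blast
    have "ball d q \<subseteq> U"
    proof
      fix y assume "y \<in> ball d q"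
      then have "dist x y < e" using d q dist_triangle[of x y d] by (simp add: dist_commute)
      then show "y \<in> U" using e by auto
    qed
    then show "\<exists>b\<in>B. x \<in> b \<and> b \<subseteq> U"
      using d q by (intro bexI[of _ "ball d q"]) (auto simp: B_def)
  qed
  then show "\<exists>B::L2 set set. countable B \<and> open = generate_topology B"
    using B topological_basis_imp_subbasis by blast
qed

text \<open>
  Since the sphere is a closed submanifold, \<open>C\<^sup>\<infinity>(S\<^sup>2)\<close> consists of the restrictions of smooth
  functions on \<open>real^3\<close>. Elements of \<open>C\<^sup>\<infinity>(S\<^sup>2)\<close> are represented by such extensions; below, only
  their values on the sphere enter, because \<^const>\<open>\<mu>\<close> is concentrated there and the
  vector fields are tangent to it.
\<close>

definition pd :: "3 \<Rightarrow> (real^3 \<Rightarrow> complex) \<Rightarrow> real^3 \<Rightarrow> complex" where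
  "pd i F x = frechet_derivative F (at x) (axis i 1)"

definition smooth :: "(real^3 \<Rightarrow> complex) \<Rightarrow> bool" where
  "smooth F \<longleftrightarrow> (\<forall>is. foldr pd is F differentiable_on UNIV)"

definition vecX :: "(real^3 \<Rightarrow> complex) \<Rightarrow> real^3 \<Rightarrow> complex" where
  "vecX F x = - (x $ 3) *\<^sub>R pd 2 F x + (x $ 2) *\<^sub>R pd 3 F x"

definition vecY :: "(real^3 \<Rightarrow> complex) \<Rightarrow> real^3 \<Rightarrow> complex" where
  "vecY F x = - (x $ 3) *\<^sub>R pd 1 F x + (x $ 1) *\<^sub>R pd 3 F x"

definition is_formal_adjoint ::
    "((real^3 \<Rightarrow> complex) \<Rightarrow> real^3 \<Rightarrow> complex) \<Rightarrow> ((real^3 \<Rightarrow> complex) \<Rightarrow> real^3 \<Rightarrow> complex) \<Rightarrow> bool" where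
  "is_formal_adjoint P Q \<longleftrightarrow>
     (\<forall>F. smooth F \<longrightarrow> smooth (Q F)) \<and>
     (\<forall>F G. smooth F \<longrightarrow> smooth G \<longrightarrow>
        (\<integral>x. P F x * cnj (G x) \<partial>\<mu>) = (\<integral>x. F x * cnj (Q G x) \<partial>\<mu>))"

text \<open>The formal adjoint is determined on the sphere; the choice concerns only the extension off it.\<close>

definition formal_adjoint ::
    "((real^3 \<Rightarrow> complex) \<Rightarrow> real^3 \<Rightarrow> complex) \<Rightarrow> (real^3 \<Rightarrow> complex) \<Rightarrow> real^3 \<Rightarrow> complex" where
  "formal_adjoint P = (SOME Q. is_formal_adjoint P Q)"

definition L_smooth :: "(real^3 \<Rightarrow> complex) \<Rightarrow> real^3 \<Rightarrow> complex" where
  "L_smooth F x = - formal_adjoint vecX (vecX F) x - formal_adjoint vecY (vecY F) x"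

text \<open>
  Graph of the realization on the maximal domain: \<open>g = L u\<close> in the sense of distributions,
  where \<open>L\<close> is formally symmetric.
\<close>

definition L_graph :: "(L2 \<times> L2) set" where
  "L_graph = {(u, g). \<forall>F. smooth F \<longrightarrow>
     (\<integral>x. rep_L2 u x * cnj (L_smooth F x) \<partial>\<mu>) = (\<integral>x. rep_L2 g x * cnj (F x) \<partial>\<mu>)}"

definition C0_semigroup :: "(real \<Rightarrow> 'a \<Rightarrow> 'a::banach) \<Rightarrow> bool" where
  "C0_semigroup S \<longleftrightarrow>
     (\<forall>t\<ge>0. bounded_linear (S t)) \<and> S 0 = id \<and>
     (\<forall>s\<ge>0. \<forall>t\<ge>0. S (s + t) = S s \<circ> S t) \<and>
     (\<forall>f. ((\<lambda>t. S t f) \<longlongrightarrow> f) (at_right 0))"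

definition generator_graph :: "(real \<Rightarrow> 'a \<Rightarrow> 'a::banach) \<Rightarrow> ('a \<times> 'a) set" where
  "generator_graph S = {(f, g). ((\<lambda>t. (S t f - f) /\<^sub>R t) \<longlongrightarrow> g) (at_right 0)}"

text \<open>Only the values at times \<open>t \<ge> 0\<close> are determined by the generator.\<close>

definition semigroup_generated_by :: "('a \<times> 'a) set \<Rightarrow> real \<Rightarrow> 'a \<Rightarrow> 'a::banach" where
  "semigroup_generated_by A = (SOME S. C0_semigroup S \<and> generator_graph S = A)"

definition exp_L :: "real \<Rightarrow> L2 \<Rightarrow> L2" where
  "exp_L = semigroup_generated_by L_graph"

definition mult_indicator :: "(real^3) set \<Rightarrow> L2 \<Rightarrow> L2" where
  "mult_indicator \<omega> u = abs_L2 (\<lambda>x. indicator \<omega> x * rep_L2 u x)"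

definition square_integrable_in_time :: "real \<Rightarrow> (real \<Rightarrow> L2) \<Rightarrow> bool" where
  "square_integrable_in_time T u \<longleftrightarrow>
     set_borel_measurable lborel {0<..<T} u \<and>
     set_integrable lborel {0<..<T} (\<lambda>t. (norm (u t))\<^sup>2)"

definition supported_in :: "real \<Rightarrow> (real^3) set \<Rightarrow> (real \<Rightarrow> L2) \<Rightarrow> bool" where
  "supported_in T \<omega> u \<longleftrightarrow>
     (AE t in lborel. t \<in> {0<..<T} \<longrightarrow> (AE x in \<mu>. x \<notin> \<omega> \<longrightarrow> rep_L2 (u t) x = 0))"

definition duhamel :: "(real^3) set \<Rightarrow> L2 \<Rightarrow> (real \<Rightarrow> L2) \<Rightarrow> real \<Rightarrow> L2" where
  "duhamel \<omega> f\<^sub>0 u t =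
     exp_L t f\<^sub>0 + (LINT s:{0<..<t}|lborel. exp_L (t - s) (mult_indicator \<omega> (u s)))"

definition null_controllable :: "(real^3) set \<Rightarrow> real \<Rightarrow> bool" where
  "null_controllable \<omega> T \<longleftrightarrow>
     (\<forall>f\<^sub>0. \<exists>u. square_integrable_in_time T u \<and> supported_in T \<omega> u \<and> duhamel \<omega> f\<^sub>0 u T = 0)"

text \<open>Extended real, so that the infimum of the empty set is \<open>\<infinity>\<close>.\<close>

definition T_min :: "(real^3) set \<Rightarrow> ereal" where
  "T_min \<omega> = Inf (ereal ` {T. 0 < T \<and> null_controllable \<omega> T})"

definition control_region :: "real \<Rightarrow> real \<Rightarrow> (real^3) set" where
  "control_region \<alpha> \<beta> = {x \<in> S2. \<alpha> < \<bar>x $ 3\<bar> \<and> \<bar>x $ 3\<bar> < \<beta>}"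

end

theory Submission
  imports Defs "HOL-Computational_Algebra.Polynomial" "HOL-Real_Asymp.Real_Asymp"
begin

text \<open>
  On the sphere, the operator is \<open>\<Delta> - \<partial>\<^sub>\<phi>\<^sup>2\<close>. It is diagonal in the spherical harmonics
  \<open>(x\<^sub>1 \<plusminus> i x\<^sub>2)\<^sup>m p(x\<^sub>3)\<close>, where \<open>p\<close> is a Gegenbauer polynomial of degree \<open>k\<close>, with eigenvalues
  \<open>- (m + k (k + 2 m + 1))\<close>. Stone--Weierstrass yields completeness, so the semigroup is explicit.

  Lower bound: the eigenfunctions \<open>(x\<^sub>1 + i x\<^sub>2)\<^sup>m\<close> decay like \<open>e\<^sup>-\<^sup>m\<^sup>t\<close> and concentrate on the equator. Their
  relative mass on the control region is at most about \<open>(1 - \<alpha>\<^sup>2)\<^sup>m\<close>, so below the critical time no control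
  can cancel initial data whose coefficients on them decay at a slow geometric rate.

  Controllability for large times is a moment problem. Different angular momenta are orthogonal on the
  rotation invariant control region \<open>\<omega>\<close>. For fixed angular momentum the gaps of the eigenvalues grow
  quadratically, so there are functions \<open>\<sigma>\<^sub>j\<close> on a fixed time interval that are biorthogonal to the exponentials
  \<open>exp (- \<lambda>\<^sub>j t)\<close>, of size \<open>exp (C (1 + \<lambda>\<^sub>j))\<close>. The squared mass of the normalised eigenfunction \<open>e\<^sub>j\<close> on
  \<open>\<omega>\<close> is at least \<open>exp (- C (1 + \<lambda>\<^sub>j))\<close>, a Remez type estimate. Hence for \<open>T\<close> large the series
  \<open>u(s) = - \<Sum>\<^sub>j exp (- \<lambda>\<^sub>j T) \<langle>f, e\<^sub>j\<rangle> \<sigma>\<^sub>j(T - s) 1\<^sub>\<omega> e\<^sub>j / \<parallel>1\<^sub>\<omega> e\<^sub>j\<parallel>\<^sup>2\<close> converges and steers \<open>f\<close> to \<open>0\<close>.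
\<close>

section \<open>Polynomials\<close>

text \<open>Everything is paid for on the scale of the eigenvalue
  \<open>m + k (k + 2 m + 1)\<close>, which dominates \<open>m\<close>, \<open>k\<close> and
  \<open>k^2\<close>. The cost of biorthogonality and the inverse mass on the region may each be
  exponential in the eigenvalue, with a constant independent of the mode, because free decay over a
  long time absorbs both. This is why very crude estimates suffice, such as the factor
  \<open>2 ^ (k * k + 3 * k)\<close> in the mass bound, and why the threshold time is not sharp.
  What cannot be relaxed is uniformity in the angular momentum; the biorthogonal functions are
  therefore built from a lower bound for the gaps that all angular momenta share. A second obstacle
  is that the formal adjoints and the semigroup are given by choice. Adjoints are pinned down almost
  everywhere by testing. The semigroup is pinned down on eigenvectors only, where a telescoping
  argument works as soon as the operators are bounded near time \<open>0\<close>; this is the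
  purpose of the uniform boundedness principle. Completeness then extends the identification to the
  whole space.\<close>

lemma pcompose_diff_coeffs:
  fixes h :: real
  assumes "\<And>i. i > k \<Longrightarrow> coeff p i = 0"
  shows "(\<forall>i\<ge>k. coeff (pcompose p [:h, 1:] - p) i = 0) \<and>
    (\<forall>j. k = Suc j \<longrightarrow> coeff (pcompose p [:h, 1:] - p) j = real (Suc j) * h * coeff p k)"
  using assms
proof (induction p arbitrary: k)
  case 0
  then show ?case by simp
next
  case (pCons c q)
  define d where "d = pcompose q [:h, 1:] - q"
  \<comment> \<open>With \<open>p = c + x * q\<close>, shifting gives
    \<open>x * d + h * (q + d)\<close>. By induction \<open>x * d\<close> contributes
    \<open>j\<close> times \<open>h\<close> to the critical coefficient and \<open>h * q\<close>
    contributes one more, whence \<open>Suc j\<close>.\<close>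
  have eq: "pcompose (pCons c q) [:h, 1:] - pCons c q = pCons 0 d + smult h (q + d)"
    by (simp add: d_def pcompose_pCons algebra_simps)
  show ?case
  proof (cases k)
    case 0
    have "q = 0" by (rule poly_eqI) (use pCons.prems[of "Suc _"] 0 in simp)
    then show ?thesis using 0 by (simp add: pcompose_pCons)
  next
    case (Suc j)
    have q: "coeff q i = 0" if "i > j" for i using pCons.prems[of "Suc i"] Suc that by simp
    note IH = pCons.IH[of j, OF q, folded d_def]
    have "coeff (pCons 0 d + smult h (q + d)) i = 0" if "i \<ge> k" for i
      using that Suc q[of i] IH by (cases i) auto
    moreover have "coeff (pCons 0 d + smult h (q + d)) j = real (Suc j) * h * coeff (pCons c q) k"
      using IH Suc by (cases j) (auto simp: algebra_simps)
    ultimately show ?thesis using Suc unfolding eq by auto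
  qed
qed

text \<open>Induction on the degree: the difference \<open>p(x + h) - p(x)\<close> with \<open>h = (b - a) / 2\<close> has lower degree, a known leading coefficient,
  and a norm on \<open>[a, a + h]\<close> that is controlled by the norm of \<open>p\<close> on \<open>[a, b]\<close>.\<close>

lemma integral_poly_sq_ge:
  fixes a b :: real
  assumes "a < b" "\<And>i. i > k \<Longrightarrow> coeff p i = 0"
  shows "(coeff p k)\<^sup>2 * (b - a) ^ (2 * k + 1) / 2 ^ (k * k + 3 * k) \<le> integral {a..b} (\<lambda>x. (poly p x)\<^sup>2)"
  using assms
proof (induction k arbitrary: p b)
  case 0
  have "poly p x = coeff p 0" for x
  proof -
    have "p = [:coeff p 0:]" by (rule poly_eqI) (use 0 in \<open>auto simp: coeff_pCons split: nat.splits\<close>)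
    then obtain c where "p = [:c:]" by blast
    then show ?thesis by simp
  qed
  then show ?case using 0 by simp
next
  case (Suc k)
  define h where "h = (b - a) / 2"
  have h: "h > 0" and b: "b = a + 2 * h" using Suc.prems by (simp_all add: h_def field_simps)
  define q where "q = pcompose p [:h, 1:] - p"
  have pq: "poly q x = poly p (x + h) - poly p x" for x by (simp add: q_def poly_pcompose add.commute)
  have q: "\<And>i. i > k \<Longrightarrow> coeff q i = 0" "coeff q k = real (Suc k) * h * coeff p (Suc k)"
    using pcompose_diff_coeffs[of "Suc k" p h, OF Suc.prems(2)] by (auto simp: q_def)
  have int: "f integrable_on {c..d}" if "continuous_on UNIV f" for f :: "real \<Rightarrow> real" and c d
    using that by (intro integrable_continuous_interval) (auto intro: continuous_on_subset)
  have "integral {a..a+h} (\<lambda>x. (poly q x)\<^sup>2) \<le> integral {a..a+h} (\<lambda>x. 2 * (poly p (x + h))\<^sup>2 + 2 * (poly p x)\<^sup>2)"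
  proof (intro integral_le int continuous_intros)
    fix x
    show "(poly q x)\<^sup>2 \<le> 2 * (poly p (x + h))\<^sup>2 + 2 * (poly p x)\<^sup>2"
      using zero_le_power2[of "poly p (x + h) + poly p x"] by (simp add: pq power2_eq_square algebra_simps)
  qed
  also have "\<dots> = 2 * integral {a..a+h} (\<lambda>x. (poly p (x + h))\<^sup>2) + 2 * integral {a..a+h} (\<lambda>x. (poly p x)\<^sup>2)"
    by (subst integral_add) (auto intro!: int continuous_intros)
  also have "integral {a..a+h} (\<lambda>x. (poly p (x + h))\<^sup>2) = integral {a+h..b} (\<lambda>x. (poly p x)\<^sup>2)"
    using has_integral_shift_Icc_real[of "\<lambda>x. (poly p x)\<^sup>2" h _ a "a + h"]
      integrable_integral[OF int[of "\<lambda>x. (poly p x)\<^sup>2" "a+h" b]]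
    by (intro integral_unique) (simp add: b o_def continuous_intros add.commute)
  also have "2 * integral {a+h..b} (\<lambda>x. (poly p x)\<^sup>2) + 2 * integral {a..a+h} (\<lambda>x. (poly p x)\<^sup>2) = 2 * integral {a..b} (\<lambda>x. (poly p x)\<^sup>2)"
    using Henstock_Kurzweil_Integration.integral_combine[of a "a+h" b "\<lambda>x. (poly p x)\<^sup>2"] h
    by (simp add: b int continuous_intros)
  finally have up: "integral {a..a+h} (\<lambda>x. (poly q x)\<^sup>2) \<le> 2 * integral {a..b} (\<lambda>x. (poly p x)\<^sup>2)" .
  have "(coeff p (Suc k))\<^sup>2 * h ^ (2 * k + 3) \<le> (coeff q k)\<^sup>2 * h ^ (2 * k + 1)"
  proof -
    have "h ^ (2 * k + 3) = h\<^sup>2 * h ^ (2 * k + 1)" by (simp add: power2_eq_square power_add eval_nat_numeral)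
    moreover have "(coeff p (Suc k) * h)\<^sup>2 \<le> (real (Suc k) * (coeff p (Suc k) * h))\<^sup>2"
      unfolding power_mult_distrib[of "real (Suc k)"] using mult_right_mono[of 1 "(real (Suc k))\<^sup>2" "(coeff p (Suc k) * h)\<^sup>2"]
      by (simp add: one_le_power del: of_nat_Suc)
    ultimately show ?thesis using h unfolding q(2) by (simp add: power_mult_distrib mult_ac)
  qed
  then have "(coeff p (Suc k))\<^sup>2 * h ^ (2 * k + 3) / 2 ^ (k * k + 3 * k) \<le> (coeff q k)\<^sup>2 * h ^ (2 * k + 1) / 2 ^ (k * k + 3 * k)"
    by (intro divide_right_mono) auto
  also have "\<dots> \<le> 2 * integral {a..b} (\<lambda>x. (poly p x)\<^sup>2)"
    using Suc.IH[of "a + h" q] q h up by simp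
  finally have "(coeff p (Suc k))\<^sup>2 * h ^ (2 * k + 3) / 2 ^ (k * k + 3 * k) / 2 \<le> integral {a..b} (\<lambda>x. (poly p x)\<^sup>2)" by simp
  \<comment> \<open>The exponent \<open>k * k + 3 * k\<close> is made for this identity: it grows by
    \<open>2 * k + 4\<close>, of which \<open>2 * k + 3\<close> pay for the halved interval and one
    for the factor 2 in front of the integral.\<close>
  moreover have "(b - a) ^ (2 * Suc k + 1) / 2 ^ (Suc k * Suc k + 3 * Suc k) = h ^ (2 * k + 3) / 2 ^ (k * k + 3 * k) / 2"
    by (simp add: b power_mult_distrib power_add eval_nat_numeral)
  ultimately show ?case by (simp only: times_divide_eq_right[symmetric])
qed

section \<open>Gegenbauer polynomials as eigenvectors of a triangular operator\<close>

text \<open>What the operator on the sphere leaves behind when \<open>(x1 + i x2)^m\<close> or its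
  conjugate is split off: on the factor \<open>p(x3)\<close> it acts as
  \<open>gegenbauer_op m p - smult m p\<close>.\<close>

definition gegenbauer_op :: "nat \<Rightarrow> real poly \<Rightarrow> real poly" where
  "gegenbauer_op m p = [:1, 0, -1:] * pderiv (pderiv p) - smult (2 * (real m + 1)) ([:0, 1:] * pderiv p)"

definition kappa :: "nat \<Rightarrow> nat \<Rightarrow> real" where
  "kappa m k = real k * (real k + 2 * real m + 1)"

lemma coeff_gegenbauer_op:
  "coeff (gegenbauer_op m p) n = (real n + 2) * (real n + 1) * coeff p (n + 2) - kappa m n * coeff p n"
proof -
  have "[:1, 0, -1:] * q = q - pCons 0 (pCons 0 q)" for q :: "real poly" by (simp add: algebra_simps)
  then show ?thesis
    unfolding gegenbauer_op_def
    by (cases n; cases "n - 1") (auto simp: coeff_pderiv kappa_def algebra_simps eval_nat_numeral)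
qed

lemma gegenbauer_op_add: "gegenbauer_op m (p + q) = gegenbauer_op m p + gegenbauer_op m q"
  by (rule poly_eqI) (simp add: coeff_gegenbauer_op algebra_simps)

lemma kappa_strict_mono: "i < j \<Longrightarrow> kappa m i < kappa m j"
  unfolding kappa_def by (intro mult_strict_mono) auto

text \<open>In the monomial basis the operator is triangular with distinct diagonal entries
  \<open>- kappa m n\<close>, so after adding \<open>kappa m K\<close> it is invertible below degree
  \<open>K\<close>. The induction removes the top coefficient of the right-hand side.\<close>

lemma gegenbauer_solve:
  assumes "k \<le> K" "\<And>i. i \<ge> k \<Longrightarrow> coeff q i = 0"
  shows "\<exists>r. (\<forall>i\<ge>k. coeff r i = 0) \<and> gegenbauer_op m r + smult (kappa m K) r = q"
  using assms
proof (induction k arbitrary: q)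
  case 0
  then have "q = 0" by (intro poly_eqI) auto
  then show ?case by (intro exI[of _ 0]) (auto simp: gegenbauer_op_def)
next
  case (Suc k)
  define a where "a = coeff q k / (kappa m K - kappa m k)"
  define r0 where "r0 = monom a k"
  define q' where "q' = q - (gegenbauer_op m r0 + smult (kappa m K) r0)"
  have ne: "kappa m K - kappa m k \<noteq> 0" using kappa_strict_mono[of k K m] Suc.prems(1) by simp
  have a: "a * kappa m K = coeff q k + a * kappa m k"
    using ne by (simp add: a_def field_simps)
  have "coeff q' i = 0" if "i \<ge> k" for i
    using Suc.prems(2)[of i] that a
    by (cases "i = k") (auto simp: q'_def r0_def coeff_gegenbauer_op algebra_simps)
  then obtain r where r: "\<forall>i\<ge>k. coeff r i = 0" "gegenbauer_op m r + smult (kappa m K) r = q'"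
    using Suc.IH[of q'] Suc.prems(1) by auto
  have "\<forall>i\<ge>Suc k. coeff (r0 + r) i = 0" using r(1) by (auto simp: r0_def)
  moreover have "gegenbauer_op m (r0 + r) + smult (kappa m K) (r0 + r) = q"
    using r(2) by (simp add: q'_def gegenbauer_op_add smult_add_right algebra_simps)
  ultimately show ?case by blast
qed

lemma gegenbauer_poly_exists:
  "\<exists>p. coeff p k = 1 \<and> (\<forall>i>k. coeff p i = 0) \<and> gegenbauer_op m p = smult (- kappa m k) p"
proof -
  let ?x = "monom (1::real) k"
  define q where "q = - (gegenbauer_op m ?x + smult (kappa m k) ?x)"
  have "coeff q i = 0" if "i \<ge> k" for i
    using that by (cases "i = k") (auto simp: q_def coeff_gegenbauer_op)
  then obtain r where r: "\<forall>i\<ge>k. coeff r i = 0" "gegenbauer_op m r + smult (kappa m k) r = q"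
    using gegenbauer_solve[of k k q m] by auto
  have "gegenbauer_op m (?x + r) = smult (- kappa m k) (?x + r)"
    using r(2) by (simp add: q_def gegenbauer_op_add smult_add_right algebra_simps)
  then show ?thesis using r(1) by (intro exI[of _ "?x + r"]) auto
qed

text \<open>The classical Gegenbauer polynomial with parameter \<open>m + 1/2\<close>, scaled to be
  monic. The leading coefficient 1 is what feeds the lower bound for integrals of squares and the
  minimality of the norm.\<close>

definition gegenbauer :: "nat \<Rightarrow> nat \<Rightarrow> real poly" where
  "gegenbauer m k = (SOME p. coeff p k = 1 \<and> (\<forall>i>k. coeff p i = 0) \<and> gegenbauer_op m p = smult (- kappa m k) p)"

lemma
  shows coeff_gegenbauer_lead: "coeff (gegenbauer m k) k = 1"
    and coeff_gegenbauer_above: "i > k \<Longrightarrow> coeff (gegenbauer m k) i = 0"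
    and gegenbauer_eigen: "gegenbauer_op m (gegenbauer m k) = smult (- kappa m k) (gegenbauer m k)"
  using someI_ex[OF gegenbauer_poly_exists[of k m]] unfolding gegenbauer_def by auto

lemma gegenbauer_0: "gegenbauer m 0 = 1"
  by (rule poly_eqI) (use coeff_gegenbauer_lead[of m 0] coeff_gegenbauer_above[of 0 _ m] in \<open>auto simp: coeff_1\<close>)

lemma gegenbauer_span:
  assumes "\<And>i. i \<ge> n \<Longrightarrow> coeff q i = 0"
  shows "\<exists>c. q = (\<Sum>k<n. smult (c k) (gegenbauer m k))"
  using assms
proof (induction n arbitrary: q)
  case 0
  then have "q = 0" by (intro poly_eqI) auto
  then show ?case by simp
next
  case (Suc n)
  have "coeff (q - smult (coeff q n) (gegenbauer m n)) i = 0" if "i \<ge> n" for i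
    using Suc.prems[of i] that coeff_gegenbauer_lead[of m n] coeff_gegenbauer_above[of n i m]
    by (cases "i = n") auto
  from Suc.IH[OF this] obtain c where c: "q - smult (coeff q n) (gegenbauer m n) = (\<Sum>k<n. smult (c k) (gegenbauer m k))"
    by blast
  have "q = (\<Sum>k<Suc n. smult ((c(n := coeff q n)) k) (gegenbauer m k))"
  proof -
    have "(\<Sum>k<n. smult ((c(n := coeff q n)) k) (gegenbauer m k)) = (\<Sum>k<n. smult (c k) (gegenbauer m k))"
      by (rule sum.cong) auto
    then show ?thesis using c by (simp add: algebra_simps)
  qed
  then show ?case by blast
qed

lemma poly_gegenbauer_op:
  "poly (gegenbauer_op m p) x =
    (1 - x\<^sup>2) * poly (pderiv (pderiv p)) x - 2 * (real m + 1) * x * poly (pderiv p) x"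
  by (simp add: gegenbauer_op_def power2_eq_square algebra_simps)

section \<open>Biorthogonal families of exponentials\<close>

definition lap :: "(real \<Rightarrow> real) \<Rightarrow> real \<Rightarrow> real" where
  "lap f z = (LINT t|lborel. f t * exp (- z * t))"

text \<open>One constant for the sup norm and the Lipschitz constant, since convolution scales both
  alike. The Lipschitz part makes a delay by \<open>\<tau>\<close> change \<open>f\<close> only by
  \<open>O(\<tau>)\<close>, which lets infinitely many delays be composed.\<close>

definition lip_supp :: "real \<Rightarrow> real \<Rightarrow> (real \<Rightarrow> real) \<Rightarrow> bool" where
  "lip_supp B S f \<longleftrightarrow> (\<forall>t. \<bar>f t\<bar> \<le> B) \<and> (\<forall>s t. \<bar>f s - f t\<bar> \<le> B * \<bar>s - t\<bar>) \<and> (\<forall>t. t \<notin> {0..S} \<longrightarrow> f t = 0)"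

lemma lip_supp_continuous:
  assumes "lip_supp B S f" shows "continuous_on A f"
proof -
  have "B \<ge> 0" using assms unfolding lip_supp_def by (meson abs_ge_zero order_trans)
  then have "B-lipschitz_on A f"
    using assms by (auto simp: lipschitz_on_def lip_supp_def dist_real_def)
  then show ?thesis by (rule lipschitz_on_continuous_on)
qed

lemma lip_supp_mono:
  "lip_supp B S f \<Longrightarrow> B \<le> B' \<Longrightarrow> S \<le> S' \<Longrightarrow> lip_supp B' S' f"
  unfolding lip_supp_def by (meson abs_ge_zero atLeastAtMost_iff mult_right_mono order_trans)

lemma lip_supp_measurable: "lip_supp B S f \<Longrightarrow> f \<in> borel_measurable borel"
  by (intro borel_measurable_continuous_onI lip_supp_continuous)

lemma lip_supp_integrable:
  assumes "lip_supp B S f" shows "integrable lborel (\<lambda>t. f t * exp (- z * t))"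
proof -
  have "set_integrable lborel {0..S} (\<lambda>t. f t * exp (- z * t))"
    by (intro borel_integrable_atLeastAtMost' continuous_intros lip_supp_continuous[OF assms])
  moreover have "(\<lambda>t. indicator {0..S} t *\<^sub>R (f t * exp (- z * t))) = (\<lambda>t. f t * exp (- z * t))"
    by (intro ext) (use assms in \<open>auto simp: lip_supp_def indicator_def\<close>)
  ultimately show ?thesis unfolding set_integrable_def by simp
qed

text \<open>Convolution with the normalised signed measure \<open>\<delta>\<^sub>0 - e\<^sup>\<nu>\<^sup>\<tau> \<delta>\<^sub>\<tau>\<close>, which makes the moment at \<open>\<nu>\<close> vanish and
  preserves the moment at \<open>\<kappa>\<close>. As \<open>\<nu> \<rightarrow> \<infinity>\<close>, its mass tends to \<open>e\<^sup>\<kappa>\<^sup>\<tau>\<close>, so infinitely many of these can be composed.\<close>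

definition delay_op :: "real \<Rightarrow> real \<Rightarrow> real \<Rightarrow> (real \<Rightarrow> real) \<Rightarrow> real \<Rightarrow> real" where
  "delay_op \<nu> \<kappa> \<tau> f t = (f t - exp (\<nu> * \<tau>) * f (t - \<tau>)) / (1 - exp ((\<nu> - \<kappa>) * \<tau>))"

lemma lap_delay_op:
  assumes "lip_supp B S f"
  shows "lap (delay_op \<nu> \<kappa> \<tau> f) z = (1 - exp ((\<nu> - z) * \<tau>)) / (1 - exp ((\<nu> - \<kappa>) * \<tau>)) * lap f z"
proof -
  let ?g = "\<lambda>t. f t * exp (- z * t)"
  have i: "integrable lborel ?g" by (rule lip_supp_integrable[OF assms])
  have i2: "integrable lborel (\<lambda>t. ?g (t - \<tau>))"
    using lborel_integrable_real_affine[OF i, of 1 "- \<tau>"] by simp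
  have s: "(LINT t|lborel. ?g (t - \<tau>)) = lap f z"
    using lborel_integral_real_affine[of 1 ?g "- \<tau>"] by (simp add: lap_def)
  have "delay_op \<nu> \<kappa> \<tau> f t * exp (- z * t) =
      (?g t - exp ((\<nu> - z) * \<tau>) * ?g (t - \<tau>)) / (1 - exp ((\<nu> - \<kappa>) * \<tau>))" for t
  proof -
    have "exp ((\<nu> - z) * \<tau>) * exp (- z * (t - \<tau>)) = exp (\<nu> * \<tau>) * exp (- z * t)"
      by (simp add: mult_exp_exp algebra_simps)
    then show ?thesis by (simp add: delay_op_def algebra_simps diff_divide_distrib)
  qed
  then have "lap (delay_op \<nu> \<kappa> \<tau> f) z =
      (LINT t|lborel. (?g t - exp ((\<nu> - z) * \<tau>) * ?g (t - \<tau>)) / (1 - exp ((\<nu> - \<kappa>) * \<tau>)))"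
    unfolding lap_def by presburger
  also have "\<dots> = (LINT t|lborel. ?g t - exp ((\<nu> - z) * \<tau>) * ?g (t - \<tau>)) / (1 - exp ((\<nu> - \<kappa>) * \<tau>))"
    by (rule Bochner_Integration.integral_divide_zero)
  also have "(LINT t|lborel. ?g t - exp ((\<nu> - z) * \<tau>) * ?g (t - \<tau>)) = lap f z - exp ((\<nu> - z) * \<tau>) * lap f z"
    using i i2 s by (subst Bochner_Integration.integral_diff) (auto simp: lap_def)
  finally show ?thesis by (simp add: algebra_simps)
qed

text \<open>\<open>\<rho>\<close> bounds the total variation of the convolving measure, which
  multiplies sup norm and Lipschitz constant; its support in \<open>{0, \<tau>}\<close> lengthens
  the support of \<open>f\<close> by \<open>\<tau>\<close>.\<close>

lemma lip_supp_delay_op: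
  assumes f: "lip_supp B S f" and \<tau>: "\<tau> > 0" and ne: "\<nu> \<noteq> \<kappa>"
    and \<rho>: "1 + exp (\<nu> * \<tau>) \<le> \<rho> * \<bar>1 - exp ((\<nu> - \<kappa>) * \<tau>)\<bar>"
  shows "lip_supp (\<rho> * B) (S + \<tau>) (delay_op \<nu> \<kappa> \<tau> f)"
proof -
  let ?d = "1 - exp ((\<nu> - \<kappa>) * \<tau>)"
  have d: "\<bar>?d\<bar> > 0" using \<tau> ne by simp
  have bd: "\<bar>(a - exp (\<nu> * \<tau>) * b) / ?d\<bar> \<le> \<rho> * M" if "\<bar>a\<bar> \<le> M" "\<bar>b\<bar> \<le> M" for a b M
  proof -
    have "\<bar>a - exp (\<nu> * \<tau>) * b\<bar> \<le> \<bar>a\<bar> + exp (\<nu> * \<tau>) * \<bar>b\<bar>"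
      using abs_triangle_ineq4[of a "exp (\<nu> * \<tau>) * b"] by (simp add: abs_mult)
    also have "\<dots> \<le> M + exp (\<nu> * \<tau>) * M" using that by (intro add_mono mult_left_mono) auto
    also have "\<dots> = (1 + exp (\<nu> * \<tau>)) * M" by (simp add: algebra_simps)
    also have "\<dots> \<le> (\<rho> * \<bar>?d\<bar>) * M" using that \<rho> by (intro mult_right_mono) auto
    finally show ?thesis using d by (simp add: abs_divide divide_le_eq mult.commute mult.left_commute)
  qed
  have "\<bar>delay_op \<nu> \<kappa> \<tau> f t\<bar> \<le> \<rho> * B" for t
    unfolding delay_op_def using f by (intro bd) (auto simp: lip_supp_def)
  moreover have "\<bar>delay_op \<nu> \<kappa> \<tau> f s - delay_op \<nu> \<kappa> \<tau> f t\<bar> \<le> \<rho> * B * \<bar>s - t\<bar>" for s t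
  proof -
    have "delay_op \<nu> \<kappa> \<tau> f s - delay_op \<nu> \<kappa> \<tau> f t =
       ((f s - f t) - exp (\<nu> * \<tau>) * (f (s - \<tau>) - f (t - \<tau>))) / ?d"
      unfolding delay_op_def diff_divide_distrib[symmetric] by (simp add: algebra_simps)
    moreover have "\<bar>f (s - \<tau>) - f (t - \<tau>)\<bar> \<le> B * \<bar>s - t\<bar>" "\<bar>f s - f t\<bar> \<le> B * \<bar>s - t\<bar>"
      using f unfolding lip_supp_def by (metis diff_diff_eq2 diff_add_cancel)+
    ultimately show ?thesis using bd[of "f s - f t" "B * \<bar>s - t\<bar>" "f (s - \<tau>) - f (t - \<tau>)"]
      by (simp add: mult.assoc)
  qed
  moreover have "delay_op \<nu> \<kappa> \<tau> f t = 0" if "t \<notin> {0..S + \<tau>}" for t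
    using f that \<tau> unfolding lip_supp_def delay_op_def by auto
  ultimately show ?thesis by (auto simp: lip_supp_def)
qed

text \<open>The numerator of the difference is split into a pure delay, which is
  \<open>O(\<tau>)\<close> by the Lipschitz bound, and a multiple of \<open>f t\<close> by
  \<open>exp (\<nu> * \<tau>) * (1 - exp (- \<kappa> * \<tau>))\<close>, which is
  \<open>O(\<tau>)\<close> because \<open>1 - exp (- x) \<le> x\<close>.\<close>

lemma delay_op_diff:
  assumes f: "lip_supp B S f" and \<tau>: "\<tau> > 0" and ne: "\<nu> \<noteq> \<kappa>" and \<kappa>: "\<kappa> \<ge> 0"
    and \<rho>: "1 + exp (\<nu> * \<tau>) \<le> \<rho> * \<bar>1 - exp ((\<nu> - \<kappa>) * \<tau>)\<bar>"
  shows "\<bar>delay_op \<nu> \<kappa> \<tau> f t - f t\<bar> \<le> \<rho> * B * (1 + \<kappa>) * \<tau>"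
proof -
  let ?E = "exp (\<nu> * \<tau>)" and ?F = "exp ((\<nu> - \<kappa>) * \<tau>)"
  have d: "\<bar>1 - ?F\<bar> > 0" using \<tau> ne by simp
  have B: "B \<ge> 0" using f unfolding lip_supp_def by (meson abs_ge_zero order_trans)
  have "delay_op \<nu> \<kappa> \<tau> f t - f t = (?F * f t - ?E * f (t - \<tau>)) / (1 - ?F)"
    using d by (simp add: delay_op_def field_simps)
  also have "?F * f t - ?E * f (t - \<tau>) = ?E * (f t - f (t - \<tau>)) - (?E - ?F) * f t"
    by (simp add: algebra_simps)
  finally have eq: "\<bar>delay_op \<nu> \<kappa> \<tau> f t - f t\<bar> = \<bar>?E * (f t - f (t - \<tau>)) - (?E - ?F) * f t\<bar> / \<bar>1 - ?F\<bar>"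
    by (simp add: abs_divide)
  have E: "?E - ?F \<ge> 0" "?E - ?F \<le> ?E * (\<kappa> * \<tau>)"
  proof -
    have F: "?F = ?E * exp (- (\<kappa> * \<tau>))" by (simp add: mult_exp_exp algebra_simps)
    show "?E - ?F \<ge> 0" using \<kappa> \<tau> by (simp add: mult_right_mono)
    have "?E * (1 - \<kappa> * \<tau>) \<le> ?F" unfolding F using exp_ge_add_one_self[of "- (\<kappa> * \<tau>)"]
      by (intro mult_left_mono) auto
    then show "?E - ?F \<le> ?E * (\<kappa> * \<tau>)" by (simp add: algebra_simps)
  qed
  have "\<bar>?E * (f t - f (t - \<tau>)) - (?E - ?F) * f t\<bar> \<le> ?E * \<bar>f t - f (t - \<tau>)\<bar> + (?E - ?F) * \<bar>f t\<bar>"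
    using abs_triangle_ineq4[of "?E * (f t - f (t - \<tau>))" "(?E - ?F) * f t"] E by (simp add: abs_mult)
  also have "\<dots> \<le> ?E * (B * \<tau>) + (?E * (\<kappa> * \<tau>)) * B"
  proof (intro add_mono mult_left_mono mult_mono)
    have "\<bar>f t - f (t - \<tau>)\<bar> \<le> B * \<bar>t - (t - \<tau>)\<bar>" using f unfolding lip_supp_def by blast
    then show "\<bar>f t - f (t - \<tau>)\<bar> \<le> B * \<tau>" using \<tau> by simp
  qed (use f E \<kappa> \<tau> in \<open>auto simp: lip_supp_def\<close>)
  also have "\<dots> = ?E * (B * (1 + \<kappa>) * \<tau>)" by (simp add: algebra_simps)
  also have "\<dots> \<le> (1 + ?E) * (B * (1 + \<kappa>) * \<tau>)" using B \<kappa> \<tau> by (intro mult_right_mono) auto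
  also have "\<dots> \<le> (\<rho> * \<bar>1 - ?F\<bar>) * (B * (1 + \<kappa>) * \<tau>)" using B \<kappa> \<tau> \<rho> by (intro mult_right_mono) auto
  finally show ?thesis unfolding eq using d by (simp add: divide_le_eq mult_ac)
qed

text \<open>Here \<open>c i\<close> is the logarithm of the mass of the \<open>i\<close>-th measure.
  Bounded sums of \<open>c\<close> keep all partial compositions within one Lipschitz class; bounded
  sums of \<open>\<tau>\<close> keep the support bounded and make the compositions converge
  uniformly. A moment once annihilated stays zero, because later delays only multiply the Laplace
  transform by a factor.\<close>

lemma infinite_delay_product:
  fixes \<nu> \<tau> c :: "nat \<Rightarrow> real"
  assumes \<tau>: "\<And>i. \<tau> i > 0" and ne: "\<And>i. \<nu> i \<noteq> \<kappa>" and \<kappa>: "\<kappa> \<ge> 0" and c: "\<And>i. c i \<ge> 0"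
    and \<rho>: "\<And>i. 1 + exp (\<nu> i * \<tau> i) \<le> exp (c i) * \<bar>1 - exp ((\<nu> i - \<kappa>) * \<tau> i)\<bar>"
    and C: "\<And>n. (\<Sum>i<n. c i) \<le> C" and T: "\<And>n. (\<Sum>i<n. \<tau> i) \<le> T"
    and h: "lip_supp B S h"
  shows "\<exists>\<sigma>. lip_supp (exp C * B) (S + T) \<sigma> \<and> (\<forall>i. lap \<sigma> (\<nu> i) = 0) \<and> lap \<sigma> \<kappa> = lap h \<kappa>"
proof -
  define f where "f = rec_nat h (\<lambda>i. delay_op (\<nu> i) \<kappa> (\<tau> i))"
  have f0: "f 0 = h" and fS: "f (Suc i) = delay_op (\<nu> i) \<kappa> (\<tau> i) (f i)" for i
    by (simp_all add: f_def)
  have B: "B \<ge> 0" using h unfolding lip_supp_def by (meson abs_ge_zero order_trans)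
  have nice: "lip_supp (exp (\<Sum>i<n. c i) * B) (S + (\<Sum>i<n. \<tau> i)) (f n)" for n
  proof (induction n)
    case 0 then show ?case using h by (simp add: f0)
  next
    case (Suc n)
    show ?case using lip_supp_delay_op[OF Suc \<tau> ne \<rho>, of n] by (simp add: fS exp_add algebra_simps)
  qed
  have nice': "lip_supp (exp C * B) (S + T) (f n)" for n
    using nice[of n] C[of n] T[of n] B by (auto intro!: lip_supp_mono[OF nice[of n]] mult_right_mono)
  have diff: "\<bar>f (Suc n) t - f n t\<bar> \<le> exp C * B * (1 + \<kappa>) * \<tau> n" for n t
  proof -
    have "\<bar>f (Suc n) t - f n t\<bar> \<le> exp (c n) * (exp (\<Sum>i<n. c i) * B) * (1 + \<kappa>) * \<tau> n"
      unfolding fS by (rule delay_op_diff[OF nice \<tau> ne \<kappa> \<rho>])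
    also have "exp (c n) * (exp (\<Sum>i<n. c i) * B) = exp (\<Sum>i<Suc n. c i) * B" by (simp add: exp_add)
    also have "\<dots> * (1 + \<kappa>) * \<tau> n \<le> exp C * B * (1 + \<kappa>) * \<tau> n"
      using C[of "Suc n"] B \<kappa> \<tau>[of n] by (intro mult_right_mono) auto
    finally show ?thesis .
  qed
  have sum\<tau>: "summable \<tau>"
    using \<tau> T by (intro summableI_nonneg_bounded[where x=T]) (auto intro: less_imp_le)
  have conv: "convergent (\<lambda>n. f n t)" for t
  proof -
    have "summable (\<lambda>n. f (Suc n) t - f n t)"
      by (rule summable_comparison_test'[OF summable_mult[OF sum\<tau>]]) (use diff in \<open>auto\<close>)
    then have "convergent (\<lambda>n. \<Sum>k<n. f (Suc k) t - f k t)" by (simp add: summable_iff_convergent)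
    then have "convergent (\<lambda>n. f n t - f 0 t)" by (simp only: sum_lessThan_telescope[of "\<lambda>n. f n t"])
    then show ?thesis using convergent_diff_const_right_iff[of "\<lambda>n. f n t" "f 0 t"] by simp
  qed
  define \<sigma> where "\<sigma> t = lim (\<lambda>n. f n t)" for t
  have lim: "(\<lambda>n. f n t) \<longlonglongrightarrow> \<sigma> t" for t using conv by (simp add: \<sigma>_def convergent_LIMSEQ_iff)
  have ls: "lip_supp (exp C * B) (S + T) \<sigma>"
    unfolding lip_supp_def
  proof (intro conjI allI impI)
    fix s t
    show "\<bar>\<sigma> t\<bar> \<le> exp C * B"
      by (rule LIMSEQ_le_const2[OF tendsto_rabs[OF lim]]) (use nice' in \<open>auto simp: lip_supp_def\<close>)
    show "\<bar>\<sigma> s - \<sigma> t\<bar> \<le> exp C * B * \<bar>s - t\<bar>"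
      by (rule LIMSEQ_le_const2[OF tendsto_rabs[OF tendsto_diff[OF lim lim]]])
        (use nice' in \<open>auto simp: lip_supp_def\<close>)
    assume "t \<notin> {0..S + T}"
    then have "(\<lambda>n. f n t) = (\<lambda>_. 0)" using nice' by (auto simp: lip_supp_def)
    then show "\<sigma> t = 0" by (simp add: \<sigma>_def)
  qed
  have laplim: "(\<lambda>n. lap (f n) z) \<longlonglongrightarrow> lap \<sigma> z" for z
    unfolding lap_def
  proof (rule integral_dominated_convergence[where w="\<lambda>t. indicator {0..S+T} t *\<^sub>R (exp C * B * exp (- z * t))"])
    show "(\<lambda>t. \<sigma> t * exp (- z * t)) \<in> borel_measurable lborel"
      using lip_supp_measurable[OF ls] by simp
    show "(\<lambda>t. f n t * exp (- z * t)) \<in> borel_measurable lborel" for n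
      using lip_supp_measurable[OF nice'] by simp
    have "set_integrable lborel {0..S+T} (\<lambda>t. exp C * B * exp (- z * t))"
      by (intro borel_integrable_atLeastAtMost' continuous_intros)
    then show "integrable lborel (\<lambda>t. indicator {0..S+T} t *\<^sub>R (exp C * B * exp (- z * t)))"
      unfolding set_integrable_def .
    show "AE t in lborel. (\<lambda>n. f n t * exp (- z * t)) \<longlonglongrightarrow> \<sigma> t * exp (- z * t)"
      by (intro AE_I2 tendsto_intros lim)
    show "AE t in lborel. norm (f n t * exp (- z * t)) \<le> indicator {0..S+T} t *\<^sub>R (exp C * B * exp (- z * t))" for n
      using nice'[of n] by (intro AE_I2) (auto simp: lip_supp_def indicator_def abs_mult intro!: mult_right_mono)
  qed
  have zero: "lap (f n) (\<nu> i) = 0" if "n > i" for n i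
    using that
  proof (induction n)
    case (Suc n)
    then show ?case using lap_delay_op[OF nice'[of n], of "\<nu> n" \<kappa> "\<tau> n" "\<nu> i"]
      by (cases "n = i") (auto simp: fS)
  qed simp
  have one: "lap (f n) \<kappa> = lap h \<kappa>" for n
  proof (induction n)
    case (Suc n)
    then show ?case using lap_delay_op[OF nice'[of n], of "\<nu> n" \<kappa> "\<tau> n" "\<kappa>"] \<tau>[of n] ne[of n]
      by (auto simp: fS)
  qed (simp add: f0)
  have "lap \<sigma> (\<nu> i) = 0" for i
  proof (rule LIMSEQ_unique[OF laplim])
    have "\<forall>\<^sub>F n in sequentially. lap (f n) (\<nu> i) = 0"
      using eventually_gt_at_top[of i] by eventually_elim (rule zero)
    then show "(\<lambda>n. lap (f n) (\<nu> i)) \<longlonglongrightarrow> 0" by (rule tendsto_eventually)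
  qed
  moreover have "lap \<sigma> \<kappa> = lap h \<kappa>"
    using LIMSEQ_unique[OF laplim[of \<kappa>]] by (simp add: one)
  ultimately show ?thesis using ls by blast
qed

lemma unit_bump:
  assumes "\<kappa> \<ge> 0"
  shows "\<exists>h. lip_supp (8 * exp \<kappa>) 1 h \<and> lap h \<kappa> = 1"
proof -
  define g :: "real \<Rightarrow> real" where "g t = max 0 (min t (1 - t))" for t
  have g: "lip_supp 1 1 g" unfolding lip_supp_def g_def by (auto simp: max_def min_def abs_if)
  have int: "integrable lborel (\<lambda>t. g t * exp (- \<kappa> * t))" by (rule lip_supp_integrable[OF g])
  \<comment> \<open>On the middle interval, of length 1/2, the tent is at least 1/4 and the
    exponential at least \<open>exp (- \<kappa>)\<close>.\<close>
  have "1/8 * exp (- \<kappa>) = (LINT t|lborel. indicator {1/4..3/4::real} t * (1/4 * exp (- \<kappa>)))" by simp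
  also have "\<dots> \<le> lap g \<kappa>"
    unfolding lap_def
  proof (rule integral_mono)
    show "integrable lborel (\<lambda>t. indicator {1/4..3/4::real} t * (1/4 * exp (- \<kappa>)))"
      by (intro integrable_mult_left integrable_real_indicator) (auto simp: less_top[symmetric])
    show "integrable lborel (\<lambda>t. g t * exp (- \<kappa> * t))" by (rule int)
    show "indicator {1/4..3/4} t * (1/4 * exp (- \<kappa>)) \<le> g t * exp (- \<kappa> * t)" for t
    proof (cases "t \<in> {1/4..3/4}")
      case True
      then have "1/4 \<le> g t" by (auto simp: g_def)
      moreover have "exp (- \<kappa>) \<le> exp (- \<kappa> * t)" using True assms by (simp add: mult_left_le)
      ultimately have "1/4 * exp (- \<kappa>) \<le> g t * exp (- \<kappa> * t)" by (intro mult_mono) auto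
      then show ?thesis using True by simp
    next
      case False
      then show ?thesis by (auto simp: g_def)
    qed
  qed
  finally have l: "1/8 * exp (- \<kappa>) \<le> lap g \<kappa>" .
  then have pos: "lap g \<kappa> > 0" using exp_gt_zero[of "- \<kappa>"] by linarith
  have le: "1 / lap g \<kappa> \<le> 8 * exp \<kappa>" using l pos by (simp add: field_simps exp_minus)
  have "lip_supp (8 * exp \<kappa>) 1 (\<lambda>t. g t / lap g \<kappa>)"
    unfolding lip_supp_def
  proof (intro conjI allI impI)
    fix s t
    have "\<bar>g t\<bar> * (1 / lap g \<kappa>) \<le> 1 * (8 * exp \<kappa>)"
      using g le pos by (intro mult_mono) (auto simp: lip_supp_def)
    then show "\<bar>g t / lap g \<kappa>\<bar> \<le> 8 * exp \<kappa>" using pos by (simp add: abs_divide)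
    have "\<bar>g s - g t\<bar> * (1 / lap g \<kappa>) \<le> \<bar>s - t\<bar> * (8 * exp \<kappa>)"
      using g le pos by (intro mult_mono) (auto simp: lip_supp_def)
    then show "\<bar>g s / lap g \<kappa> - g t / lap g \<kappa>\<bar> \<le> 8 * exp \<kappa> * \<bar>s - t\<bar>"
      using pos by (simp add: abs_divide mult_ac flip: diff_divide_distrib)
    assume "t \<notin> {0..1}"
    then show "g t / lap g \<kappa> = 0" using g by (auto simp: lip_supp_def)
  qed
  moreover have "lap (\<lambda>t. g t / lap g \<kappa>) \<kappa> = 1"
    using pos unfolding lap_def by simp
  ultimately show ?thesis by blast
qed

text \<open>\<open>C\<close> and \<open>T\<close> are chosen before the sequence \<open>L\<close>,
  and only the gap condition is assumed of it. This order of quantifiers gives every angular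
  momentum the same constants.\<close>

lemma biorthogonal_family:
  "\<exists>C T. 0 \<le> C \<and> 0 \<le> T \<and> (\<forall>L :: nat \<Rightarrow> real. L 0 \<ge> 0 \<longrightarrow>
     (\<forall>i j. i < j \<longrightarrow> L j - L i \<ge> real j ^ 2 - real i ^ 2) \<longrightarrow>
     (\<forall>k. \<exists>\<sigma>. lip_supp (exp (C * (1 + L k))) T \<sigma> \<and> (\<forall>j. lap \<sigma> (L j) = (if j = k then 1 else 0))))"
proof -
  define t :: "nat \<Rightarrow> real" where "t n = real (Suc n) powr (- 3 / 2)" for n
  \<comment> \<open>Since \<open>(n + 1)^2 * (n + 1) powr (- 3 / 2) = sqrt (n + 1)\<close>, the
    delays \<open>t\<close> and the quadratic gaps make \<open>y n\<close> an upper bound for the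
    reciprocal of \<open>exp ((L j - L k) * t n)\<close>; its summability bounds the total excess
    mass of the larger exponents.\<close>
  define y :: "nat \<Rightarrow> real" where "y n = exp (- sqrt (real (Suc n)))" for n
  have st: "summable t"
  proof -
    have "summable (\<lambda>n. real n powr (- 3 / 2))" by (simp add: summable_real_powr_iff)
    then show ?thesis unfolding t_def by (subst summable_Suc_iff)
  qed
  have sy: "summable y"
  proof (rule summable_comparison_test_bigo)
    show "summable (\<lambda>n. norm (1 / real n ^ 2))"
      using inverse_power_summable[of 2, where 'a=real] by (simp add: field_simps)
    show "y \<in> O(\<lambda>n. 1 / real n ^ 2)" unfolding y_def by real_asymp
  qed
  define S1 S2 where "S1 = suminf t" and "S2 = suminf y"
  have t0: "t n > 0" for n by (simp add: t_def)
  have y0: "y n > 0" for n by (simp add: y_def)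
  have S1: "(\<Sum>i<n. t i) \<le> S1" for n unfolding S1_def using st t0 by (intro sum_le_suminf) (auto intro: less_imp_le)
  have S2: "(\<Sum>i<n. y i) \<le> S2" for n unfolding S2_def using sy y0 by (intro sum_le_suminf) (auto intro: less_imp_le)
  have S10: "S1 \<ge> 0" and S20: "S2 \<ge> 0" using S1[of 0] S2[of 0] by auto
  have y1: "y n \<le> 1/2" for n
  proof -
    have "2 \<le> exp (1::real)" using exp_ge_add_one_self[of "1::real"] by simp
    also have "\<dots> \<le> exp (sqrt (real (Suc n)))" by simp
    finally show ?thesis by (simp add: y_def exp_minus field_simps)
  qed
  \<comment> \<open>Collects the exponents that arise below:
    \<open>2 * real k \<le> 2 * L k\<close>, the term \<open>L k\<close> twice,
    \<open>L k * S1 + 4 * S2\<close> from the larger exponents, and 7 because the bump brings a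
    factor \<open>8 \<le> exp 7\<close>; there is room to spare.\<close>
  define C where "C = 12 + S1 + 4 * S2"
  have "\<exists>\<sigma>. lip_supp (exp (C * (1 + L k))) (2 + S1) \<sigma> \<and> (\<forall>j. lap \<sigma> (L j) = (if j = k then 1 else 0))"
    if L0: "L 0 \<ge> 0" and gap: "\<And>i j. i < j \<Longrightarrow> L j - L i \<ge> real j ^ 2 - real i ^ 2" for L :: "nat \<Rightarrow> real" and k
  proof -
    have sq: "real i ^ 2 \<le> L i" for i using gap[of 0 i] L0 by (cases "i = 0") auto
    then have pos: "L i \<ge> 0" for i by (meson order_trans zero_le_power2)
    have kL: "real k \<le> L k"
      by (rule order_trans[OF _ sq]) (cases k; simp add: power2_eq_square)
    \<comment> \<open>Delays \<open>1 / k\<close> for the \<open>k\<close> smaller exponents, and \<open>(j - k)\<^sup>-\<^sup>3\<^sup>/\<^sup>2\<close> for the larger ones: the delays are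
      summable uniformly in \<open>k\<close>, while \<open>(L j - L k) \<tau>\<close> still grows like \<open>\<surd>(j - k)\<close>.\<close>
    define \<nu> where "\<nu> i = (if i < k then L i else L (Suc i))" for i
    define \<tau> where "\<tau> i = (if i < k then 1 / real k else t (i - k))" for i
    \<comment> \<open>For the smaller exponents the numerator of the mass is at most
      \<open>2 * exp (L k / real k)\<close> and the denominator at least 1/2, and
      \<open>4 \<le> exp 2\<close>. For the larger ones \<open>L k * t\<close> is the limiting mass
      and \<open>4 * y\<close> its correction.\<close>
    define c where "c i = (if i < k then 2 + L k / real k else L k * t (i - k) + 4 * y (i - k))" for i
    have cut: "(\<Sum>i<n. if i < k then a else b (i - k)) \<le> real k * a + s"
      if "a \<ge> 0" "\<And>i. b i \<ge> 0" "\<And>n. (\<Sum>i<n. b i) \<le> s" for a s :: real and b n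
    proof -
      have "(\<Sum>i<n. if i < k then a else b (i - k)) \<le> (\<Sum>i<n + k. if i < k then a else b (i - k))"
        using that by (intro sum_mono2) auto
      also have "\<dots> = (\<Sum>i<k. a) + (\<Sum>i\<in>{k..<n+k}. b (i - k))"
      proof -
        have "(\<Sum>i<k. if i < k then a else b (i - k)) = (\<Sum>i<k. a)" by (rule sum.cong) auto
        moreover have "(\<Sum>i\<in>{k..<n+k}. if i < k then a else b (i - k)) = (\<Sum>i\<in>{k..<n+k}. b (i - k))"
          by (rule sum.cong) auto
        ultimately show ?thesis
          using sum.atLeastLessThan_concat[of 0 k "n + k" "\<lambda>i. if i < k then a else b (i - k)"]
          by (simp add: atLeast0LessThan)
      qed
      also have "(\<Sum>i\<in>{k..<n+k}. b (i - k)) = (\<Sum>i<n. b i)"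
        using sum.shift_bounds_nat_ivl[of "\<lambda>i. b (i - k)" 0 k n] by (simp add: atLeast0LessThan)
      finally show ?thesis using that(3)[of n] by simp
    qed
    obtain h where h: "lip_supp (8 * exp (L k)) 1 h" "lap h (L k) = 1" using unit_bump[OF pos] by blast
    have "\<exists>\<sigma>. lip_supp (exp (2 * real k + L k + (L k * S1 + 4 * S2)) * (8 * exp (L k))) (1 + (1 + S1)) \<sigma> \<and>
        (\<forall>i. lap \<sigma> (\<nu> i) = 0) \<and> lap \<sigma> (L k) = lap h (L k)"
    proof (rule infinite_delay_product[where \<tau>=\<tau> and c=c])
      show "\<tau> i > 0" for i by (auto simp: \<tau>_def t0)
      show "\<nu> i \<noteq> L k" for i
      proof (cases "i < k")
        case True
        then have "real i ^ 2 < real k ^ 2" by (intro power_strict_mono) auto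
        then show ?thesis using True gap[of i k] by (auto simp: \<nu>_def)
      next
        case False
        then have "real k ^ 2 < real (Suc i) ^ 2" by (intro power_strict_mono) auto
        then show ?thesis using False gap[of k "Suc i"] by (auto simp: \<nu>_def)
      qed
      show "0 \<le> L k" by (rule pos)
      show "0 \<le> c i" for i using pos t0[of "i - k"] y0[of "i - k"] by (simp add: c_def)
      show "lip_supp (8 * exp (L k)) 1 h" by (rule h(1))
      show "(\<Sum>i<n. c i) \<le> 2 * real k + L k + (L k * S1 + 4 * S2)" for n
      proof -
        have "(\<Sum>i<n. c i) \<le> real k * (2 + L k / real k) + (L k * S1 + 4 * S2)"
          unfolding c_def using pos t0 y0
        proof (intro cut)
          show "(\<Sum>i<n. L k * t i + 4 * y i) \<le> L k * S1 + 4 * S2" for n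
            unfolding sum.distrib sum_distrib_left[symmetric]
            using S1 S2 pos by (intro add_mono mult_left_mono) auto
        qed (auto intro!: add_nonneg_nonneg mult_nonneg_nonneg intro: less_imp_le)
        also have "real k * (2 + L k / real k) \<le> 2 * real k + L k" using pos[of k] by (cases "k = 0") (auto simp: field_simps)
        finally show ?thesis by simp
      qed
      show "(\<Sum>i<n. \<tau> i) \<le> 1 + S1" for n
      proof -
        have "(\<Sum>i<n. \<tau> i) \<le> real k * (1 / real k) + S1" unfolding \<tau>_def
          using t0 S1 by (intro cut) (auto intro: less_imp_le)
        then show ?thesis by (cases "k = 0") auto
      qed
      show "1 + exp (\<nu> i * \<tau> i) \<le> exp (c i) * \<bar>1 - exp ((\<nu> i - L k) * \<tau> i)\<bar>" for i
      proof (cases "i < k")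
        case True
        have "1 \<le> (real k ^ 2 - real i ^ 2) / real k"
        proof -
          have "real i + 1 \<le> real k" using True by linarith
          then have "(real i + 1) * (real i + 1) \<le> real k * real k" by (intro mult_mono) auto
          moreover have "real i * real i \<le> (real k - 1) * (real k - 1)" using \<open>real i + 1 \<le> real k\<close> by (intro mult_mono) auto
          ultimately show ?thesis using True by (simp add: field_simps power2_eq_square)
        qed
        also have "\<dots> \<le> (L k - L i) / real k" using gap[OF True] by (intro divide_right_mono) auto
        finally have g: "1 \<le> (L k - L i) / real k" .
        have "exp ((\<nu> i - L k) * \<tau> i) = exp (- ((L k - L i) / real k))"
          using True by (simp add: \<nu>_def \<tau>_def field_simps)
        also have "\<dots> \<le> exp (- 1)" using g by simp
        also have "\<dots> \<le> 1/2" using exp_ge_add_one_self[of "1::real"] by (simp add: exp_minus field_simps)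
        finally have a: "1/2 \<le> \<bar>1 - exp ((\<nu> i - L k) * \<tau> i)\<bar>" by linarith
        have "L i \<le> L k" using g True by (simp add: field_simps)
        then have "exp (\<nu> i * \<tau> i) \<le> exp (L k / real k)" using True by (simp add: \<nu>_def \<tau>_def divide_right_mono)
        moreover have "1 \<le> exp (L k / real k)" using pos by simp
        ultimately have "1 + exp (\<nu> i * \<tau> i) \<le> 2 * exp (L k / real k)" by linarith
        also have "\<dots> \<le> (exp 2 * (1/2)) * exp (L k / real k)"
        proof (intro mult_right_mono)
          have "2 \<le> exp (1::real)" using exp_ge_add_one_self[of "1::real"] by simp
          then have "2 * 2 \<le> exp (1::real) * exp 1" by (intro mult_mono) auto
          then show "2 \<le> exp 2 * (1/2::real)" by (simp add: mult_exp_exp)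
        qed auto
        also have "\<dots> = exp (c i) * (1/2)" using True by (simp add: c_def exp_add)
        also have "\<dots> \<le> exp (c i) * \<bar>1 - exp ((\<nu> i - L k) * \<tau> i)\<bar>" using a by (intro mult_left_mono) auto
        finally show ?thesis .
      next
        case False
        define n where "n = i - k"
        have i: "i = k + n" using False by (simp add: n_def)
        have "(real (Suc n))\<^sup>2 \<le> real (Suc i) ^ 2 - real k ^ 2"
          unfolding i by (simp add: power2_eq_square algebra_simps)
        also have "\<dots> \<le> L (Suc i) - L k" using gap[of k "Suc i"] False by simp
        finally have g: "(real (Suc n))\<^sup>2 \<le> L (Suc i) - L k" .
        define F where "F = exp ((L (Suc i) - L k) * t n)"
        have "sqrt (real (Suc n)) = (real (Suc n))\<^sup>2 * t n"
          unfolding t_def by (simp add: powr_half_sqrt[symmetric] powr_add[symmetric] flip: powr_numeral)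
        also have "\<dots> \<le> (L (Suc i) - L k) * t n" using g t0[of n] by (intro mult_right_mono) auto
        finally have "exp (sqrt (real (Suc n))) \<le> F" unfolding F_def by simp
        then have Fy: "inverse F \<le> y n" unfolding y_def exp_minus by (intro le_imp_inverse_le) auto
        have F0: "F > 0" by (simp add: F_def)
        define w where "w = inverse F"
        have w: "0 < w" "w \<le> y n" "w \<le> 1/2" using F0 Fy y1[of n] by (auto simp: w_def)
        \<comment> \<open>That is, \<open>(1 + w) / (1 - w) \<le> 1 + 4 * w\<close> for
          \<open>w \<le> 1/2\<close>: the origin of the factor 4 in \<open>c\<close> and the use of
          the bound 1/2 on \<open>y\<close>.\<close>
        have "1 + w \<le> (1 + 4 * w) * (1 - w)"
        proof -
          have "w * w \<le> w * (1/2)" using w by (intro mult_left_mono) auto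
          then show ?thesis by (simp add: algebra_simps)
        qed
        also have "\<dots> \<le> exp (4 * y n) * (1 - w)"
          using exp_ge_add_one_self[of "4 * w"] w by (intro mult_right_mono order_trans[OF exp_ge_add_one_self]) auto
        finally have "(1 + w) * F \<le> exp (4 * y n) * (1 - w) * F" using F0 by (intro mult_right_mono) auto
        moreover have "w * F = 1" using F0 by (simp add: w_def)
        then have "(1 + w) * F = 1 + F" "exp (4 * y n) * (1 - w) * F = exp (4 * y n) * (F - 1)"
          by (simp_all add: distrib_right left_diff_distrib mult.assoc)
        ultimately have wF: "1 + F \<le> exp (4 * y n) * (F - 1)" by simp
        have e: "exp (\<nu> i * \<tau> i) = exp (L k * t n) * F"
          using False by (simp add: \<nu>_def \<tau>_def F_def n_def[symmetric] mult_exp_exp algebra_simps)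
        have "1 + exp (\<nu> i * \<tau> i) \<le> exp (L k * t n) * (1 + F)"
          unfolding e using pos[of k] t0[of n] by (simp add: algebra_simps)
        also have "\<dots> \<le> exp (L k * t n) * (exp (4 * y n) * (F - 1))" using wF by (intro mult_left_mono) auto
        also have "\<dots> = exp (c i) * (F - 1)" using False by (simp add: c_def n_def[symmetric] exp_add)
        also have "\<dots> \<le> exp (c i) * \<bar>1 - F\<bar>" by (intro mult_left_mono) auto
        also have "F = exp ((\<nu> i - L k) * \<tau> i)" using False by (simp add: F_def \<nu>_def \<tau>_def n_def)
        finally show ?thesis .
      qed
    qed
    then obtain \<sigma> where \<sigma>: "lip_supp (exp (2 * real k + L k + (L k * S1 + 4 * S2)) * (8 * exp (L k))) (1 + (1 + S1)) \<sigma>"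
       "\<And>i. lap \<sigma> (\<nu> i) = 0" "lap \<sigma> (L k) = 1" using h(2) by auto
    have "exp (2 * real k + L k + (L k * S1 + 4 * S2)) * (8 * exp (L k)) \<le> exp (C * (1 + L k))"
    proof -
      have "8 \<le> exp (7::real)" using exp_ge_add_one_self[of "7::real"] by simp
      then have "exp (2 * real k + L k + (L k * S1 + 4 * S2)) * (8 * exp (L k)) \<le>
        exp (2 * real k + L k + (L k * S1 + 4 * S2)) * (exp 7 * exp (L k))"
        by (intro mult_left_mono mult_right_mono) auto
      also have "\<dots> = exp (2 * real k + L k + (L k * S1 + 4 * S2) + 7 + L k)" by (simp only: mult_exp_exp add.assoc)
      also have "\<dots> \<le> exp (C * (1 + L k))"
      proof -
        have "0 \<le> S2 * L k" "0 \<le> S1" "0 \<le> S2 * (L k)" using S10 S20 pos by auto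
        then have "2 * real k + L k + (L k * S1 + 4 * S2) + 7 + L k \<le> C * (1 + L k)"
          using kL pos[of k] unfolding C_def by (simp add: algebra_simps)
        then show ?thesis by simp
      qed
      finally show ?thesis .
    qed
    then have "lip_supp (exp (C * (1 + L k))) (2 + S1) \<sigma>"
      using lip_supp_mono[OF \<sigma>(1), of "exp (C * (1 + L k))" "2 + S1"] by simp
    moreover have "lap \<sigma> (L j) = 0" if jk: "j \<noteq> k" for j
    proof (cases "j < k")
      case True then show ?thesis using \<sigma>(2)[of j] by (simp add: \<nu>_def)
    next
      case False
      then obtain i where "j = Suc i" "\<not> i < k" using jk by (cases j) auto
      then show ?thesis using \<sigma>(2)[of i] by (simp add: \<nu>_def)
    qed
    ultimately show ?thesis using \<sigma>(3) by auto
  qed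
  moreover have "0 \<le> C" "0 \<le> 2 + S1" using S10 S20 by (auto simp: C_def)
  ultimately show ?thesis by blast
qed

section \<open>Diagonal semigroups\<close>

text \<open>Take \<open>w\<close> of norm \<open>r\<close> on which \<open>T\<close> nearly attains
  its norm. As \<open>2 T w = T (x + w) - T (x - w)\<close>, one of \<open>x + w\<close> and
  \<open>x - w\<close> has an image at least as large as \<open>T w\<close>. The factor 2/3 leaves
  room for a norm that is not attained.\<close>

lemma gliding_step:
  fixes T :: "'a::real_normed_vector \<Rightarrow> 'b::real_normed_vector"
  assumes T: "bounded_linear T" and r: "r > 0"
  shows "\<exists>y. norm (y - x) \<le> r \<and> norm (T y) \<ge> 2/3 * r * onorm T"
proof (cases "onorm T = 0")
  case True
  then show ?thesis using r by (intro exI[of _ x]) simp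
next
  case False
  then have pos: "onorm T > 0" using onorm_pos_le[OF T] by linarith
  interpret T: bounded_linear T by (rule T)
  have "\<exists>u. norm (T u) > 2/3 * onorm T * norm u"
  proof (rule ccontr)
    assume "\<not> ?thesis"
    then have "onorm T \<le> 2/3 * onorm T" using pos by (intro onorm_bound) (auto simp: not_less)
    then show False using pos by simp
  qed
  then obtain u where u: "norm (T u) > 2/3 * onorm T * norm u" by blast
  then have u0: "norm u > 0" by (cases "u = 0") (auto simp: T.zero)
  define w where "w = (r / norm u) *\<^sub>R u"
  have w: "norm w = r" using u0 r by (simp add: w_def)
  have "norm (T w) = r / norm u * norm (T u)" using r u0 by (simp add: w_def T.scaleR)
  also have "\<dots> \<ge> r / norm u * (2/3 * onorm T * norm u)"
    using u r u0 by (intro mult_left_mono) auto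
  finally have Tw: "norm (T w) \<ge> 2/3 * r * onorm T" using u0 by (simp add: field_simps)
  have "2 * norm (T w) = norm (T (x + w) - T (x - w))"
    by (simp add: T.diff T.add flip: scaleR_2)
  also have "\<dots> \<le> norm (T (x + w)) + norm (T (x - w))" by (rule norm_triangle_ineq4)
  finally have "norm (T w) \<le> norm (T (x + w)) \<or> norm (T w) \<le> norm (T (x - w))" by linarith
  then show ?thesis
  proof
    assume "norm (T w) \<le> norm (T (x + w))"
    then show ?thesis using Tw w by (intro exI[of _ "x + w"]) auto
  next
    assume "norm (T w) \<le> norm (T (x - w))"
    then show ?thesis using Tw w by (intro exI[of _ "x - w"]) auto
  qed
qed

text \<open>Sokal's gliding hump argument, which avoids the Baire category theorem.\<close>

lemma uniform_boundedness:
  fixes T :: "nat \<Rightarrow> 'a::banach \<Rightarrow> 'b::real_normed_vector"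
  assumes T: "\<And>n. bounded_linear (T n)" and bdd: "\<And>x. bounded (range (\<lambda>n. T n x))"
  shows "\<exists>M. \<forall>n. onorm (T n) \<le> M"
proof (rule ccontr)
  assume "\<not> ?thesis"
  then have "\<forall>k. \<exists>n. onorm (T n) > 4 ^ k" by (auto simp: not_le)
  then obtain N where N: "\<And>k::nat. onorm (T (N k)) > 4 ^ k" by metis
  define nxt where "nxt k x = (SOME y. norm (y - x) \<le> (1/3) ^ k \<and> norm (T (N k) y) \<ge> 2/3 * (1/3) ^ k * onorm (T (N k)))" for k x
  have nxt: "norm (nxt k x - x) \<le> (1/3) ^ k \<and> norm (T (N k) (nxt k x)) \<ge> 2/3 * (1/3) ^ k * onorm (T (N k))" for k x
    unfolding nxt_def by (rule someI_ex, rule gliding_step[OF T]) simp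
  define x where "x = rec_nat 0 nxt"
  define d where "d k = x (Suc k) - x k" for k
  have xS: "x (Suc k) = nxt k (x k)" for k by (simp add: x_def)
  have nd: "norm (d k) \<le> (1/3) ^ k" for k using nxt[of k "x k"] by (simp add: d_def xS)
  have sd: "summable (\<lambda>k. norm (d k))"
    by (rule summable_comparison_test'[OF summable_geometric[of "1/3::real"]]) (use nd in auto)
  define X where "X = suminf d"
  have x0: "x k = (\<Sum>i<k. d i)" for k
    using sum_lessThan_telescope[of x k] by (simp add: d_def) (simp add: x_def)
  have dist: "norm (X - x (Suc k)) \<le> 1/2 * (1/3) ^ k" for k
  proof -
    have "X - x (Suc k) = (\<Sum>i. d (i + Suc k))"
      unfolding X_def x0 by (rule suminf_minus_initial_segment[OF summable_norm_cancel[OF sd], symmetric])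
    also have "norm \<dots> \<le> (\<Sum>i. norm (d (i + Suc k)))"
      by (rule summable_norm[OF summable_ignore_initial_segment[OF sd]])
    also have "\<dots> \<le> (\<Sum>i. (1/3) ^ (i + Suc k))"
      by (intro suminf_le nd summable_ignore_initial_segment sd summable_geometric) simp
    also have "\<dots> = (1/3) ^ Suc k * (\<Sum>i. (1/3::real) ^ i)"
      by (subst suminf_mult[symmetric]) (auto simp: power_add mult_ac)
    also have "\<dots> = 1/2 * (1/3) ^ k" by (subst suminf_geometric) auto
    finally show ?thesis .
  qed
  obtain M where M: "\<And>n. norm (T n X) \<le> M" using bdd[of X] unfolding bounded_iff by blast
  \<comment> \<open>Step \<open>k\<close> gains 2/3 of the radius times the operator norm, all later
    steps together lose at most 1/2 of it, so 1/6 survives. Norms above \<open>4 ^ k\<close> beat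
    the radii \<open>(1/3) ^ k\<close>.\<close>
  have "1/6 * (4/3) ^ k \<le> M" for k
  proof -
    interpret Tk: bounded_linear "T (N k)" by (rule T)
    have "2/3 * (1/3) ^ k * onorm (T (N k)) \<le> norm (T (N k) (x (Suc k)))" using nxt[of k "x k"] by (simp add: xS)
    also have "\<dots> = norm (T (N k) X - T (N k) (X - x (Suc k)))" by (simp add: Tk.diff)
    also have "\<dots> \<le> norm (T (N k) X) + norm (T (N k) (X - x (Suc k)))" by (rule norm_triangle_ineq4)
    also have "\<dots> \<le> M + onorm (T (N k)) * (1/2 * (1/3) ^ k)"
      using onorm[OF T[of "N k"], of "X - x (Suc k)"] dist[of k] onorm_pos_le[OF T[of "N k"]]
      by (intro add_mono M) (meson mult_left_mono order_trans)
    finally have "1/6 * (1/3) ^ k * onorm (T (N k)) \<le> M" by (simp add: algebra_simps)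
    moreover have "1/6 * (1/3) ^ k * 4 ^ k \<le> 1/6 * (1/3) ^ k * onorm (T (N k))"
      using N[of k] by (intro mult_left_mono) auto
    moreover have "(1/3::real) ^ k * 4 ^ k = (4/3) ^ k" by (simp flip: power_mult_distrib)
    ultimately show ?thesis by simp
  qed
  moreover obtain k where "(4/3::real) ^ k > 6 * M" using real_arch_pow[of "4/3" "6 * M"] by auto
  ultimately show False by (metis mult.commute not_less mult_le_cancel_left_pos zero_less_numeral
        times_divide_eq_left mult_1 pos_divide_le_eq)
qed

text \<open>Otherwise there are times \<open>t k\<close> tending to 0 at which the norm exceeds
  \<open>k\<close>. But \<open>S (t k) x\<close> converges to \<open>x\<close> for each
  \<open>x\<close>, so uniform boundedness gives a contradiction.\<close>

lemma C0_semigroup_locally_bounded: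
  fixes S :: "real \<Rightarrow> 'a::banach \<Rightarrow> 'a"
  assumes S: "C0_semigroup S"
  shows "\<exists>\<delta>>0. \<exists>M\<ge>0. \<forall>t\<in>{0..\<delta>}. \<forall>x. norm (S t x) \<le> M * norm x"
proof (rule ccontr)
  assume contr: "\<not> ?thesis"
  have lin: "\<And>t. t \<ge> 0 \<Longrightarrow> bounded_linear (S t)" and S0: "S 0 = id"
    and lim: "\<And>f. ((\<lambda>t. S t f) \<longlongrightarrow> f) (at_right 0)"
    using S by (auto simp: C0_semigroup_def)
  have "\<forall>k::nat. \<exists>t\<in>{0..1 / (real k + 1)}. \<exists>x. norm (S t x) > real k * norm x"
    using contr by (metis (no_types, opaque_lifting) not_le of_nat_0_le_iff zero_less_divide_1_iff
        add_nonneg_pos zero_less_one)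
  then obtain t where t: "\<And>k::nat. t k \<in> {0..1 / (real k + 1)}" "\<And>k. \<exists>x. norm (S (t k) x) > real k * norm x"
    by metis
  have tlim: "(\<lambda>k. S (t k) x) \<longlonglongrightarrow> x" for x
  proof (rule LIMSEQ_I)
    fix r :: real assume r: "r > 0"
    have "\<forall>\<^sub>F s in at_right 0. dist (S s x) x < r" using lim[of x] r by (rule tendstoD)
    then obtain b where b: "b > 0" "\<And>s. 0 < s \<Longrightarrow> s < b \<Longrightarrow> norm (S s x - x) < r"
      unfolding eventually_at_right_field dist_norm by auto
    obtain K :: nat where K: "1 / (real K + 1) < b"
      using reals_Archimedean[OF b(1)] by (auto simp: field_simps)
    show "\<exists>K. \<forall>k\<ge>K. norm (S (t k) x - x) < r"
    proof (intro exI allI impI)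
      fix k assume "K \<le> k"
      then have "1 / (real k + 1) \<le> 1 / (real K + 1)" by (intro divide_left_mono) auto
      then have "t k < b" using t(1)[of k] K by auto
      then show "norm (S (t k) x - x) < r" using b(2)[of "t k"] t(1)[of k] r by (cases "t k = 0") (auto simp: S0)
    qed
  qed
  then have "bounded (range (\<lambda>n. S (t n) x))" for x
    by (intro convergent_imp_bounded) auto
  moreover have tl: "bounded_linear (S (t n))" for n using t(1) by (auto intro: lin)
  ultimately obtain M where M: "\<And>n. onorm (S (t n)) \<le> M"
    using uniform_boundedness[of "\<lambda>n. S (t n)"] by blast
  obtain k where k: "M < real k" using reals_Archimedean2 by blast
  obtain x where x: "norm (S (t k) x) > real k * norm x" using t(2) by blast
  have "norm (S (t k) x) \<le> onorm (S (t k)) * norm x" by (rule onorm[OF tl])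
  also have "\<dots> \<le> real k * norm x" using M[of k] k by (intro mult_right_mono) auto
  finally show False using x by simp
qed

text \<open>Only the right derivative at time 0 is known. The defect \<open>r h\<close> of the
  exponential over one step is \<open>o(h)\<close>; telescoping over \<open>N\<close> steps of
  length \<open>t / N\<close> propagates each defect by operators of norm at most \<open>M\<close>,
  with total at most \<open>N * M * norm (r (t / N))\<close>, which tends to 0. This works up to the
  time \<open>\<delta>\<close> of local boundedness; the semigroup law covers the rest.\<close>

lemma C0_semigroup_eigenvector:
  fixes S :: "real \<Rightarrow> 'a::banach \<Rightarrow> 'a"
  assumes S: "C0_semigroup S" and v: "(v, - l *\<^sub>R v) \<in> generator_graph S" and l: "l \<ge> 0" and t: "t \<ge> 0"
  shows "S t v = exp (- l * t) *\<^sub>R v"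
proof -
  have lin: "\<And>t. t \<ge> 0 \<Longrightarrow> bounded_linear (S t)" and S0: "S 0 = id"
    and add: "\<And>s t. s \<ge> 0 \<Longrightarrow> t \<ge> 0 \<Longrightarrow> S (s + t) = S s \<circ> S t"
    using S by (auto simp: C0_semigroup_def)
  obtain \<delta> M where \<delta>: "\<delta> > 0" and M: "M \<ge> 0" "\<And>t x. t \<in> {0..\<delta>} \<Longrightarrow> norm (S t x) \<le> M * norm x"
    using C0_semigroup_locally_bounded[OF S] by blast
  define r where "r h = S h v - exp (- l * h) *\<^sub>R v" for h
  have "((\<lambda>h. (S h v - v) /\<^sub>R h - ((exp (- l * h) - 1) / h) *\<^sub>R v) \<longlongrightarrow> - l *\<^sub>R v - (- l) *\<^sub>R v) (at_right 0)"
  proof (rule tendsto_diff[OF _ tendsto_scaleR[OF _ tendsto_const]])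
    show "((\<lambda>h. (S h v - v) /\<^sub>R h) \<longlongrightarrow> - l *\<^sub>R v) (at_right 0)"
      using v by (simp add: generator_graph_def)
    show "((\<lambda>h. (exp (- l * h) - 1) / h) \<longlongrightarrow> - l) (at_right 0)" by real_asymp
  qed
  moreover have "(S h v - v) /\<^sub>R h - ((exp (- l * h) - 1) / h) *\<^sub>R v = r h /\<^sub>R h" for h
    by (simp add: r_def algebra_simps divide_inverse)
  ultimately have rlim: "((\<lambda>h. r h /\<^sub>R h) \<longlongrightarrow> 0) (at_right 0)" by simp
  have small: "S t v = exp (- l * t) *\<^sub>R v" if t: "0 < t" "t \<le> \<delta>" for t
  proof -
    have key: "norm (S t v - exp (- l * t) *\<^sub>R v) \<le> real N * M * norm (r (t / real N))" if N: "N > 0" for N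
    proof -
      define h where "h = t / real N"
      have h: "h > 0" using t N by (simp add: h_def)
      have "n \<le> N \<Longrightarrow> norm (S (real n * h) v - exp (- l * h) ^ n *\<^sub>R v) \<le> real n * (M * norm (r h))" for n
      proof (induction n)
        case 0 then show ?case by (simp add: S0)
      next
        case (Suc n)
        have nh: "real n * h \<in> {0..\<delta>}"
        proof -
          have "real n * h \<le> real N * h" using Suc.prems h by (intro mult_right_mono) auto
          then show ?thesis using h t N by (auto simp: h_def)
        qed
        interpret Sn: bounded_linear "S (real n * h)" using nh by (intro lin) auto
        have "S (real (Suc n) * h) v = S (real n * h) (S h v)"
          using add[of "real n * h" h] nh h by (simp add: algebra_simps)
        also have "\<dots> = S (real n * h) (r h) + exp (- l * h) *\<^sub>R S (real n * h) v"
          unfolding r_def Sn.diff Sn.scaleR by simp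
        finally have "S (real (Suc n) * h) v - exp (- l * h) ^ Suc n *\<^sub>R v =
            S (real n * h) (r h) + exp (- l * h) *\<^sub>R (S (real n * h) v - exp (- l * h) ^ n *\<^sub>R v)"
          by (simp add: algebra_simps)
        also have "norm \<dots> \<le> M * norm (r h) + exp (- l * h) * norm (S (real n * h) v - exp (- l * h) ^ n *\<^sub>R v)"
          by (rule order_trans[OF norm_triangle_ineq]) (use M(2)[OF nh] in simp)
        also have "exp (- l * h) * norm (S (real n * h) v - exp (- l * h) ^ n *\<^sub>R v) \<le> 1 * norm (S (real n * h) v - exp (- l * h) ^ n *\<^sub>R v)"
          using l h by (intro mult_right_mono) auto
        also have "\<dots> \<le> real n * (M * norm (r h))" using Suc by simp
        finally show ?case by (simp add: algebra_simps)
      qed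
      from this[of N] show ?thesis using N by (simp add: h_def flip: exp_of_nat_mult)
    qed
    have "(\<lambda>N. t * M * norm (r (t / real (Suc N)) /\<^sub>R (t / real (Suc N)))) \<longlonglongrightarrow> t * M * norm (0::'a)"
    proof (rule tendsto_mult[OF tendsto_const tendsto_norm[OF filterlim_compose[OF rlim]]])
      have "(\<lambda>N. t / real (Suc N)) \<longlonglongrightarrow> 0" by real_asymp
      then show "LIM N sequentially. t / real (Suc N) :> at_right 0"
        using t by (auto simp: filterlim_at intro!: always_eventually)
    qed
    then have "norm (S t v - exp (- l * t) *\<^sub>R v) \<le> 0"
    proof (intro LIMSEQ_le_const[of _ 0] exI[of _ 0] allI impI)
      fix N
      show "norm (S t v - exp (- l * t) *\<^sub>R v) \<le> t * M * norm (r (t / real (Suc N)) /\<^sub>R (t / real (Suc N)))"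
      proof -
        have "t * M * norm (r (t / real (Suc N)) /\<^sub>R (t / real (Suc N))) = real (Suc N) * M * norm (r (t / real (Suc N)))"
          using t by (simp add: field_simps del: of_nat_Suc)
        then show ?thesis using key[of "Suc N"] by simp
      qed
    qed simp
    then show ?thesis by simp
  qed
  obtain N :: nat where N: "t / \<delta> < real N" using reals_Archimedean2 by blast
  then have N0: "N > 0" using t \<delta> by (cases "N = 0") (auto simp: field_simps zero_le_divide_iff not_less)
  show ?thesis
  proof (cases "t = 0")
    case True then show ?thesis by (simp add: S0)
  next
    case False
    define h where "h = t / real N"
    have h: "h > 0" "h \<le> \<delta>" using N N0 t False \<delta> by (auto simp: h_def field_simps)
    have "S (real n * h) v = exp (- l * (real n * h)) *\<^sub>R v" for n
    proof (induction n)
      case 0 then show ?case by (simp add: S0)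
    next
      case (Suc n)
      interpret Sn: bounded_linear "S (real n * h)" using h by (intro lin) auto
      have "S (real (Suc n) * h) v = S (real n * h) (S h v)"
        using add[of "real n * h" h] h by (simp add: algebra_simps)
      also have "\<dots> = exp (- l * h) *\<^sub>R exp (- l * (real n * h)) *\<^sub>R v"
        unfolding small[OF h] Sn.scaleR Suc by simp
      also have "\<dots> = exp (- l * (real (Suc n) * h)) *\<^sub>R v"
        by (simp add: algebra_simps flip: exp_add)
      finally show ?case .
    qed
    from this[of N] show ?thesis using N0 by (simp add: h_def)
  qed
qed

section \<open>Orthonormal bases and the semigroups they diagonalise\<close>

locale orthonormal_basis =
  fixes v :: "nat \<Rightarrow> 'a::{real_inner,banach}"
  assumes orthonormal: "v i \<bullet> v j = (if i = j then 1 else 0)"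
    and total: "(\<And>i. f \<bullet> v i = 0) \<Longrightarrow> f = 0"
begin

lemma norm_sum_sq:
  assumes "finite A" shows "(norm (\<Sum>i\<in>A. c i *\<^sub>R v i))\<^sup>2 = (\<Sum>i\<in>A. (c i)\<^sup>2)"
  unfolding power2_norm_eq_inner using assms
  by (simp add: inner_sum_left inner_sum_right orthonormal power2_eq_square if_distrib sum.delta cong: if_cong)

lemma bessel: "(\<Sum>i<n. (f \<bullet> v i)\<^sup>2) \<le> (norm f)\<^sup>2"
proof -
  let ?p = "\<Sum>i<n. (f \<bullet> v i) *\<^sub>R v i"
  have "0 \<le> (norm (f - ?p))\<^sup>2" by simp
  also have "\<dots> = (norm f)\<^sup>2 - 2 * (f \<bullet> ?p) + (norm ?p)\<^sup>2"
    by (simp add: power2_norm_eq_inner inner_diff_left inner_diff_right inner_commute)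
  also have "f \<bullet> ?p = (\<Sum>i<n. (f \<bullet> v i)\<^sup>2)" by (simp add: inner_sum_right power2_eq_square)
  also have "(norm ?p)\<^sup>2 = (\<Sum>i<n. (f \<bullet> v i)\<^sup>2)" by (simp add: norm_sum_sq)
  finally show ?thesis by simp
qed

lemma summable_coeffs: "summable (\<lambda>i. (f \<bullet> v i)\<^sup>2)"
  by (rule summableI_nonneg_bounded[where x="(norm f)\<^sup>2"]) (use bessel in auto)

lemma series_converges:
  assumes "summable (\<lambda>i. (c i)\<^sup>2)"
  shows "summable (\<lambda>i. c i *\<^sub>R v i)" "(\<Sum>i. c i *\<^sub>R v i) \<bullet> v j = c j"
proof -
  show s: "summable (\<lambda>i. c i *\<^sub>R v i)"
    unfolding summable_Cauchy
  proof (intro allI impI)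
    fix e :: real assume e: "e > 0"
    then obtain N where N: "\<And>m n. m \<ge> N \<Longrightarrow> norm (\<Sum>i\<in>{m..<n}. (c i)\<^sup>2) < e\<^sup>2"
      using assms unfolding summable_Cauchy by (meson zero_less_power)
    show "\<exists>N. \<forall>m\<ge>N. \<forall>n. norm (\<Sum>i\<in>{m..<n}. c i *\<^sub>R v i) < e"
    proof (intro exI allI impI)
      fix m n assume "N \<le> m"
      then have "(norm (\<Sum>i\<in>{m..<n}. c i *\<^sub>R v i))\<^sup>2 < e\<^sup>2"
        using N[of m n] by (simp add: norm_sum_sq sum_nonneg)
      then show "norm (\<Sum>i\<in>{m..<n}. c i *\<^sub>R v i) < e" using e by (simp add: power2_less_imp_less)
    qed
  qed
  have "(\<lambda>i. (c i *\<^sub>R v i) \<bullet> v j) sums ((\<Sum>i. c i *\<^sub>R v i) \<bullet> v j)"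
    by (intro bounded_linear.sums[OF bounded_linear_inner_left] summable_sums s)
  moreover have "(\<lambda>i. (c i *\<^sub>R v i) \<bullet> v j) sums c j"
    using sums_single[of j "\<lambda>_. c j"] by (simp add: orthonormal if_distrib cong: if_cong)
  ultimately show "(\<Sum>i. c i *\<^sub>R v i) \<bullet> v j = c j" by (rule sums_unique2)
qed

lemma eqI: "(\<And>i. f \<bullet> v i = g \<bullet> v i) \<Longrightarrow> f = g"
  using total[of "f - g"] by (simp add: inner_diff_left)

lemma expansion: "(\<lambda>i. (f \<bullet> v i) *\<^sub>R v i) sums f"
proof -
  have "(\<Sum>i. (f \<bullet> v i) *\<^sub>R v i) = f" by (rule eqI) (rule series_converges[OF summable_coeffs])
  then show ?thesis using summable_sums[OF series_converges(1)[OF summable_coeffs[of f]]] by simp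
qed

lemma parseval: "(\<lambda>i. (f \<bullet> v i) * (g \<bullet> v i)) sums (f \<bullet> g)"
  using bounded_linear.sums[OF bounded_linear_inner_left expansion, of f g] by (simp add: inner_commute)

lemma norm_sq_sums: "(\<lambda>i. (f \<bullet> v i)\<^sup>2) sums (norm f)\<^sup>2"
  using parseval[of f f] by (simp add: power2_eq_square power2_norm_eq_inner[symmetric])

definition multiplier :: "(nat \<Rightarrow> real) \<Rightarrow> 'a \<Rightarrow> 'a" where
  "multiplier a f = (\<Sum>i. (a i * (f \<bullet> v i)) *\<^sub>R v i)"

lemma
  assumes "\<And>i. \<bar>a i\<bar> \<le> 1"
  shows multiplier_inner: "multiplier a f \<bullet> v j = a j * (f \<bullet> v j)"
    and norm_multiplier_le: "norm (multiplier a f) \<le> norm f"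
    and multiplier_linear: "bounded_linear (multiplier a)"
proof -
  have le: "(a i * x)\<^sup>2 \<le> x\<^sup>2" for i x
    using assms[of i] abs_square_le_1[of "a i"] by (simp add: power_mult_distrib mult_left_le_one_le)
  have inner: "multiplier a f \<bullet> v j = a j * (f \<bullet> v j)" for f j
    unfolding multiplier_def
    by (rule series_converges, rule summable_comparison_test'[OF summable_coeffs[of f]]) (use le in simp)
  have nrm: "norm (multiplier a f) \<le> norm f" for f
  proof -
    have "(norm (multiplier a f))\<^sup>2 \<le> (norm f)\<^sup>2"
      by (rule sums_le[OF _ norm_sq_sums norm_sq_sums]) (simp add: inner le)
    then show ?thesis by (rule power2_le_imp_le) simp
  qed
  show "multiplier a f \<bullet> v j = a j * (f \<bullet> v j)" "norm (multiplier a f) \<le> norm f" by (rule inner nrm)+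
  show "bounded_linear (multiplier a)"
  proof (rule bounded_linear_intro[where K=1])
    show "multiplier a (x + y) = multiplier a x + multiplier a y" for x y
      by (rule eqI) (simp add: inner inner_add_left algebra_simps)
    show "multiplier a (r *\<^sub>R x) = r *\<^sub>R multiplier a x" for r x
      by (rule eqI) (simp add: inner)
    show "norm (multiplier a x) \<le> norm x * 1" for x using nrm by simp
  qed
qed

text \<open>Dominated convergence for series, the squared coefficients of \<open>f\<close> being the
  majorant. It yields both strong continuity and the convergence of difference quotients.\<close>

lemma tendsto_multiplier_0:
  assumes F: "F \<noteq> bot" and lim: "\<And>i. ((\<lambda>t. a t i) \<longlongrightarrow> 0) F" and a: "\<And>t i. \<bar>a t i\<bar> \<le> 1"
  shows "((\<lambda>t. multiplier (a t) f) \<longlongrightarrow> 0) F"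
proof -
  have "((\<lambda>t. \<Sum>i. (a t i)\<^sup>2 * (f \<bullet> v i)\<^sup>2) \<longlongrightarrow> (\<Sum>i. 0 * (f \<bullet> v i)\<^sup>2)) F"
  proof (rule conjunct2[OF conjunct2[OF tannerys_theorem[where M="\<lambda>i. (f \<bullet> v i)\<^sup>2"]]])
    fix i
    have "((\<lambda>t. (a t i)\<^sup>2 * (f \<bullet> v i)\<^sup>2) \<longlongrightarrow> 0\<^sup>2 * (f \<bullet> v i)\<^sup>2) F" by (intro tendsto_intros lim)
    then show "((\<lambda>t. (a t i)\<^sup>2 * (f \<bullet> v i)\<^sup>2) \<longlongrightarrow> 0 * (f \<bullet> v i)\<^sup>2) F" by simp
  next
    show "\<forall>\<^sub>F (i, t) in sequentially \<times>\<^sub>F F. norm ((a t i)\<^sup>2 * (f \<bullet> v i)\<^sup>2) \<le> (f \<bullet> v i)\<^sup>2"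
      using a by (intro always_eventually) (auto simp: abs_square_le_1 mult_left_le_one_le)
  qed (use F summable_coeffs in auto)
  moreover have "(\<Sum>i. (a t i)\<^sup>2 * (f \<bullet> v i)\<^sup>2) = (norm (multiplier (a t) f))\<^sup>2" for t
    using sums_unique[OF norm_sq_sums[of "multiplier (a t) f"]]
    by (simp add: multiplier_inner[OF a] power_mult_distrib)
  ultimately have "((\<lambda>t. sqrt ((norm (multiplier (a t) f))\<^sup>2)) \<longlongrightarrow> sqrt 0) F"
    by (intro tendsto_real_sqrt) simp
  then show ?thesis by (simp add: tendsto_norm_zero_iff)
qed

end

locale diagonal_semigroup = orthonormal_basis v for v :: "nat \<Rightarrow> 'a::{real_inner,banach}" +
  fixes eigenvalue :: "nat \<Rightarrow> real"
  assumes eigenvalue_nonneg: "eigenvalue i \<ge> 0"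
begin

text \<open>The truncation at \<open>0\<close> keeps the multipliers bounded at the irrelevant negative times.\<close>

definition semigroup :: "real \<Rightarrow> 'a \<Rightarrow> 'a" where
  "semigroup t = multiplier (\<lambda>i. exp (- eigenvalue i * max 0 t))"

lemma exp_bound: "\<bar>exp (- eigenvalue i * max 0 t)\<bar> \<le> 1"
  using eigenvalue_nonneg by simp

lemma semigroup_linear: "bounded_linear (semigroup t)"
  unfolding semigroup_def by (rule multiplier_linear) (rule exp_bound)

lemma norm_semigroup_le: "norm (semigroup t f) \<le> norm f"
  unfolding semigroup_def by (rule norm_multiplier_le) (rule exp_bound)

lemma semigroup_inner: "t \<ge> 0 \<Longrightarrow> semigroup t f \<bullet> v j = exp (- eigenvalue j * t) * (f \<bullet> v j)"
  unfolding semigroup_def by (subst multiplier_inner[OF exp_bound]) simp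

lemma C0_semigroup: "C0_semigroup semigroup"
  unfolding C0_semigroup_def
proof (intro conjI allI impI)
  show "bounded_linear (semigroup t)" for t by (rule semigroup_linear)
  show "semigroup 0 = id" by (rule ext, rule eqI) (simp add: semigroup_inner)
  show "semigroup (s + t) = semigroup s \<circ> semigroup t" if "0 \<le> s" "0 \<le> t" for s t
    by (rule ext, rule eqI) (use that in \<open>simp add: semigroup_inner algebra_simps exp_add exp_diff exp_minus divide_inverse\<close>)
  fix f
  define a where "a t i = exp (- eigenvalue i * max 0 t) - 1" for t i
  have a: "\<bar>a t i\<bar> \<le> 1" for t i using exp_bound[of i t] exp_gt_zero[of "- eigenvalue i * max 0 t"] unfolding a_def by linarith
  have "((\<lambda>t. multiplier (a t) f) \<longlongrightarrow> 0) (at_right 0)"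
  proof (rule tendsto_multiplier_0[OF _ _ a])
    fix i
    have "((\<lambda>t. a t i) \<longlongrightarrow> exp (- eigenvalue i * max 0 0) - 1) (at_right 0)"
      unfolding a_def by (intro tendsto_intros)
    then show "((\<lambda>t. a t i) \<longlongrightarrow> 0) (at_right 0)" by simp
  qed simp
  then have "((\<lambda>t. multiplier (a t) f + f) \<longlongrightarrow> 0 + f) (at_right 0)" by (intro tendsto_intros)
  moreover have "multiplier (a t) f + f = semigroup t f" for t
    by (rule eqI) (simp add: inner_add_left multiplier_inner[OF a] semigroup_def a_def algebra_simps
        multiplier_inner[where a="\<lambda>i. exp (- eigenvalue i * max 0 t)", OF exp_bound, simplified])
  ultimately show "((\<lambda>t. semigroup t f) \<longlongrightarrow> f) (at_right 0)" by simp
qed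

lemma generator: "generator_graph semigroup = {(f, g). \<forall>i. g \<bullet> v i = - eigenvalue i * (f \<bullet> v i)}"
proof safe
  fix f g i assume "(f, g) \<in> generator_graph semigroup"
  then have "((\<lambda>t. ((semigroup t f - f) /\<^sub>R t) \<bullet> v i) \<longlongrightarrow> g \<bullet> v i) (at_right 0)"
    unfolding generator_graph_def mem_Collect_eq split_conv by (rule tendsto_inner[OF _ tendsto_const])
  moreover have "((\<lambda>t. ((semigroup t f - f) /\<^sub>R t) \<bullet> v i) \<longlongrightarrow> - eigenvalue i * (f \<bullet> v i)) (at_right 0)"
  proof (rule Lim_transform_eventually)
    have "((\<lambda>t. (exp (- eigenvalue i * t) - 1) / t) \<longlongrightarrow> - eigenvalue i) (at_right 0)" by real_asymp
    then show "((\<lambda>t. (exp (- eigenvalue i * t) - 1) / t * (f \<bullet> v i)) \<longlongrightarrow> - eigenvalue i * (f \<bullet> v i)) (at_right 0)"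
      by (intro tendsto_intros)
    show "\<forall>\<^sub>F t in at_right 0. (exp (- eigenvalue i * t) - 1) / t * (f \<bullet> v i) = ((semigroup t f - f) /\<^sub>R t) \<bullet> v i"
      using eventually_at_right_less[of "0::real"]
      by eventually_elim (simp add: semigroup_inner inner_diff_left algebra_simps divide_inverse)
  qed
  ultimately show "g \<bullet> v i = - eigenvalue i * (f \<bullet> v i)" by (rule tendsto_unique[rotated]) simp
next
  fix f g assume g: "\<forall>i. g \<bullet> v i = - eigenvalue i * (f \<bullet> v i)"
  \<comment> \<open>The difference quotient of \<open>f\<close> is \<open>g\<close> multiplied by
    \<open>(1 - exp (- x)) / x\<close> with \<open>x = eigenvalue i * t\<close>, a number in
    \<open>[0, 1]\<close>; subtracting 1 leaves a bounded multiplier tending to 0. For eigenvalue 0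
    both the quotient and the coefficient of \<open>g\<close> vanish, so the value 0 is
    consistent.\<close>
  define a where "a t i = (if t > 0 \<and> eigenvalue i > 0 then (1 - exp (- eigenvalue i * t)) / (eigenvalue i * t) - 1 else 0)" for t i
  have a: "\<bar>a t i\<bar> \<le> 1" for t i
  proof (cases "t > 0 \<and> eigenvalue i > 0")
    case True
    define x where "x = eigenvalue i * t"
    have x: "x > 0" using True by (simp add: x_def)
    have "1 - exp (- x) \<le> x" using exp_ge_add_one_self[of "- x"] by linarith
    moreover have "0 \<le> 1 - exp (- x)" using x by simp
    ultimately have "0 \<le> (1 - exp (- x)) / x" "(1 - exp (- x)) / x \<le> 1" using x by simp_all
    then show ?thesis using True by (simp add: a_def x_def)
  qed (auto simp: a_def)
  have "((\<lambda>t. multiplier (a t) g) \<longlongrightarrow> 0) (at_right 0)"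
  proof (rule tendsto_multiplier_0[OF _ _ a])
    fix i
    show "((\<lambda>t. a t i) \<longlongrightarrow> 0) (at_right 0)"
    proof (cases "eigenvalue i > 0")
      case True
      have "((\<lambda>t. (1 - exp (- eigenvalue i * t)) / (eigenvalue i * t) - 1) \<longlongrightarrow> 0) (at_right 0)"
        using True by real_asymp
      moreover have "\<forall>\<^sub>F t in at_right 0. (1 - exp (- eigenvalue i * t)) / (eigenvalue i * t) - 1 = a t i"
        using eventually_at_right_less[of "0::real"] by eventually_elim (use True in \<open>simp add: a_def\<close>)
      ultimately show ?thesis by (rule Lim_transform_eventually)
    qed (simp add: a_def)
  qed simp
  then have "((\<lambda>t. multiplier (a t) g + g) \<longlongrightarrow> 0 + g) (at_right 0)" by (intro tendsto_intros)
  moreover have "\<forall>\<^sub>F t in at_right 0. multiplier (a t) g + g = (semigroup t f - f) /\<^sub>R t"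
    using eventually_at_right_less[of "0::real"]
  proof eventually_elim
    case (elim t)
    show ?case
    proof (rule eqI)
      fix i
      show "(multiplier (a t) g + g) \<bullet> v i = ((semigroup t f - f) /\<^sub>R t) \<bullet> v i"
        using elim g eigenvalue_nonneg[of i]
        by (cases "eigenvalue i = 0")
          (auto simp: inner_add_left multiplier_inner[OF a] a_def semigroup_inner inner_diff_left field_simps)
    qed
  qed
  ultimately have "((\<lambda>t. (semigroup t f - f) /\<^sub>R t) \<longlongrightarrow> g) (at_right 0)"
    by (simp add: Lim_transform_eventually)
  then show "(f, g) \<in> generator_graph semigroup" by (simp add: generator_graph_def)
qed

text \<open>The choice operator promises only some semigroup with generator \<open>A\<close>. Its
  values on eigenvectors are forced, and boundedness of \<open>S t\<close> carries them through the
  expansion of any vector.\<close>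

lemma semigroup_generated_by_eq:
  assumes A: "A = {(f, g). \<forall>i. g \<bullet> v i = - eigenvalue i * (f \<bullet> v i)}" and t: "t \<ge> 0"
  shows "semigroup_generated_by A t = semigroup t"
proof
  fix f
  define S where "S = semigroup_generated_by A"
  have "C0_semigroup S \<and> generator_graph S = A"
    unfolding S_def semigroup_generated_by_def
    by (rule someI[of _ semigroup]) (simp add: C0_semigroup generator A)
  then have S: "C0_semigroup S" and gen: "generator_graph S = A" by auto
  interpret St: bounded_linear "S t" using S t by (auto simp: C0_semigroup_def)
  have eig: "S t (v i) = exp (- eigenvalue i * t) *\<^sub>R v i" for i
  proof (rule C0_semigroup_eigenvector[OF S _ eigenvalue_nonneg t])
    show "(v i, - eigenvalue i *\<^sub>R v i) \<in> generator_graph S" by (auto simp: gen A orthonormal)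
  qed
  have "(\<lambda>i. S t ((f \<bullet> v i) *\<^sub>R v i)) sums S t f" by (rule St.sums[OF expansion])
  moreover have "(\<lambda>i. S t ((f \<bullet> v i) *\<^sub>R v i)) sums semigroup t f"
    using expansion[of "semigroup t f"] t by (simp add: St.scaleR eig semigroup_inner mult.commute)
  ultimately show "semigroup_generated_by A t f = semigroup t f" unfolding S_def by (rule sums_unique2)
qed

end

section \<open>Integration in polar coordinates\<close>

lemma integral_\<mu>_chart:
  fixes F :: "real^3 \<Rightarrow> 'b::{banach, second_countable_topology}"
  assumes [measurable]: "F \<in> borel_measurable borel"
  shows "integral\<^sup>L \<mu> F = (LINT p|lborel. (indicator chart_dom p * sin (fst p)) *\<^sub>R F (chart p))"
proof -
  have "integral\<^sup>L \<mu> F = (LINT p|density lborel (\<lambda>p. ennreal (indicator chart_dom p * vol_density p)). F (chart p))"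
    unfolding \<mu>_def by (rule integral_distr) auto
  also have "\<dots> = (LINT p|lborel. (indicator chart_dom p * vol_density p) *\<^sub>R F (chart p))"
  proof (rule integral_density)
    show "AE p in lborel. 0 \<le> indicator chart_dom p * vol_density p" by (simp add: vol_density_eq)
  qed measurable
  also have "\<dots> = (LINT p|lborel. (indicator chart_dom p * sin (fst p)) *\<^sub>R F (chart p))"
    by (intro Bochner_Integration.integral_cong refl)
      (auto simp: vol_density_eq indicator_def chart_dom_def abs_of_pos sin_gt_zero)
  finally show ?thesis .
qed

lemma borel_measurable_fst_plane [measurable]: "(fst :: real \<times> real \<Rightarrow> real) \<in> borel_measurable borel"
  by (intro borel_measurable_continuous_onI continuous_intros)

lemma borel_measurable_coord [measurable]: "(\<lambda>x::real^3. x $ i) \<in> borel_measurable borel"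
  by (intro borel_measurable_continuous_onI continuous_intros)

lemma integrable_box:
  fixes f :: "real \<times> real \<Rightarrow> 'b::{banach, second_countable_topology}"
  assumes [measurable]: "f \<in> borel_measurable borel" and b: "\<And>p. p \<in> chart_dom \<Longrightarrow> norm (f p) \<le> B"
  shows "integrable lborel (\<lambda>p. indicator chart_dom p *\<^sub>R f p)"
proof (rule Bochner_Integration.integrable_bound)
  have "emeasure lborel chart_dom \<le> emeasure lborel (cbox (0,0) (pi, 2*pi))"
  proof (rule emeasure_mono)
    show "chart_dom \<subseteq> cbox (0,0) (pi, 2*pi)" by (auto simp: chart_dom_def cbox_Pair_eq)
  qed (simp del: cbox_Pair_eq)
  also have "\<dots> < \<infinity>" by (rule emeasure_lborel_cbox_finite)
  finally show "integrable lborel (\<lambda>p. indicator chart_dom p * B)"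
    by (intro integrable_mult_left integrable_real_indicator) auto
  show "AE p in lborel. norm (indicator chart_dom p *\<^sub>R f p) \<le> norm (indicator chart_dom p * B)"
    using b by (intro AE_I2) (auto simp: indicator_def intro: order_trans[OF _ abs_ge_self])
qed simp

lemma chart_dom_indicator: "indicator chart_dom (\<theta>, \<phi>) = (indicator {0<..<pi} \<theta> * indicator {0<..<2*pi} \<phi> :: real)"
  by (simp add: chart_dom_def indicator_times)

lemma integral_box_fst:
  fixes f :: "real \<times> real \<Rightarrow> 'b::{banach, second_countable_topology}"
  assumes "f \<in> borel_measurable borel" and "\<And>p. p \<in> chart_dom \<Longrightarrow> norm (f p) \<le> B"
  shows "(LINT p|lborel. indicator chart_dom p *\<^sub>R f p) =
    (LINT \<theta>|lborel. indicator {0<..<pi} \<theta> *\<^sub>R (LINT \<phi>|lborel. indicator {0<..<2*pi} \<phi> *\<^sub>R f (\<theta>, \<phi>)))"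
proof -
  have "integrable (lborel \<Otimes>\<^sub>M lborel) (\<lambda>p. indicator chart_dom p *\<^sub>R f p)"
    unfolding lborel_prod using assms by (rule integrable_box)
  from lborel_pair.integral_fst'[OF this] show ?thesis
    unfolding lborel_prod by (simp add: chart_dom_indicator flip: scaleR_scaleR)
qed

lemma integral_box_snd:
  fixes f :: "real \<times> real \<Rightarrow> 'b::{banach, second_countable_topology}"
  assumes "f \<in> borel_measurable borel" and "\<And>p. p \<in> chart_dom \<Longrightarrow> norm (f p) \<le> B"
  shows "(LINT p|lborel. indicator chart_dom p *\<^sub>R f p) =
    (LINT \<phi>|lborel. indicator {0<..<2*pi} \<phi> *\<^sub>R (LINT \<theta>|lborel. indicator {0<..<pi} \<theta> *\<^sub>R f (\<theta>, \<phi>)))"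
proof -
  have "integrable (lborel \<Otimes>\<^sub>M lborel) (\<lambda>(x, y). indicator chart_dom (x, y) *\<^sub>R f (x, y))"
    unfolding lborel_prod using integrable_box[OF assms] by (simp add: case_prod_beta')
  from lborel_pair.integral_snd[OF this]
  have "(LINT p|lborel. indicator chart_dom p *\<^sub>R f p) = (LINT \<phi>|lborel. LINT \<theta>|lborel. indicator chart_dom (\<theta>, \<phi>) *\<^sub>R f (\<theta>, \<phi>))"
    unfolding lborel_prod by (simp add: case_prod_beta')
  then show ?thesis
    by (simp add: chart_dom_indicator mult.commute[of "indicator {0<..<pi} _"] flip: scaleR_scaleR)
qed

lemma integral_FTC_open:
  fixes f :: "real \<Rightarrow> 'a::euclidean_space"
  assumes "a \<le> b" and "\<And>x. a \<le> x \<Longrightarrow> x \<le> b \<Longrightarrow> (F has_vector_derivative f x) (at x within {a..b})"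
    and "continuous_on {a..b} f"
  shows "(LINT x|lborel. indicator {a<..<b} x *\<^sub>R f x) = F b - F a"
proof -
  have m: "(\<lambda>x. indicator {a..b} x *\<^sub>R f x) \<in> borel_measurable borel"
    by (rule borel_measurable_continuous_on_indicator) (use assms in auto)
  have eq: "(\<lambda>x. indicator {a<..<b} x *\<^sub>R f x) = (\<lambda>x. indicator {a<..<b} x *\<^sub>R (indicator {a..b} x *\<^sub>R f x))"
    by (auto simp: indicator_def fun_eq_iff)
  have "(LINT x|lborel. indicator {a<..<b} x *\<^sub>R f x) = (LINT x|lborel. indicator {a..b} x *\<^sub>R f x)"
  proof (rule integral_cong_AE)
    show "(\<lambda>x. indicator {a<..<b} x *\<^sub>R f x) \<in> borel_measurable lborel"
      unfolding eq using m by measurable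
    have "AE x in lborel. x \<noteq> a \<and> x \<noteq> b" using AE_lborel_singleton[of a] AE_lborel_singleton[of b] by eventually_elim auto
    then show "AE x in lborel. indicator {a<..<b} x *\<^sub>R f x = indicator {a..b} x *\<^sub>R f x"
      by eventually_elim (auto simp: indicator_def)
  qed (use m in simp)
  also have "\<dots> = F b - F a" by (rule integral_FTC_Icc[OF assms])
  finally show ?thesis .
qed

lemma integral_cis_period:
  assumes "n \<noteq> (0::int)"
  shows "(LINT \<phi>|lborel. indicator {0<..<2*pi} \<phi> *\<^sub>R cis (of_int n * \<phi>)) = 0"
proof -
  have "(LINT \<phi>|lborel. indicator {0<..<2*pi} \<phi> *\<^sub>R cis (of_int n * \<phi>)) =
    cis (of_int n * (2 * pi)) / (\<i> * of_int n) - cis (of_int n * 0) / (\<i> * of_int n)"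
  proof (rule integral_FTC_open)
    fix x :: real
    have "((\<lambda>z. exp (\<i> * of_int n * z) / (\<i> * of_int n)) has_field_derivative exp (\<i> * of_int n * of_real x)) (at (of_real x))"
      using assms by (auto intro!: derivative_eq_intros simp: field_simps)
    from has_vector_derivative_real_field[OF this]
    show "((\<lambda>\<phi>. cis (of_int n * \<phi>) / (\<i> * of_int n)) has_vector_derivative cis (of_int n * x)) (at x within {0..2 * pi})"
      by (simp add: cis_conv_exp mult.assoc)
  qed (auto intro!: continuous_intros)
  also have "cis (of_int n * (2 * pi)) = 1" using cis_multiple_2pi[of "of_int n"] by (simp add: mult_ac)
  finally show ?thesis by simp
qed

lemma integral_\<mu>_mode_zero:
  fixes F :: "real^3 \<Rightarrow> complex"
  assumes [measurable]: "F \<in> borel_measurable borel" and b: "\<And>x. x \<in> S2 \<Longrightarrow> norm (F x) \<le> B"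
    and n: "n \<noteq> 0" and eq: "\<And>\<theta> \<phi>. F (chart (\<theta>, \<phi>)) = G \<theta> * cis (of_int n * \<phi>)"
  shows "integral\<^sup>L \<mu> F = 0"
proof -
  have bd: "norm (sin (fst p) *\<^sub>R F (chart p)) \<le> B" for p
  proof -
    have "\<bar>sin (fst p)\<bar> * norm (F (chart p)) \<le> 1 * B" using b[OF chart_in_S2, of p] by (intro mult_mono) auto
    then show ?thesis by simp
  qed
  have "integral\<^sup>L \<mu> F = (LINT p|lborel. indicator chart_dom p *\<^sub>R (sin (fst p) *\<^sub>R F (chart p)))"
    by (simp add: integral_\<mu>_chart)
  also have "\<dots> = (LINT \<theta>|lborel. indicator {0<..<pi} \<theta> *\<^sub>R (LINT \<phi>|lborel. indicator {0<..<2*pi} \<phi> *\<^sub>R (sin \<theta> *\<^sub>R F (chart (\<theta>, \<phi>)))))"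
    by (subst integral_box_fst[OF _ bd]) auto
  also have "(\<lambda>\<theta>. LINT \<phi>|lborel. indicator {0<..<2*pi} \<phi> *\<^sub>R (sin \<theta> *\<^sub>R F (chart (\<theta>, \<phi>)))) = (\<lambda>_. 0)"
  proof
    fix \<theta>
    have "(LINT \<phi>|lborel. indicator {0<..<2*pi} \<phi> *\<^sub>R (sin \<theta> *\<^sub>R F (chart (\<theta>, \<phi>)))) =
      (LINT \<phi>|lborel. (sin \<theta> *\<^sub>R G \<theta>) * (indicator {0<..<2*pi} \<phi> *\<^sub>R cis (of_int n * \<phi>)))"
      by (simp add: eq mult_ac)
    also have "\<dots> = 0" unfolding integral_mult_right_zero integral_cis_period[OF n] by simp
    finally show "(LINT \<phi>|lborel. indicator {0<..<2*pi} \<phi> *\<^sub>R (sin \<theta> *\<^sub>R F (chart (\<theta>, \<phi>)))) = 0" .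
  qed
  finally show ?thesis by simp
qed

text \<open>Archimedes' hat-box theorem: the density \<open>sin\<close> cancels against the
  substitution by \<open>cos\<close>, so the height \<open>x3\<close> is uniformly
  distributed.\<close>

lemma integral_\<mu>_zonal:
  fixes G :: "real \<Rightarrow> real"
  assumes [measurable]: "G \<in> borel_measurable borel" and b: "\<And>x. \<bar>G x\<bar> \<le> B"
  shows "(\<integral>x. G (x $ 3) \<partial>\<mu>) = 2 * pi * (LINT x|lborel. G x * indicator {-1..1} x)"
proof -
  have bd: "norm (sin (fst p) *\<^sub>R G (chart p $ 3)) \<le> B" for p
  proof -
    have "\<bar>sin (fst p)\<bar> * \<bar>G (chart p $ 3)\<bar> \<le> 1 * B" using b by (intro mult_mono) auto
    then show ?thesis by (simp add: abs_mult)
  qed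
  have "(\<integral>x. G (x $ 3) \<partial>\<mu>) = (LINT p|lborel. indicator chart_dom p *\<^sub>R (sin (fst p) *\<^sub>R G (chart p $ 3)))"
    by (subst integral_\<mu>_chart) (auto simp: mult_ac)
  also have "\<dots> = (LINT \<theta>|lborel. indicator {0<..<pi} \<theta> *\<^sub>R (LINT \<phi>|lborel. indicator {0<..<2*pi} \<phi> *\<^sub>R (sin \<theta> *\<^sub>R G (cos \<theta>))))"
    by (subst integral_box_fst[OF _ bd]) auto
  also have "\<dots> = 2 * pi * (LINT \<theta>|lborel. indicator {0<..<pi} \<theta> *\<^sub>R (sin \<theta> * G (cos \<theta>)))"
    unfolding integral_mult_right_zero[symmetric] by (rule Bochner_Integration.integral_cong) (simp_all add: mult_ac)
  \<comment> \<open>The substitution rule wants an increasing map, hence \<open>- cos\<close>, whose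
    derivative \<open>sin\<close> is nonnegative here; a final reflection undoes the sign.\<close>
  also have "(LINT \<theta>|lborel. indicator {0<..<pi} \<theta> *\<^sub>R (sin \<theta> * G (cos \<theta>))) = (LINT \<theta>|lborel. G (- (- cos \<theta>)) * sin \<theta> * indicator {0..pi} \<theta>)"
  proof (rule integral_cong_AE)
    have "AE x in lborel. x \<noteq> 0 \<and> x \<noteq> pi" using AE_lborel_singleton[of 0] AE_lborel_singleton[of pi] by eventually_elim auto
    then show "AE \<theta> in lborel. indicator {0<..<pi} \<theta> *\<^sub>R (sin \<theta> * G (cos \<theta>)) = G (- (- cos \<theta>)) * sin \<theta> * indicator {0..pi} \<theta>"
      by eventually_elim (auto simp: indicator_def)
  qed simp_all
  also have "\<dots> = (LINT x|lborel. G (- x) * indicator {- cos 0..- cos pi} x)"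
  proof (rule integral_substitution(2)[symmetric, where g'=sin])
    show "set_integrable lborel {- cos 0..- cos pi} (\<lambda>x. G (- x))"
      unfolding set_integrable_def
    proof (rule Bochner_Integration.integrable_bound)
      show "integrable lborel (\<lambda>x. indicator {-1..1::real} x * B)"
        by (intro integrable_mult_left integrable_real_indicator) (auto simp: less_top[symmetric])
    qed (auto simp: indicator_def intro!: order_trans[OF b abs_ge_self])
  qed (auto intro!: derivative_eq_intros continuous_intros sin_ge_zero)
  also have "\<dots> = (LINT x|lborel. G x * indicator {-1..1} x)"
    by (subst lborel_integral_real_affine[where c="-1" and t=0]) (auto intro!: Bochner_Integration.integral_cong simp: indicator_def)
  finally show ?thesis .
qed

section \<open>Smooth functions and integration by parts\<close>

lemma pd_eqI: "(F has_derivative F') (at x) \<Longrightarrow> pd i F x = F' (axis i 1)"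
  unfolding pd_def by (metis frechet_derivative_at)

lemma has_derivative_pd:
  assumes "F differentiable (at x)"
  shows "(F has_derivative (\<lambda>v. \<Sum>i\<in>UNIV. v $ i *\<^sub>R pd i F x)) (at x)"
proof -
  have d: "(F has_derivative frechet_derivative F (at x)) (at x)"
    using assms by (simp add: frechet_derivative_works)
  then have l: "linear (frechet_derivative F (at x))" by (rule has_derivative_linear)
  have "frechet_derivative F (at x) v = (\<Sum>i\<in>UNIV. v $ i *\<^sub>R pd i F x)" for v
  proof -
    have "v = (\<Sum>i\<in>UNIV. v $ i *\<^sub>R axis i 1)"
      using basis_expansion[of v] by (simp add: scalar_mult_eq_scaleR)
    then have "frechet_derivative F (at x) v = frechet_derivative F (at x) (\<Sum>i\<in>UNIV. v $ i *\<^sub>R axis i 1)" by simp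
    also have "\<dots> = (\<Sum>i\<in>UNIV. v $ i *\<^sub>R pd i F x)"
      by (simp add: linear_sum[OF l] linear_cmul[OF l] pd_def)
    finally show ?thesis .
  qed
  then show ?thesis using d by (metis (no_types, lifting) ext)
qed

lemma smooth_differentiable: "smooth F \<Longrightarrow> F differentiable (at x)"
  unfolding smooth_def using differentiable_on_eq_differentiable_at[OF open_UNIV]
  by (metis UNIV_I foldr.simps(1) id_apply)

lemma smooth_continuous: "smooth F \<Longrightarrow> continuous_on A F"
  by (meson continuous_at_imp_continuous_on differentiable_imp_continuous_within smooth_differentiable)

lemma smooth_pd: "smooth F \<Longrightarrow> smooth (pd i F)"
  unfolding smooth_def
proof
  fix js assume "\<forall>is. foldr pd is F differentiable_on UNIV"
  then have "foldr pd (js @ [i]) F differentiable_on UNIV" by blast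
  then show "foldr pd js (pd i F) differentiable_on UNIV" by simp
qed

text \<open>\<open>smooth\<close> speaks of all iterated partial derivatives at once. Exhibiting a
  class of differentiable functions closed under \<open>pd\<close> replaces every induction on such
  iterations.\<close>

lemma smooth_coinduct:
  assumes "P F" "\<And>F x. P F \<Longrightarrow> F differentiable (at x)" "\<And>F i. P F \<Longrightarrow> P (pd i F)"
  shows "smooth F"
  unfolding smooth_def
proof
  fix js
  have "P (foldr pd js F)" by (induction js) (use assms in auto)
  then show "foldr pd js F differentiable_on UNIV"
    using assms(2) by (simp add: differentiable_on_eq_differentiable_at)
qed

lemma pd_add:
  assumes "\<And>x. F differentiable (at x)" "\<And>x. G differentiable (at x)"
  shows "pd i (\<lambda>x. F x + G x) = (\<lambda>x. pd i F x + pd i G x)"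
proof
  fix x
  show "pd i (\<lambda>x. F x + G x) x = pd i F x + pd i G x"
    by (subst pd_eqI[OF has_derivative_add[OF assms[THEN frechet_derivative_works[THEN iffD1]]]]) (simp add: pd_def)
qed

lemma pd_mult:
  assumes "\<And>x. F differentiable (at x)" "\<And>x. G differentiable (at x)"
  shows "pd i (\<lambda>x. F x * G x) = (\<lambda>x. F x * pd i G x + pd i F x * G x)"
proof
  fix x
  show "pd i (\<lambda>x. F x * G x) x = F x * pd i G x + pd i F x * G x"
    by (subst pd_eqI[OF has_derivative_mult[OF assms[THEN frechet_derivative_works[THEN iffD1]]]]) (simp add: pd_def)
qed

text \<open>Products of smooth functions are not closed under \<open>pd\<close> in form, since the
  Leibniz rule creates sums. The algebra they generate is closed, and therefore a valid class for
  \<open>smooth_coinduct\<close>.\<close>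

inductive smooth_algebra :: "(real^3 \<Rightarrow> complex) \<Rightarrow> bool" where
  base: "smooth F \<Longrightarrow> smooth_algebra F"
| add: "smooth_algebra F \<Longrightarrow> smooth_algebra G \<Longrightarrow> smooth_algebra (\<lambda>x. F x + G x)"
| mult: "smooth_algebra F \<Longrightarrow> smooth_algebra G \<Longrightarrow> smooth_algebra (\<lambda>x. F x * G x)"

lemma smooth_algebra_smooth: "smooth_algebra F \<Longrightarrow> smooth F"
proof (rule smooth_coinduct[where P=smooth_algebra])
  show d: "F differentiable (at x)" if "smooth_algebra F" for F x
    using that by induction (auto intro: smooth_differentiable differentiable_add differentiable_mult)
  show "smooth_algebra (pd i F)" if "smooth_algebra F" for F i
    using that
  proof induction
    case (base F)
    then show ?case by (intro smooth_algebra.base smooth_pd)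
  next
    case (add F G)
    then show ?case by (simp add: pd_add d smooth_algebra.add)
  next
    case (mult F G)
    then show ?case unfolding pd_mult[OF d d, OF mult.hyps] by (intro smooth_algebra.add smooth_algebra.mult)
  qed
qed

lemma smooth_add: "smooth F \<Longrightarrow> smooth G \<Longrightarrow> smooth (\<lambda>x. F x + G x)"
  by (rule smooth_algebra_smooth, rule smooth_algebra.add) (auto intro: smooth_algebra.base)

lemma smooth_mult: "smooth F \<Longrightarrow> smooth G \<Longrightarrow> smooth (\<lambda>x. F x * G x)"
  by (rule smooth_algebra_smooth, rule smooth_algebra.mult) (auto intro: smooth_algebra.base)

lemma pd_const: "pd i (\<lambda>_. c) = (\<lambda>_. 0)"
  by (rule ext) (subst pd_eqI[OF has_derivative_const], simp)

lemma smooth_const: "smooth (\<lambda>_. c)"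
  by (rule smooth_coinduct[where P="\<lambda>F. \<exists>c. F = (\<lambda>_. c)"]) (auto simp: pd_const)

lemma has_derivative_coord: "((\<lambda>x::real^3. complex_of_real (x $ j)) has_derivative (\<lambda>v. complex_of_real (v $ j))) (at x)"
  by (intro bounded_linear_imp_has_derivative bounded_linear_compose[OF bounded_linear_of_real] bounded_linear_vec_nth)

lemma pd_coord: "pd i (\<lambda>x. complex_of_real (x $ j)) = (\<lambda>_. if i = j then 1 else 0)"
  by (rule ext) (subst pd_eqI[OF has_derivative_coord], simp add: axis_def)

lemma smooth_coord: "smooth (\<lambda>x. complex_of_real (x $ j))"
proof (rule smooth_coinduct[where P="\<lambda>F. (F = (\<lambda>x. complex_of_real (x $ j))) \<or> (\<exists>c. F = (\<lambda>_. c))"])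
  fix F :: "real^3 \<Rightarrow> complex" and x assume "F = (\<lambda>x. complex_of_real (x $ j)) \<or> (\<exists>c. F = (\<lambda>_. c))"
  then show "F differentiable at x" using has_derivative_coord[of j x] by (auto simp: differentiable_def intro: has_derivative_const)
qed (auto simp: pd_coord pd_const)

lemma pd_cnj:
  assumes "\<And>x. F differentiable (at x)"
  shows "pd i (\<lambda>x. cnj (F x)) = (\<lambda>x. cnj (pd i F x))"
proof
  fix x
  show "pd i (\<lambda>x. cnj (F x)) x = cnj (pd i F x)"
    by (subst pd_eqI[OF bounded_linear.has_derivative[OF bounded_linear_cnj assms[THEN frechet_derivative_works[THEN iffD1]]]]) (simp add: pd_def)
qed

lemma smooth_cnj: "smooth F \<Longrightarrow> smooth (\<lambda>x. cnj (F x))"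
proof (rule smooth_coinduct[where P="\<lambda>F. \<exists>G. smooth G \<and> F = (\<lambda>x. cnj (G x))"])
  fix F :: "real^3 \<Rightarrow> complex" and x i assume "\<exists>G. smooth G \<and> F = (\<lambda>x. cnj (G x))"
  then obtain G where G: "smooth G" "F = (\<lambda>x. cnj (G x))" by blast
  show "F differentiable at x" unfolding G(2)
    using bounded_linear.has_derivative[OF bounded_linear_cnj smooth_differentiable[OF G(1), THEN frechet_derivative_works[THEN iffD1]]]
    by (auto simp: differentiable_def)
  show "\<exists>G. smooth G \<and> pd i F = (\<lambda>x. cnj (G x))"
    unfolding G(2) using smooth_differentiable[OF G(1)] smooth_pd[OF G(1)] by (auto simp: pd_cnj)
qed auto

lemma smooth_uminus: "smooth F \<Longrightarrow> smooth (\<lambda>x. - F x)"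
  using smooth_mult[OF smooth_const[of "-1"]] by simp

lemma smooth_diff: "smooth F \<Longrightarrow> smooth G \<Longrightarrow> smooth (\<lambda>x. F x - G x)"
  using smooth_add[OF _ smooth_uminus] by simp

lemma smooth_power: "smooth F \<Longrightarrow> smooth (\<lambda>x. F x ^ n)"
  by (induction n) (auto intro: smooth_mult smooth_const)

lemma smooth_vecX: "smooth F \<Longrightarrow> smooth (vecX F)"
  and smooth_vecY: "smooth F \<Longrightarrow> smooth (vecY F)"
proof -
  have eq: "vecX F = (\<lambda>x. - (of_real (x $ 3) * pd 2 F x) + of_real (x $ 2) * pd 3 F x)"
    "vecY F = (\<lambda>x. - (of_real (x $ 3) * pd 1 F x) + of_real (x $ 1) * pd 3 F x)"
    by (auto simp: vecX_def vecY_def scaleR_conv_of_real)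
  assume F: "smooth F"
  show "smooth (vecX F)" unfolding eq by (intro smooth_add smooth_uminus smooth_mult smooth_coord smooth_pd F)
  show "smooth (vecY F)" unfolding eq by (intro smooth_add smooth_uminus smooth_mult smooth_coord smooth_pd F)
qed

lemma vec_mult:
  assumes "smooth F" "smooth G"
  shows "vecX (\<lambda>x. F x * G x) = (\<lambda>x. vecX F x * G x + F x * vecX G x)"
    and "vecY (\<lambda>x. F x * G x) = (\<lambda>x. vecY F x * G x + F x * vecY G x)"
  unfolding vecX_def vecY_def pd_mult[OF smooth_differentiable smooth_differentiable, OF assms]
  by (auto simp: algebra_simps fun_eq_iff)

lemma vec_add:
  assumes "smooth F" "smooth G"
  shows "vecX (\<lambda>x. F x + G x) = (\<lambda>x. vecX F x + vecX G x)"
    and "vecY (\<lambda>x. F x + G x) = (\<lambda>x. vecY F x + vecY G x)"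
  unfolding vecX_def vecY_def pd_add[OF smooth_differentiable smooth_differentiable, OF assms]
  by (auto simp: algebra_simps fun_eq_iff)

lemma vec_const: "vecX (\<lambda>_. c) = (\<lambda>_. 0)" "vecY (\<lambda>_. c) = (\<lambda>_. 0)"
  by (auto simp: vecX_def vecY_def pd_const)

lemma vec_cnj:
  assumes "smooth F"
  shows "vecX (\<lambda>x. cnj (F x)) = (\<lambda>x. cnj (vecX F x))" and "vecY (\<lambda>x. cnj (F x)) = (\<lambda>x. cnj (vecY F x))"
  unfolding vecX_def vecY_def pd_cnj[OF smooth_differentiable, OF assms]
  by (auto simp: fun_eq_iff)

lemma integrable_continuous_\<mu>:
  fixes F :: "real^3 \<Rightarrow> 'b::{banach, second_countable_topology}"
  assumes "continuous_on UNIV F" shows "integrable \<mu> F"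
proof -
  have "compact (F ` S2)" by (intro compact_continuous_image continuous_on_subset[OF assms]) auto
  then obtain B where B: "\<And>x. x \<in> S2 \<Longrightarrow> norm (F x) \<le> B" using compact_imp_bounded bounded_iff by (metis imageI)
  show ?thesis
  proof (rule \<mu>.integrable_const_bound)
    show "AE x in \<mu>. norm (F x) \<le> B" using AE_\<mu>_S2 by eventually_elim (rule B)
    show "F \<in> borel_measurable \<mu>" using borel_measurable_continuous_onI[OF assms] by simp
  qed
qed

lemma continuous_square_integrable: "continuous_on UNIV F \<Longrightarrow> square_integrable F"
  unfolding square_integrable_def
  using borel_measurable_continuous_onI[of F] by (auto intro!: integrable_continuous_\<mu> continuous_intros)

lemma smooth_square_integrable: "smooth F \<Longrightarrow> square_integrable F"
  by (intro continuous_square_integrable smooth_continuous)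

lemma continuous_on_chart: "continuous_on A chart"
proof -
  have "continuous_on A (\<lambda>p. chart p $ i)" for i
    using exhaust_3[of i] by (elim disjE; simp) (intro continuous_intros)+
  then show ?thesis using continuous_on_vec_lambda[of A "\<lambda>i p. chart p $ i"] by simp
qed

text \<open>In polar coordinates, the rotation fields are \<open>- s \<partial>\<^sub>\<theta> - s' cot \<theta> \<partial>\<^sub>\<phi>\<close> with \<open>s = sin\<close>, respectively \<open>s = cos\<close>.\<close>

lemma integral_rotation_zero:
  fixes H W :: "real^3 \<Rightarrow> complex" and s s' :: "real \<Rightarrow> real"
  assumes H: "smooth H" and W: "smooth W"
    and s: "\<And>t. (s has_real_derivative s' t) (at t)" "\<And>t. (s' has_real_derivative - s t) (at t)"
    and per: "s' (2 * pi) = s' 0"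
    and polar: "\<And>p. sin (fst p) *\<^sub>R W (chart p) =
      - (s (snd p) * sin (fst p)) *\<^sub>R (\<Sum>i\<in>UNIV. d1_chart p $ i *\<^sub>R pd i H (chart p))
      - (cos (fst p) * s' (snd p)) *\<^sub>R (\<Sum>i\<in>UNIV. d2_chart p $ i *\<^sub>R pd i H (chart p))"
  shows "(\<integral>x. W x \<partial>\<mu>) = 0"
proof -
  define f1 where "f1 p = (\<Sum>i\<in>UNIV. d1_chart p $ i *\<^sub>R pd i H (chart p))" for p
  define f2 where "f2 p = (\<Sum>i\<in>UNIV. d2_chart p $ i *\<^sub>R pd i H (chart p))" for p
  have cs: "continuous_on UNIV s" "continuous_on UNIV s'"
    by (intro continuous_at_imp_continuous_on ballI DERIV_isCont[OF s(1)] DERIV_isCont[OF s(2)])+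
  have css: "continuous_on UNIV (\<lambda>p::real\<times>real. s (snd p))" "continuous_on UNIV (\<lambda>p::real\<times>real. s' (snd p))"
    by (rule continuous_on_compose2[OF cs(1)] continuous_on_compose2[OF cs(2)]; auto intro: continuous_intros)+
  have cf: "continuous_on UNIV (\<lambda>p. H (chart p))" "\<And>i. continuous_on UNIV (\<lambda>p. pd i H (chart p))"
    by (rule continuous_on_compose2[OF smooth_continuous continuous_on_chart]; auto intro: H smooth_pd)+
  have cd: "continuous_on UNIV (\<lambda>p. d1_chart p $ i)" "continuous_on UNIV (\<lambda>p. d2_chart p $ i)" for i
    using exhaust_3[of i] unfolding d1_chart_eq[abs_def] d2_chart_eq[abs_def] by (elim disjE; simp; intro continuous_intros)+
  have cfi: "continuous_on UNIV f1" "continuous_on UNIV f2"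
    unfolding f1_def f2_def by (intro continuous_intros cd cf)+
  \<comment> \<open>Divergence form: \<open>D1\<close> is the derivative in \<open>\<theta>\<close>
    of \<open>- s sin \<theta> H\<close> and \<open>D2\<close> that in \<open>\<phi>\<close> of
    \<open>- cos \<theta> s' H\<close>. Their terms with undifferentiated \<open>H\<close> cancel in
    the sum. The first integrates to zero because \<open>sin\<close> vanishes at the poles, the
    second by periodicity.\<close>
  define D1 where "D1 p = - (s (snd p) * cos (fst p)) *\<^sub>R H (chart p) - (s (snd p) * sin (fst p)) *\<^sub>R f1 p" for p
  define D2 where "D2 p = (s (snd p) * cos (fst p)) *\<^sub>R H (chart p) - (cos (fst p) * s' (snd p)) *\<^sub>R f2 p" for p
  have cD: "continuous_on UNIV D1" "continuous_on UNIV D2"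
    unfolding D1_def D2_def by (intro continuous_intros css cf cfi)+
  have bdd: "\<exists>B. \<forall>p\<in>chart_dom. norm (D p) \<le> B" if "continuous_on UNIV D" for D :: "real \<times> real \<Rightarrow> complex"
  proof -
    have "compact (D ` cbox (0,0) (pi, 2*pi))" by (intro compact_continuous_image continuous_on_subset[OF that]) (auto simp del: cbox_Pair_eq)
    then obtain B where "\<And>p. p \<in> cbox (0,0) (pi, 2*pi) \<Longrightarrow> norm (D p) \<le> B" using compact_imp_bounded bounded_iff by (metis imageI)
    moreover have "chart_dom \<subseteq> cbox (0,0) (pi, 2*pi)" by (auto simp: chart_dom_def cbox_Pair_eq)
    ultimately show ?thesis by blast
  qed
  have chain: "((\<lambda>t. H (g t)) has_vector_derivative (\<Sum>i\<in>UNIV. g' $ i *\<^sub>R pd i H (g t))) (at t within A)"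
    if "(g has_vector_derivative g') (at t)" for g g' t A
    using vector_derivative_diff_chain_within[OF has_vector_derivative_at_within[OF that]
        has_derivative_at_withinI[OF has_derivative_pd[OF smooth_differentiable[OF H]]]]
    by (simp add: o_def)
  have d1: "((\<lambda>t. chart (t, \<phi>)) has_vector_derivative d1_chart (\<theta>, \<phi>)) (at \<theta>)" for \<theta> \<phi>
    unfolding d1_chart_eq by (rule has_vector_derivative_vec3I) (auto intro!: derivative_eq_intros)
  have d2: "((\<lambda>t. chart (\<theta>, t)) has_vector_derivative d2_chart (\<theta>, \<phi>)) (at \<phi>)" for \<theta> \<phi>
    unfolding d2_chart_eq by (rule has_vector_derivative_vec3I) (auto intro!: derivative_eq_intros)
  have slice: "continuous_on A (\<lambda>t. D (t, \<phi>))" "continuous_on A (\<lambda>t. D (\<phi>, t))"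
    if "continuous_on UNIV D" for D :: "real \<times> real \<Rightarrow> complex" and A \<phi>
    by (rule continuous_on_compose2[OF that]; auto intro: continuous_intros)+
  have I1: "(LINT \<theta>|lborel. indicator {0<..<pi} \<theta> *\<^sub>R D1 (\<theta>, \<phi>)) = 0" for \<phi>
  proof -
    have "(LINT \<theta>|lborel. indicator {0<..<pi} \<theta> *\<^sub>R D1 (\<theta>, \<phi>)) =
      - (s \<phi> * sin pi) *\<^sub>R H (chart (pi, \<phi>)) - (- (s \<phi> * sin 0) *\<^sub>R H (chart (0, \<phi>)))"
    proof (rule integral_FTC_open)
      fix \<theta> :: real
      have "((\<lambda>\<theta>. - (s \<phi> * sin \<theta>)) has_real_derivative - (s \<phi> * cos \<theta>)) (at \<theta> within {0..pi})"
        by (auto intro!: derivative_eq_intros)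
      from has_vector_derivative_scaleR[OF this chain[OF d1]]
      show "((\<lambda>\<theta>. - (s \<phi> * sin \<theta>) *\<^sub>R H (chart (\<theta>, \<phi>))) has_vector_derivative D1 (\<theta>, \<phi>)) (at \<theta> within {0..pi})"
        by (simp add: D1_def f1_def algebra_simps)
    qed (auto intro: slice cD)
    then show ?thesis by simp
  qed
  have I2: "(LINT \<phi>|lborel. indicator {0<..<2*pi} \<phi> *\<^sub>R D2 (\<theta>, \<phi>)) = 0" for \<theta>
  proof -
    have "(LINT \<phi>|lborel. indicator {0<..<2*pi} \<phi> *\<^sub>R D2 (\<theta>, \<phi>)) =
      - (cos \<theta> * s' (2*pi)) *\<^sub>R H (chart (\<theta>, 2*pi)) - (- (cos \<theta> * s' 0) *\<^sub>R H (chart (\<theta>, 0)))"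
    proof (rule integral_FTC_open)
      fix \<phi> :: real
      have "((\<lambda>\<phi>. - (cos \<theta> * s' \<phi>)) has_real_derivative (cos \<theta> * s \<phi>)) (at \<phi> within {0..2*pi})"
        using has_field_derivative_at_within[OF s(2)] by (auto intro!: derivative_eq_intros)
      from has_vector_derivative_scaleR[OF this chain[OF d2]]
      show "((\<lambda>\<phi>. - (cos \<theta> * s' \<phi>) *\<^sub>R H (chart (\<theta>, \<phi>))) has_vector_derivative D2 (\<theta>, \<phi>)) (at \<phi> within {0..2*pi})"
        by (simp add: D2_def f2_def algebra_simps)
    qed (auto intro: slice cD)
    also have "chart (\<theta>, 2*pi) = chart (\<theta>, 0)" by (simp add: chart_def)
    finally show ?thesis by (simp add: per)
  qed
  obtain B1 where B1: "\<And>p. p \<in> chart_dom \<Longrightarrow> norm (D1 p) \<le> B1" using bdd[OF cD(1)] by blast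
  obtain B2 where B2: "\<And>p. p \<in> chart_dom \<Longrightarrow> norm (D2 p) \<le> B2" using bdd[OF cD(2)] by blast
  note m = cD[THEN borel_measurable_continuous_onI]
  have "(LINT p|lborel. indicator chart_dom p *\<^sub>R D1 p) = 0"
    by (subst integral_box_snd[OF m(1) B1]) (simp_all add: I1)
  moreover have "(LINT p|lborel. indicator chart_dom p *\<^sub>R D2 p) = 0"
    by (subst integral_box_fst[OF m(2) B2]) (simp_all add: I2)
  ultimately have "(LINT p|lborel. indicator chart_dom p *\<^sub>R D1 p + indicator chart_dom p *\<^sub>R D2 p) = 0"
    using integrable_box[OF m(1) B1] integrable_box[OF m(2) B2] by (subst Bochner_Integration.integral_add) auto
  moreover have "indicator chart_dom p *\<^sub>R D1 p + indicator chart_dom p *\<^sub>R D2 p = (indicator chart_dom p * sin (fst p)) *\<^sub>R W (chart p)" for p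
    unfolding scaleR_scaleR[symmetric] polar by (simp add: D1_def D2_def f1_def f2_def flip: scaleR_add_right)
  ultimately show ?thesis
    unfolding integral_\<mu>_chart[OF borel_measurable_continuous_onI[OF smooth_continuous[OF W]]] by simp
qed

lemma rotation_field_polar:
  fixes P1 P2 P3 :: complex and s c S C :: real
  assumes "S\<^sup>2 + C\<^sup>2 = 1"
  shows "s *\<^sub>R (- c *\<^sub>R P2 + (s * S) *\<^sub>R P3) = - (S * s) *\<^sub>R ((c * C) *\<^sub>R P1 + (c * S) *\<^sub>R P2 + (- s) *\<^sub>R P3)
      - (c * C) *\<^sub>R (- (s * S) *\<^sub>R P1 + (s * C) *\<^sub>R P2)" (is "_ = ?A")
    and "s *\<^sub>R (- c *\<^sub>R P1 + (s * C) *\<^sub>R P3) = - (C * s) *\<^sub>R ((c * C) *\<^sub>R P1 + (c * S) *\<^sub>R P2 + (- s) *\<^sub>R P3)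
      - (c * - S) *\<^sub>R (- (s * S) *\<^sub>R P1 + (s * C) *\<^sub>R P2)" (is "_ = ?B")
proof -
  have "?A = (- (s * c) * (S\<^sup>2 + C\<^sup>2)) *\<^sub>R P2 + (s * s * S) *\<^sub>R P3"
    by (simp add: scaleR_add_right scaleR_diff_right algebra_simps power2_eq_square)
  then show "s *\<^sub>R (- c *\<^sub>R P2 + (s * S) *\<^sub>R P3) = ?A" unfolding assms by (simp add: scaleR_add_right scaleR_diff_right mult_ac)
  have "?B = (- (s * c) * (S\<^sup>2 + C\<^sup>2)) *\<^sub>R P1 + (s * s * C) *\<^sub>R P3"
    by (simp add: scaleR_add_right scaleR_diff_right algebra_simps power2_eq_square)
  then show "s *\<^sub>R (- c *\<^sub>R P1 + (s * C) *\<^sub>R P3) = ?B" unfolding assms by (simp add: scaleR_add_right scaleR_diff_right mult_ac)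
qed

text \<open>The fields generate rotations, so this is the infinitesimal form of rotation invariance
  of \<open>\<mu>\<close>; the formal adjoints are then the negatives of the fields.\<close>

lemma integral_vec_zero:
  assumes H: "smooth H"
  shows "(\<integral>x. vecX H x \<partial>\<mu>) = 0" "(\<integral>x. vecY H x \<partial>\<mu>) = 0"
proof -
  show "(\<integral>x. vecX H x \<partial>\<mu>) = 0"
  proof (rule integral_rotation_zero[OF H smooth_vecX[OF H]])
    fix p :: "real \<times> real"
    show "sin (fst p) *\<^sub>R vecX H (chart p) = - (sin (snd p) * sin (fst p)) *\<^sub>R (\<Sum>i\<in>UNIV. d1_chart p $ i *\<^sub>R pd i H (chart p))
      - (cos (fst p) * cos (snd p)) *\<^sub>R (\<Sum>i\<in>UNIV. d2_chart p $ i *\<^sub>R pd i H (chart p))"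
      using rotation_field_polar(1)[where S="sin (snd p)" and C="cos (snd p)" and s="sin (fst p)" and c="cos (fst p)"
          and ?P1.0="pd 1 H (chart p)" and ?P2.0="pd 2 H (chart p)" and ?P3.0="pd 3 H (chart p)"]
      by (simp add: sum_3 d1_chart_eq d2_chart_eq vecX_def mult_ac)
  qed (auto intro!: derivative_eq_intros)
  show "(\<integral>x. vecY H x \<partial>\<mu>) = 0"
  proof (rule integral_rotation_zero[OF H smooth_vecY[OF H]])
    fix p :: "real \<times> real"
    show "sin (fst p) *\<^sub>R vecY H (chart p) = - (cos (snd p) * sin (fst p)) *\<^sub>R (\<Sum>i\<in>UNIV. d1_chart p $ i *\<^sub>R pd i H (chart p))
      - (cos (fst p) * - sin (snd p)) *\<^sub>R (\<Sum>i\<in>UNIV. d2_chart p $ i *\<^sub>R pd i H (chart p))"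
      using rotation_field_polar(2)[where S="sin (snd p)" and C="cos (snd p)" and s="sin (fst p)" and c="cos (fst p)"
          and ?P1.0="pd 1 H (chart p)" and ?P2.0="pd 2 H (chart p)" and ?P3.0="pd 3 H (chart p)"]
      by (simp add: sum_3 d1_chart_eq d2_chart_eq vecY_def mult_ac)
  qed (auto intro!: derivative_eq_intros)
qed

section \<open>Formal adjoints and the operator as a sum of squares\<close>

lemma formal_adjoint_uminus:
  assumes smooth: "\<And>F. smooth F \<Longrightarrow> smooth (P F)"
    and mult: "\<And>F G. smooth F \<Longrightarrow> smooth G \<Longrightarrow> P (\<lambda>x. F x * G x) = (\<lambda>x. P F x * G x + F x * P G x)"
    and cnj: "\<And>F. smooth F \<Longrightarrow> P (\<lambda>x. cnj (F x)) = (\<lambda>x. cnj (P F x))"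
    and zero: "\<And>F. smooth F \<Longrightarrow> (\<integral>x. P F x \<partial>\<mu>) = 0"
  shows "is_formal_adjoint P (\<lambda>F x. - P F x)"
  unfolding is_formal_adjoint_def
proof (intro conjI allI impI)
  fix F G assume F: "smooth F" and G: "smooth G"
  have "0 = (\<integral>x. P F x * cnj (G x) + F x * cnj (P G x) \<partial>\<mu>)"
    using zero[OF smooth_mult[OF F smooth_cnj[OF G]]] by (simp add: mult F G smooth_cnj cnj)
  also have "\<dots> = (\<integral>x. P F x * cnj (G x) \<partial>\<mu>) + (\<integral>x. F x * cnj (P G x) \<partial>\<mu>)"
    by (intro Bochner_Integration.integral_add square_integrable_mult_integrable smooth_square_integrable smooth F G)
  finally show "(\<integral>x. P F x * cnj (G x) \<partial>\<mu>) = (\<integral>x. F x * cnj (- P G x) \<partial>\<mu>)"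
    by (simp add: eq_neg_iff_add_eq_0)
qed (intro smooth_uminus smooth)

text \<open>Testing both adjoint identities with the difference \<open>Q G - Q' G\<close> itself
  shows that its norm is zero. Off the sphere nothing is determined, hence the formulation almost
  everywhere.\<close>

lemma formal_adjoint_unique:
  assumes Q: "is_formal_adjoint P Q" "is_formal_adjoint P Q'" and G: "smooth G"
  shows "AE x in \<mu>. Q G x = Q' G x"
proof -
  define D where "D x = Q G x - Q' G x" for x
  have s: "smooth (Q G)" "smooth (Q' G)" using Q G by (auto simp: is_formal_adjoint_def)
  then have D: "smooth D" unfolding D_def by (rule smooth_diff)
  have "(\<integral>x. D x * cnj (Q G x) \<partial>\<mu>) = (\<integral>x. D x * cnj (Q' G x) \<partial>\<mu>)"
  proof -
    have "(\<integral>x. P D x * cnj (G x) \<partial>\<mu>) = (\<integral>x. D x * cnj (Q G x) \<partial>\<mu>)"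
      "(\<integral>x. P D x * cnj (G x) \<partial>\<mu>) = (\<integral>x. D x * cnj (Q' G x) \<partial>\<mu>)"
      using Q D G unfolding is_formal_adjoint_def by blast+
    then show ?thesis by simp
  qed
  then have "(\<integral>x. D x * cnj (Q G x) - D x * cnj (Q' G x) \<partial>\<mu>) = 0"
    by (subst Bochner_Integration.integral_diff) (auto intro: square_integrable_mult_integrable smooth_square_integrable D s)
  also have "(\<lambda>x. D x * cnj (Q G x) - D x * cnj (Q' G x)) = (\<lambda>x. complex_of_real ((norm (D x))\<^sup>2))"
  proof
    fix x
    have "D x * cnj (Q G x) - D x * cnj (Q' G x) = D x * cnj (D x)" by (simp add: D_def right_diff_distrib)
    then show "D x * cnj (Q G x) - D x * cnj (Q' G x) = complex_of_real ((norm (D x))\<^sup>2)"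
      by (simp only: complex_norm_square)
  qed
  finally have "(\<integral>x. (norm (D x))\<^sup>2 \<partial>\<mu>) = 0" unfolding integral_complex_of_real by simp
  moreover have "integrable \<mu> (\<lambda>x. (norm (D x))\<^sup>2)" using smooth_square_integrable[OF D] by (simp add: square_integrable_def)
  ultimately have "AE x in \<mu>. (norm (D x))\<^sup>2 = 0" by (subst (asm) integral_nonneg_eq_0_iff_AE) auto
  then show ?thesis by eventually_elim (simp add: D_def)
qed

lemma is_formal_adjoint_vec:
  "is_formal_adjoint vecX (\<lambda>F x. - vecX F x)" "is_formal_adjoint vecY (\<lambda>F x. - vecY F x)"
  by (rule formal_adjoint_uminus[OF smooth_vecX vec_mult(1) vec_cnj(1) integral_vec_zero(1)]
      formal_adjoint_uminus[OF smooth_vecY vec_mult(2) vec_cnj(2) integral_vec_zero(2)]; assumption)+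

text \<open>A concrete representative of \<open>L_smooth\<close>, whose definition involves chosen
  adjoints; the two agree almost everywhere, and all computations are done with this one.\<close>

definition sum_squares :: "(real^3 \<Rightarrow> complex) \<Rightarrow> real^3 \<Rightarrow> complex" where
  "sum_squares F x = vecX (vecX F) x + vecY (vecY F) x"

lemma smooth_sum_squares: "smooth F \<Longrightarrow> smooth (sum_squares F)"
  unfolding sum_squares_def[abs_def] by (intro smooth_add smooth_vecX smooth_vecY)

lemma AE_L_smooth: "smooth F \<Longrightarrow> AE x in \<mu>. L_smooth F x = sum_squares F x"
proof -
  assume F: "smooth F"
  have "is_formal_adjoint vecX (formal_adjoint vecX)" "is_formal_adjoint vecY (formal_adjoint vecY)"
    unfolding formal_adjoint_def
    by (rule someI[of "is_formal_adjoint vecX", OF is_formal_adjoint_vec(1)]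
        someI[of "is_formal_adjoint vecY", OF is_formal_adjoint_vec(2)])+
  from this(1)[THEN formal_adjoint_unique, OF is_formal_adjoint_vec(1) smooth_vecX[OF F]]
    this(2)[THEN formal_adjoint_unique, OF is_formal_adjoint_vec(2) smooth_vecY[OF F]]
  show ?thesis
    by eventually_elim (simp add: L_smooth_def sum_squares_def)
qed

lemma sum_squares_symmetric:
  assumes F: "smooth F" and G: "smooth G"
  shows "(\<integral>x. sum_squares F x * cnj (G x) \<partial>\<mu>) = (\<integral>x. F x * cnj (sum_squares G x) \<partial>\<mu>)"
proof -
  have X: "(\<integral>x. vecX F x * cnj (G x) \<partial>\<mu>) = - (\<integral>x. F x * cnj (vecX G x) \<partial>\<mu>)"
    and Y: "(\<integral>x. vecY F x * cnj (G x) \<partial>\<mu>) = - (\<integral>x. F x * cnj (vecY G x) \<partial>\<mu>)" if "smooth F" "smooth G" for F G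
    using is_formal_adjoint_vec that unfolding is_formal_adjoint_def by simp_all
  note sm = smooth_vecX smooth_vecY F G
  note int = square_integrable_mult_integrable[OF smooth_square_integrable smooth_square_integrable]
  have "(\<integral>x. sum_squares F x * cnj (G x) \<partial>\<mu>) = (\<integral>x. vecX (vecX F) x * cnj (G x) \<partial>\<mu>) + (\<integral>x. vecY (vecY F) x * cnj (G x) \<partial>\<mu>)"
    unfolding sum_squares_def distrib_right by (intro Bochner_Integration.integral_add int sm)
  also have "\<dots> = (\<integral>x. F x * cnj (vecX (vecX G) x) \<partial>\<mu>) + (\<integral>x. F x * cnj (vecY (vecY G) x) \<partial>\<mu>)"
    by (simp add: X Y sm)
  also have "\<dots> = (\<integral>x. F x * cnj (sum_squares G x) \<partial>\<mu>)"
    unfolding sum_squares_def complex_cnj_add distrib_left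
    by (intro Bochner_Integration.integral_add[symmetric] int sm)
  finally show ?thesis .
qed

section \<open>Spherical harmonics\<close>

text \<open>The sign of \<open>n\<close> selects \<open>x1 + i x2\<close> or its conjugate, so that
  on the sphere the function is \<open>sin^|n| p(cos)\<close> times \<open>cis (n \<phi>)\<close>.
  Keeping \<open>p\<close> arbitrary allows one formula for monomials, eigenfunctions and their
  combinations.\<close>

definition sph :: "int \<Rightarrow> real poly \<Rightarrow> real^3 \<Rightarrow> complex" where
  "sph n p x = (of_real (x $ 1) + (if n \<ge> 0 then \<i> else - \<i>) * of_real (x $ 2)) ^ nat \<bar>n\<bar> * of_real (poly p (x $ 3))"

lemma smooth_poly: "smooth (\<lambda>x. of_real (poly p (x $ 3)))"
  by (induction p) (simp_all add: smooth_const smooth_add smooth_mult smooth_coord)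

lemma vec_coord:
  "vecX (\<lambda>x. of_real (x $ 1)) = (\<lambda>x. 0)" "vecX (\<lambda>x. of_real (x $ 2)) = (\<lambda>x. - of_real (x $ 3))"
  "vecX (\<lambda>x. of_real (x $ 3)) = (\<lambda>x. of_real (x $ 2))"
  "vecY (\<lambda>x. of_real (x $ 1)) = (\<lambda>x. - of_real (x $ 3))" "vecY (\<lambda>x. of_real (x $ 2)) = (\<lambda>x. 0)"
  "vecY (\<lambda>x. of_real (x $ 3)) = (\<lambda>x. of_real (x $ 1))"
  by (auto simp: vecX_def vecY_def pd_coord fun_eq_iff scaleR_conv_of_real)

lemma vec_poly:
  "vecX (\<lambda>x. of_real (poly p (x $ 3))) = (\<lambda>x. of_real (x $ 2) * of_real (poly (pderiv p) (x $ 3)))"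
  "vecY (\<lambda>x. of_real (poly p (x $ 3))) = (\<lambda>x. of_real (x $ 1) * of_real (poly (pderiv p) (x $ 3)))"
proof (induction p)
  case 0
  {
    case 1 show ?case by (simp add: vec_const)
  next
    case 2 show ?case by (simp add: vec_const)
  }
next
  case (pCons a p)
  have s: "smooth (\<lambda>x. of_real (x $ 3) * of_real (poly p (x $ 3)))"
    by (intro smooth_mult smooth_coord smooth_poly)
  have eq: "(\<lambda>x::real^3. complex_of_real (poly (pCons a p) (x $ 3))) = (\<lambda>x. of_real a + of_real (x $ 3) * of_real (poly p (x $ 3)))"
    by simp
  {
    case 1 show ?case
      unfolding eq vec_add(1)[OF smooth_const s] vec_mult(1)[OF smooth_coord smooth_poly] vec_const vec_coord pCons
      by (simp add: pderiv_pCons algebra_simps)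
  next
    case 2 show ?case
      unfolding eq vec_add(2)[OF smooth_const s] vec_mult(2)[OF smooth_coord smooth_poly] vec_const vec_coord pCons
      by (simp add: pderiv_pCons algebra_simps)
  }
qed

lemma vec_power:
  assumes F: "smooth F"
  shows "vecX (\<lambda>x. F x ^ m) = (\<lambda>x. vecX F x * (of_nat m * F x ^ (m - 1)))"
    and "vecY (\<lambda>x. F x ^ m) = (\<lambda>x. vecY F x * (of_nat m * F x ^ (m - 1)))"
proof (induction m)
  case 0
  {
    case 1 show ?case by (simp add: vec_const)
  next
    case 2 show ?case by (simp add: vec_const)
  }
next
  case (Suc m)
  {
    case 1 show ?case
      unfolding power_Suc vec_mult(1)[OF F smooth_power[OF F]] Suc
      by (cases m) (auto simp: algebra_simps)
  next
    case 2 show ?case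
      unfolding power_Suc vec_mult(2)[OF F smooth_power[OF F]] Suc
      by (cases m) (auto simp: algebra_simps)
  }
qed

lemma smooth_sph: "smooth (sph n p)"
  unfolding sph_def[abs_def] by (intro smooth_mult smooth_power smooth_add smooth_coord smooth_const smooth_poly)

lemma S2_coord: "x \<in> S2 \<Longrightarrow> (x $ 1)\<^sup>2 + (x $ 2)\<^sup>2 + (x $ 3)\<^sup>2 = 1"
  by (simp add: norm_eq_sqrt_inner inner_vec_def sum_3 power2_eq_square)

lemma sum_squares_sph:
  assumes x: "x \<in> S2"
  shows "sum_squares (sph n p) x = sph n (gegenbauer_op (nat \<bar>n\<bar>) p - smult (real (nat \<bar>n\<bar>)) p) x"
proof -
  define e where "e = (if n \<ge> 0 then \<i> else - \<i>)"
  have e2: "e * e = - 1" by (simp add: e_def)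
  define m where "m = nat \<bar>n\<bar>"
  define c1 c2 c3 where c: "c1 = (\<lambda>x::real^3. complex_of_real (x $ 1))" "c2 = (\<lambda>x::real^3. complex_of_real (x $ 2))" "c3 = (\<lambda>x::real^3. complex_of_real (x $ 3))"
  define W where "W = (\<lambda>x. c1 x + e * c2 x)"
  define P0 P1 P2 where P: "P0 = (\<lambda>x::real^3. complex_of_real (poly p (x $ 3)))"
    "P1 = (\<lambda>x::real^3. complex_of_real (poly (pderiv p) (x $ 3)))"
    "P2 = (\<lambda>x::real^3. complex_of_real (poly (pderiv (pderiv p)) (x $ 3)))"
  define A where "A = (\<lambda>x. W x ^ m)"
  \<comment> \<open>\<open>A1\<close> and \<open>A2\<close> are the first and second derivatives of
    the power. Truncated subtraction in the exponents is harmless, as the factors in front vanish in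
    those cases.\<close>
  define A1 where "A1 = (\<lambda>x. of_nat m * W x ^ (m - 1))"
  define A2 where "A2 = (\<lambda>x. of_nat m * (of_nat (m - 1) * W x ^ (m - 1 - 1)))"
  have sc: "smooth c1" "smooth c2" "smooth c3" unfolding c by (rule smooth_coord)+
  have sP: "smooth P0" "smooth P1" "smooth P2" unfolding P by (rule smooth_poly)+
  have sW: "smooth W" unfolding W_def by (intro smooth_add smooth_mult smooth_const sc)
  have sA: "smooth A" "smooth A1" unfolding A_def A1_def by (intro smooth_mult smooth_const smooth_power sW)+
  note s = sc sP sA smooth_const
  have vc: "vecX c2 = (\<lambda>x. - c3 x)" "vecX c3 = c2" "vecX c1 = (\<lambda>x. 0)"
      "vecY c1 = (\<lambda>x. - c3 x)" "vecY c3 = c1" "vecY c2 = (\<lambda>x. 0)"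
    unfolding c by (simp_all only: vec_coord)
  have vP: "vecX P0 = (\<lambda>x. c2 x * P1 x)" "vecX P1 = (\<lambda>x. c2 x * P2 x)"
     "vecY P0 = (\<lambda>x. c1 x * P1 x)" "vecY P1 = (\<lambda>x. c1 x * P2 x)"
    unfolding P c by (rule vec_poly)+
  have vW: "vecX W = (\<lambda>x. - (e * c3 x))" "vecY W = (\<lambda>x. - c3 x)"
    unfolding W_def by (simp_all add: vec_add vec_mult vec_const vc smooth_mult s)
  have vA: "vecX A = (\<lambda>x. - (e * c3 x) * A1 x)" "vecY A = (\<lambda>x. - c3 x * A1 x)"
    unfolding A_def vec_power[OF sW] vW A1_def by auto
  have vA1: "vecX A1 = (\<lambda>x. - (e * c3 x) * A2 x)" "vecY A1 = (\<lambda>x. - c3 x * A2 x)"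
    unfolding A1_def vec_mult[OF smooth_const smooth_power[OF sW]] vec_const vec_power[OF sW] vW A2_def by (auto simp: mult_ac)
  have F: "sph n p = (\<lambda>x. A x * P0 x)"
    by (auto simp: sph_def A_def W_def c P e_def m_def)
  have X1: "vecX (sph n p) = (\<lambda>x. (- e) * (c3 x * (A1 x * P0 x)) + A x * (c2 x * P1 x))"
    unfolding F vec_mult(1)[OF s(7) s(4)] vA vP by (auto simp: mult_ac)
  have Y1: "vecY (sph n p) = (\<lambda>x. (- 1) * (c3 x * (A1 x * P0 x)) + A x * (c1 x * P1 x))"
    unfolding F vec_mult(2)[OF s(7) s(4)] vA vP by (auto simp: mult_ac)
  have X2: "vecX (vecX (sph n p)) x = (- e) * (c2 x * (A1 x * P0 x) + c3 x * (- (e * c3 x) * A2 x * P0 x + A1 x * (c2 x * P1 x)))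
      + (- (e * c3 x) * A1 x * (c2 x * P1 x) + A x * (- c3 x * P1 x + c2 x * (c2 x * P2 x)))" for x
    unfolding X1
      vec_add(1)[OF smooth_mult[OF smooth_const smooth_mult[OF sc(3) smooth_mult[OF sA(2) sP(1)]]] smooth_mult[OF sA(1) smooth_mult[OF sc(2) sP(2)]]]
      vec_mult(1)[OF smooth_const smooth_mult[OF sc(3) smooth_mult[OF sA(2) sP(1)]]] vec_mult(1)[OF sc(3) smooth_mult[OF sA(2) sP(1)]]
      vec_mult(1)[OF sA(2) sP(1)] vec_mult(1)[OF sA(1) smooth_mult[OF sc(2) sP(2)]] vec_mult(1)[OF sc(2) sP(2)] vec_const vc vP vA vA1
    by (simp add: algebra_simps)
  have Y2: "vecY (vecY (sph n p)) x = (- 1) * (c1 x * (A1 x * P0 x) + c3 x * (- c3 x * A2 x * P0 x + A1 x * (c1 x * P1 x)))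
      + (- c3 x * A1 x * (c1 x * P1 x) + A x * (- c3 x * P1 x + c1 x * (c1 x * P2 x)))" for x
    unfolding Y1
      vec_add(2)[OF smooth_mult[OF smooth_const smooth_mult[OF sc(3) smooth_mult[OF sA(2) sP(1)]]] smooth_mult[OF sA(1) smooth_mult[OF sc(1) sP(2)]]]
      vec_mult(2)[OF smooth_const smooth_mult[OF sc(3) smooth_mult[OF sA(2) sP(1)]]] vec_mult(2)[OF sc(3) smooth_mult[OF sA(2) sP(1)]]
      vec_mult(2)[OF sA(2) sP(1)] vec_mult(2)[OF sA(1) smooth_mult[OF sc(1) sP(2)]] vec_mult(2)[OF sc(1) sP(2)] vec_const vc vP vA vA1
    by (simp add: algebra_simps)
  have A1W: "A1 x * (c1 x + e * c2 x) = of_nat m * A x"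
    by (cases m) (auto simp: A1_def A_def W_def)
  have sphere: "c1 x * c1 x + c2 x * c2 x = 1 - c3 x * c3 x"
  proof -
    have "(x $ 1)\<^sup>2 + (x $ 2)\<^sup>2 = 1 - (x $ 3)\<^sup>2" using S2_coord[OF x] by simp
    then have "complex_of_real ((x $ 1)\<^sup>2 + (x $ 2)\<^sup>2) = complex_of_real (1 - (x $ 3)\<^sup>2)" by simp
    then show ?thesis by (simp add: c power2_eq_square)
  qed
  \<comment> \<open>Three identities finish the computation: \<open>1 + e * e = 0\<close> removes
    the second derivative of the power, \<open>A1 * W = m * A\<close> is Euler's relation, and the
    equation of the sphere eliminates \<open>x1\<close> and \<open>x2\<close> in front of
    \<open>P2\<close>.\<close>
  have "sum_squares (sph n p) x =
      - P0 x * (A1 x * (c1 x + e * c2 x)) - 2 * (c3 x * P1 x * (A1 x * (c1 x + e * c2 x))) + (1 + e * e) * (c3 x * c3 x * A2 x * P0 x)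
      - 2 * (c3 x * (A x * P1 x)) + A x * P2 x * (c1 x * c1 x + c2 x * c2 x)"
    unfolding sum_squares_def X2 Y2 by (simp add: algebra_simps)
  also have "\<dots> = A x * ((1 - c3 x * c3 x) * P2 x - 2 * (of_nat m + 1) * c3 x * P1 x - of_nat m * P0 x)"
    unfolding A1W sphere e2 by (simp add: algebra_simps)
  also have "\<dots> = sph n (gegenbauer_op m p - smult (real m) p) x"
    by (simp add: sph_def A_def W_def c P e_def m_def poly_gegenbauer_op power2_eq_square)
  finally show ?thesis by (simp add: m_def)
qed

definition eigenfun :: "int \<Rightarrow> nat \<Rightarrow> real^3 \<Rightarrow> complex" where
  "eigenfun n k = sph n (gegenbauer (nat \<bar>n\<bar>) k)"

definition eigval :: "int \<Rightarrow> nat \<Rightarrow> real" where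
  "eigval n k = real (nat \<bar>n\<bar>) + kappa (nat \<bar>n\<bar>) k"

lemma sph_smult: "sph n (smult c p) x = of_real c * sph n p x"
  by (simp add: sph_def)

lemma sum_squares_eigenfun: "x \<in> S2 \<Longrightarrow> sum_squares (eigenfun n k) x = - of_real (eigval n k) * eigenfun n k x"
proof -
  define m where "m = nat \<bar>n\<bar>"
  assume "x \<in> S2"
  moreover have "gegenbauer_op m (gegenbauer m k) - smult (real m) (gegenbauer m k) = smult (- eigval n k) (gegenbauer m k)"
    unfolding gegenbauer_eigen by (rule poly_eqI) (simp add: eigval_def m_def algebra_simps)
  ultimately show ?thesis
    unfolding eigenfun_def m_def by (simp only: sum_squares_sph sph_smult of_real_minus)
qed

lemma sph_chart: "sph n p (chart (\<theta>, \<phi>)) = of_real (sin \<theta> ^ nat \<bar>n\<bar> * poly p (cos \<theta>)) * cis (of_int n * \<phi>)"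
proof -
  have "of_real (chart (\<theta>, \<phi>) $ 1) + (if n \<ge> 0 then \<i> else - \<i>) * of_real (chart (\<theta>, \<phi>) $ 2)
     = of_real (sin \<theta>) * cis (of_int (sgn n) * \<phi>)" if "n \<noteq> 0"
    using that by (auto simp: complex_eq_iff sgn_if)
  moreover have "cis (of_int (sgn n) * \<phi>) ^ nat \<bar>n\<bar> = cis (of_int n * \<phi>)"
  proof -
    have "real (nat \<bar>n\<bar>) * (of_int (sgn n) * \<phi>) = of_int n * \<phi>" by (auto simp: sgn_if)
    then show ?thesis by (simp only: Complex.DeMoivre)
  qed
  ultimately show ?thesis
    by (cases "n = 0") (auto simp: sph_def power_mult_distrib)
qed

lemma norm_sph:
  assumes "x \<in> S2" shows "(norm (sph n p x))\<^sup>2 = (1 - (x $ 3)\<^sup>2) ^ nat \<bar>n\<bar> * (poly p (x $ 3))\<^sup>2"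
proof -
  define W where "W = of_real (x $ 1) + (if n \<ge> 0 then \<i> else - \<i>) * of_real (x $ 2)"
  have W: "(norm W)\<^sup>2 = 1 - (x $ 3)\<^sup>2"
    using S2_coord[OF assms] unfolding W_def cmod_power2 by (auto simp: power2_eq_square)
  have "(norm (sph n p x))\<^sup>2 = ((norm W)\<^sup>2) ^ nat \<bar>n\<bar> * (poly p (x $ 3))\<^sup>2"
    unfolding sph_def W_def[symmetric]
    by (simp add: norm_mult norm_power power_mult_distrib mult.commute flip: power_mult)
  then show ?thesis unfolding W .
qed

lemma continuous_sph: "continuous_on A (sph n p)"
  by (rule smooth_continuous[OF smooth_sph])

lemma measurable_sph [measurable]: "sph n p \<in> borel_measurable borel"
  by (rule borel_measurable_continuous_onI[OF continuous_sph])

lemma square_integrable_sph: "square_integrable (sph n p)"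
  by (rule smooth_square_integrable[OF smooth_sph])

lemma bounded_sph: "\<exists>B. \<forall>x\<in>S2. norm (sph n p x) \<le> B"
proof -
  have "compact (sph n p ` S2)" by (intro compact_continuous_image continuous_sph) auto
  then show ?thesis using compact_imp_bounded bounded_iff by (metis imageI)
qed

lemma sph_orthogonal_mode:
  assumes n: "n \<noteq> n'" and [measurable]: "g \<in> borel_measurable borel" and g: "\<And>t. norm (g t) \<le> 1"
  shows "(\<integral>x. g (x $ 3) * (sph n p x * cnj (sph n' q x)) \<partial>\<mu>) = 0"
proof -
  obtain B where B: "\<And>x. x \<in> S2 \<Longrightarrow> norm (sph n p x) \<le> B" using bounded_sph by blast
  obtain B' where B': "\<And>x. x \<in> S2 \<Longrightarrow> norm (sph n' q x) \<le> B'" using bounded_sph by blast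
  have [measurable]: "(\<lambda>x. cnj (sph n' q x)) \<in> borel_measurable borel"
    by (intro borel_measurable_continuous_onI continuous_intros continuous_sph)
  show ?thesis
  proof (rule integral_\<mu>_mode_zero)
    show "norm (g (x $ 3) * (sph n p x * cnj (sph n' q x))) \<le> 1 * (B * B')" if "x \<in> S2" for x
      unfolding norm_mult complex_mod_cnj using that g B B'
      by (intro mult_mono mult_nonneg_nonneg order_trans[OF norm_ge_zero B]) auto
    show "n - n' \<noteq> 0" using n by simp
    show "g (chart (\<theta>, \<phi>) $ 3) * (sph n p (chart (\<theta>, \<phi>)) * cnj (sph n' q (chart (\<theta>, \<phi>)))) =
       (g (cos \<theta>) * of_real (sin \<theta> ^ nat \<bar>n\<bar> * poly p (cos \<theta>) * (sin \<theta> ^ nat \<bar>n'\<bar> * poly q (cos \<theta>)))) * cis (of_int (n - n') * \<phi>)" for \<theta> \<phi>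
      unfolding sph_chart by (simp add: cis_cnj cis_mult left_diff_distrib)
  qed measurable
qed

lemma eigval_strict_mono: "i < j \<Longrightarrow> eigval n i < eigval n j"
  unfolding eigval_def using kappa_strict_mono by auto

text \<open>Different angular momenta are separated by the integral over \<open>\<phi>\<close>; for
  equal ones the eigenvalues differ and the operator is symmetric.\<close>

lemma eigenfun_orthogonal:
  assumes "(n, k) \<noteq> (n', k')"
  shows "(\<integral>x. eigenfun n k x * cnj (eigenfun n' k' x) \<partial>\<mu>) = 0"
proof (cases "n = n'")
  case False
  then show ?thesis using sph_orthogonal_mode[of n n' "\<lambda>_. 1"] by (simp add: eigenfun_def)
next
  case True
  then have "k \<noteq> k'" using assms by simp
  then have ne: "eigval n k \<noteq> eigval n k'" using eigval_strict_mono by (metis less_irrefl linorder_neqE_nat)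
  let ?I = "\<integral>x. eigenfun n k x * cnj (eigenfun n k' x) \<partial>\<mu>"
  have sm: "smooth (eigenfun n k)" for k by (simp add: eigenfun_def smooth_sph)
  have m: "(\<lambda>x. F x * cnj (G x)) \<in> borel_measurable \<mu>" if "smooth F" "smooth G" for F G
    by (intro borel_measurable_integrable square_integrable_mult_integrable smooth_square_integrable that)
  have "- of_real (eigval n k) * ?I = (\<integral>x. - of_real (eigval n k) * (eigenfun n k x * cnj (eigenfun n k' x)) \<partial>\<mu>)" by simp
  also have "\<dots> = (\<integral>x. sum_squares (eigenfun n k) x * cnj (eigenfun n k' x) \<partial>\<mu>)"
  proof (rule integral_cong_AE)
    show "AE x in \<mu>. - of_real (eigval n k) * (eigenfun n k x * cnj (eigenfun n k' x)) = sum_squares (eigenfun n k) x * cnj (eigenfun n k' x)"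
      using AE_\<mu>_S2 by eventually_elim (simp add: sum_squares_eigenfun)
    show "(\<lambda>x. sum_squares (eigenfun n k) x * cnj (eigenfun n k' x)) \<in> borel_measurable \<mu>"
      by (intro m smooth_sum_squares sm)
    show "(\<lambda>x. - of_real (eigval n k) * (eigenfun n k x * cnj (eigenfun n k' x))) \<in> borel_measurable \<mu>"
      by (intro borel_measurable_times borel_measurable_const m sm)
  qed
  also have "\<dots> = (\<integral>x. eigenfun n k x * cnj (sum_squares (eigenfun n k') x) \<partial>\<mu>)"
    by (rule sum_squares_symmetric[OF sm sm])
  also have "\<dots> = (\<integral>x. - of_real (eigval n k') * (eigenfun n k x * cnj (eigenfun n k' x)) \<partial>\<mu>)"
  proof (rule integral_cong_AE)
    show "AE x in \<mu>. eigenfun n k x * cnj (sum_squares (eigenfun n k') x) = - of_real (eigval n k') * (eigenfun n k x * cnj (eigenfun n k' x))"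
      using AE_\<mu>_S2 by eventually_elim (simp add: sum_squares_eigenfun)
    show "(\<lambda>x. eigenfun n k x * cnj (sum_squares (eigenfun n k') x)) \<in> borel_measurable \<mu>"
      by (intro m smooth_sum_squares sm)
    show "(\<lambda>x. - of_real (eigval n k') * (eigenfun n k x * cnj (eigenfun n k' x))) \<in> borel_measurable \<mu>"
      by (intro borel_measurable_times borel_measurable_const m sm)
  qed
  also have "\<dots> = - of_real (eigval n k') * ?I" by simp
  finally have "of_real (eigval n k - eigval n k') * ?I = 0" by (simp add: algebra_simps)
  then show ?thesis using ne True by simp
qed

text \<open>The polynomials \<open>gegenbauer m k\<close> minimise the weighted norm among monic polynomials of degree \<open>k\<close>.\<close>

lemma norm_eigenfun_le: "(\<integral>x. (norm (eigenfun n k x))\<^sup>2 \<partial>\<mu>) \<le> measure \<mu> UNIV"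
proof -
  define m where "m = nat \<bar>n\<bar>"
  define r where "r = monom 1 k - gegenbauer m k"
  have "coeff r i = 0" if "i \<ge> k" for i
    using that coeff_gegenbauer_lead[of m k] coeff_gegenbauer_above[of k i m] by (cases "i = k") (auto simp: r_def)
  then obtain c where c: "r = (\<Sum>j<k. smult (c j) (gegenbauer m j))" using gegenbauer_span by blast
  have sr: "sph n r x = (\<Sum>j<k. of_real (c j) * eigenfun n j x)" for x
    by (simp add: c sph_def eigenfun_def m_def poly_sum sum_distrib_left mult_ac)
  have mon: "sph n (monom 1 k) x = eigenfun n k x + sph n r x" for x
    by (simp add: r_def sph_def eigenfun_def m_def algebra_simps)
  have sm: "square_integrable (eigenfun n k)" for k by (simp add: eigenfun_def square_integrable_sph)
  have "(\<integral>x. eigenfun n k x * cnj (sph n r x) \<partial>\<mu>) = (\<integral>x. (\<Sum>j<k. of_real (c j) * (eigenfun n k x * cnj (eigenfun n j x))) \<partial>\<mu>)"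
    by (simp add: sr sum_distrib_left mult_ac)
  also have "\<dots> = (\<Sum>j<k. of_real (c j) * (\<integral>x. eigenfun n k x * cnj (eigenfun n j x) \<partial>\<mu>))"
    by (subst Bochner_Integration.integral_sum)
      (auto intro!: Bochner_Integration.integrable_mult_right square_integrable_mult_integrable sm)
  also have "\<dots> = 0" by (intro sum.neutral ballI) (simp add: eigenfun_orthogonal)
  finally have orth: "(\<integral>x. eigenfun n k x \<bullet> sph n r x \<partial>\<mu>) = 0"
    unfolding inner_eq_Re_cnj integral_Re[OF square_integrable_mult_integrable[OF sm square_integrable_sph]] by simp
  have sq: "integrable \<mu> (\<lambda>x. (norm (eigenfun n k x))\<^sup>2)" using sm by (simp add: square_integrable_def)
  have sqm: "integrable \<mu> (\<lambda>x. (norm (sph n p x))\<^sup>2)" for p using square_integrable_sph by (simp add: square_integrable_def)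
  have "(\<integral>x. (norm (eigenfun n k x))\<^sup>2 \<partial>\<mu>) = (\<integral>x. (norm (eigenfun n k x))\<^sup>2 + 2 * (eigenfun n k x \<bullet> sph n r x) \<partial>\<mu>)"
    using sq orth square_integrable_inner_integrable[OF sm square_integrable_sph] by simp
  also have "\<dots> \<le> (\<integral>x. (norm (sph n (monom 1 k) x))\<^sup>2 \<partial>\<mu>)"
  proof (intro integral_mono sqm)
    show "integrable \<mu> (\<lambda>x. (norm (eigenfun n k x))\<^sup>2 + 2 * (eigenfun n k x \<bullet> sph n r x))"
      using sq square_integrable_inner_integrable[OF sm square_integrable_sph] by simp
    show "(norm (eigenfun n k x))\<^sup>2 + 2 * (eigenfun n k x \<bullet> sph n r x) \<le> (norm (sph n (monom 1 k) x))\<^sup>2" for x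
      unfolding mon power2_norm_eq_inner by (simp add: inner_add_left inner_add_right inner_commute)
  qed
  also have "\<dots> \<le> (\<integral>x. 1 \<partial>\<mu>)"
  proof (rule integral_mono_AE)
    show "AE x in \<mu>. (norm (sph n (monom 1 k) x))\<^sup>2 \<le> 1"
      using AE_\<mu>_S2
    proof eventually_elim
      case (elim x)
      have "(x $ 1)\<^sup>2 + (x $ 2)\<^sup>2 + (x $ 3)\<^sup>2 = 1" by (rule S2_coord[OF elim])
      moreover define y where "y = (x $ 3)\<^sup>2"
      moreover have "0 \<le> (x $ 1)\<^sup>2" "0 \<le> (x $ 2)\<^sup>2" "0 \<le> (x $ 3)\<^sup>2" by simp_all
      ultimately have y: "0 \<le> y" "y \<le> 1" by linarith+
      then have "(1 - y) ^ nat \<bar>n\<bar> * y ^ k \<le> 1 * 1"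
        by (intro mult_mono power_le_one) auto
      then have "(1 - (x $ 3)\<^sup>2) ^ nat \<bar>n\<bar> * ((x $ 3)\<^sup>2) ^ k \<le> 1" unfolding y_def by simp
      then show ?case unfolding norm_sph[OF elim] by (simp add: poly_monom power_mult[symmetric] mult.commute)
    qed
  qed (use sqm in auto)
  finally show ?thesis by simp
qed

text \<open>On the band the weight \<open>(1 - x3^2)^|n|\<close> is at least its value at
  \<open>b\<close>, and the zonal integral formula reduces the rest to one variable. Since
  \<open>A\<close> may be any Borel set containing the band, the lemma serves both the control
  region and the norm over the whole sphere.\<close>

lemma band_lower_bound:
  assumes ab: "0 \<le> a" "a < b" "b \<le> 1" and [measurable]: "A \<in> sets borel"
    and A: "\<And>x. x \<in> S2 \<Longrightarrow> a < x $ 3 \<Longrightarrow> x $ 3 < b \<Longrightarrow> x \<in> A"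
  shows "2 * pi * (1 - b\<^sup>2) ^ nat \<bar>n\<bar> * integral {a..b} (\<lambda>t. (poly p t)\<^sup>2) \<le> (\<integral>x. indicator A x * (norm (sph n p x))\<^sup>2 \<partial>\<mu>)"
proof -
  let ?q = "(1 - b\<^sup>2) ^ nat \<bar>n\<bar>"
  have q0: "?q \<ge> 0" using ab by (simp add: power_le_one)
  define G where "G t = indicator {a<..<b} t * (?q * (poly p t)\<^sup>2)" for t
  have cont: "continuous_on {a..b} (\<lambda>t. ?q * (poly p t)\<^sup>2)" by (intro continuous_intros)
  have "compact ((\<lambda>t. ?q * (poly p t)\<^sup>2) ` {a..b})" by (intro compact_continuous_image cont) auto
  from compact_imp_bounded[OF this, unfolded bounded_iff]
  obtain B where "\<forall>y\<in>(\<lambda>t. ?q * (poly p t)\<^sup>2) ` {a..b}. norm y \<le> B" by (rule exE)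
  then have B: "\<And>t. t \<in> {a..b} \<Longrightarrow> norm (?q * (poly p t)\<^sup>2) \<le> B" by (rule bspec) (rule imageI)
  have B0: "B \<ge> 0" using B[of a] ab by (meson atLeastAtMost_iff less_imp_le norm_ge_zero order_refl order_trans)
  have Gb: "\<bar>G t\<bar> \<le> B" for t using B[of t] B0 by (auto simp: G_def indicator_def)
  have [measurable]: "(\<lambda>t. poly p t) \<in> borel_measurable borel" by (intro borel_measurable_continuous_onI continuous_intros)
  have Gm [measurable]: "G \<in> borel_measurable borel" unfolding G_def by measurable
  have "(LINT t|lborel. G t * indicator {-1..1} t) = (LINT t:{a<..<b}|lborel. ?q * (poly p t)\<^sup>2)"
    unfolding set_lebesgue_integral_def using ab by (intro Bochner_Integration.integral_cong refl) (auto simp: G_def indicator_def)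
  also have "\<dots> = integral {a<..<b} (\<lambda>t. ?q * (poly p t)\<^sup>2)"
    by (intro set_borel_integral_eq_integral set_integrable_subset[OF borel_integrable_atLeastAtMost'[OF cont]]) auto
  also have "\<dots> = ?q * integral {a..b} (\<lambda>t. (poly p t)\<^sup>2)" by (simp add: integral_open_interval_real)
  finally have "2 * pi * ?q * integral {a..b} (\<lambda>t. (poly p t)\<^sup>2) = (\<integral>x. G (x $ 3) \<partial>\<mu>)"
    using integral_\<mu>_zonal[OF Gm Gb] by simp
  also have "\<dots> \<le> (\<integral>x. indicator A x * (norm (sph n p x))\<^sup>2 \<partial>\<mu>)"
  proof (rule integral_mono_AE)
    show "integrable \<mu> (\<lambda>x. G (x $ 3))"
      by (rule \<mu>.integrable_const_bound[where B=B]) (use Gb in auto)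
    show "integrable \<mu> (\<lambda>x. indicator A x * (norm (sph n p x))\<^sup>2)"
      by (rule Bochner_Integration.integrable_bound[where f="\<lambda>x. (norm (sph n p x))\<^sup>2"])
        (use square_integrable_sph[of n p] in \<open>auto simp: square_integrable_def indicator_def\<close>)
    show "AE x in \<mu>. G (x $ 3) \<le> indicator A x * (norm (sph n p x))\<^sup>2"
      using AE_\<mu>_S2
    proof eventually_elim
      case (elim x)
      show ?case
      proof (cases "a < x $ 3 \<and> x $ 3 < b")
        case True
        then have "(x $ 3)\<^sup>2 \<le> b\<^sup>2" using ab by (intro power_mono) auto
        then have "?q \<le> (1 - (x $ 3)\<^sup>2) ^ nat \<bar>n\<bar>" using ab by (intro power_mono) (auto simp: power_le_one)
        then show ?thesis using True A[OF elim] unfolding G_def norm_sph[OF elim] by (auto intro: mult_right_mono)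
      next
        case False
        then have "G (x $ 3) = 0" by (auto simp: G_def)
        then show ?thesis by simp
      qed
    qed
  qed
  finally show ?thesis .
qed

section \<open>Completeness of the harmonics\<close>

text \<open>All polynomials, generated from the complex coordinates \<open>x1 + i x2\<close>,
  \<open>x1 - i x2\<close> and \<open>x3\<close>; in these each single monomial restricts to one
  \<open>sph n p\<close>.\<close>

inductive monomial_span :: "(real^3 \<Rightarrow> complex) \<Rightarrow> bool" where
  monomial: "monomial_span (\<lambda>x. (of_real (x $ 1) + \<i> * of_real (x $ 2)) ^ a * (of_real (x $ 1) - \<i> * of_real (x $ 2)) ^ b * of_real (x $ 3) ^ c)"
| add: "monomial_span F \<Longrightarrow> monomial_span G \<Longrightarrow> monomial_span (\<lambda>x. F x + G x)"
| scale: "monomial_span F \<Longrightarrow> monomial_span (\<lambda>x. c * F x)"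

lemma monomial_span_mult:
  assumes "monomial_span F" "monomial_span G" shows "monomial_span (\<lambda>x. F x * G x)"
  using assms(1)
proof induction
  case (monomial a b c)
  show ?case
    using assms(2)
  proof induction
    case (monomial a' b' c')
    show ?case using monomial_span.monomial[of "a + a'" "b + b'" "c + c'"] by (simp add: power_add mult_ac)
  next
    case (add F G) then show ?case by (simp add: distrib_left monomial_span.add)
  next
    case (scale F c') then show ?case by (simp add: mult.left_commute[of _ c'] monomial_span.scale)
  qed
next
  case (add F G) then show ?case by (simp add: distrib_right monomial_span.add)
next
  case (scale F c') then show ?case by (simp add: mult.assoc monomial_span.scale)
qed

lemma monomial_span_const: "monomial_span (\<lambda>_. c)"
  using monomial_span.scale[OF monomial_span.monomial[of 0 0 0], of c] by simp

lemma monomial_span_coord: "monomial_span (\<lambda>x. of_real (x $ i))"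
proof -
  note m = monomial_span.monomial[of 1 0 0] monomial_span.monomial[of 0 1 0] monomial_span.monomial[of 0 0 1]
  have "monomial_span (\<lambda>x. of_real (x $ 1))" "monomial_span (\<lambda>x. of_real (x $ 2))"
    using monomial_span.add[OF monomial_span.scale[OF m(1), of "1/2"] monomial_span.scale[OF m(2), of "1/2"]]
      monomial_span.add[OF monomial_span.scale[OF m(1), of "- \<i>/2"] monomial_span.scale[OF m(2), of "\<i>/2"]]
    by (simp_all add: algebra_simps add_divide_distrib[symmetric] diff_divide_distrib[symmetric])
  then show ?thesis using m(3) exhaust_3[of i] by auto
qed

lemma monomial_span_real_polynomial:
  assumes "real_polynomial_function F" shows "monomial_span (\<lambda>x. of_real (F x))"
  using assms
proof induction
  case (linear f)
  have f: "f x = (\<Sum>i\<in>UNIV. x $ i * f (axis i 1))" for x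
  proof -
    have "x = (\<Sum>i\<in>UNIV. x $ i *\<^sub>R axis i 1)"
      using basis_expansion[of x] by (simp add: scalar_mult_eq_scaleR)
    then have "f x = f (\<Sum>i\<in>UNIV. x $ i *\<^sub>R axis i 1)" by simp
    also have "\<dots> = (\<Sum>i\<in>UNIV. x $ i * f (axis i 1))"
      using linear by (simp add: linear_sum linear_cmul bounded_linear.linear)
    finally show ?thesis .
  qed
  have "(\<lambda>x. complex_of_real (f x)) = (\<lambda>x. of_real (f (axis 1 1)) * of_real (x $ 1) + of_real (f (axis 2 1)) * of_real (x $ 2) + of_real (f (axis 3 1)) * of_real (x $ 3))"
    by (rule ext, subst f) (simp add: sum_3 mult_ac)
  then show ?case by (auto intro!: monomial_span.add monomial_span.scale monomial_span_coord)
qed (auto intro: monomial_span_const monomial_span.add monomial_span_mult)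

text \<open>On the sphere \<open>(x1 + i x2) (x1 - i x2) = 1 - x3^2\<close>, so paired factors
  become part of the polynomial in \<open>x3\<close> and the surplus determines \<open>n\<close> and
  its sign.\<close>

lemma monomial_eq_sph:
  "\<exists>n p. \<forall>x\<in>S2. (of_real (x $ 1) + \<i> * of_real (x $ 2)) ^ a * (of_real (x $ 1) - \<i> * of_real (x $ 2)) ^ b * of_real (x $ 3) ^ c = sph n p x"
proof -
  define W where "W x = complex_of_real (x $ 1) + \<i> * of_real (x $ 2)" for x :: "real^3"
  define V where "V x = complex_of_real (x $ 1) - \<i> * of_real (x $ 2)" for x :: "real^3"
  have WV: "W x * V x = of_real (1 - (x $ 3)\<^sup>2)" if "x \<in> S2" for x
  proof -
    have "1 - (x $ 3)\<^sup>2 = (x $ 1)\<^sup>2 + (x $ 2)\<^sup>2" using S2_coord[OF that] by simp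
    then show ?thesis by (simp only:) (simp add: W_def V_def complex_eq_iff power2_eq_square)
  qed
  have one: "poly [:1, 0, -1:] t = 1 - t\<^sup>2" for t :: real by (simp add: power2_eq_square)
  show ?thesis unfolding W_def[symmetric] V_def[symmetric]
  proof (cases "b \<le> a")
    case True
    show "\<exists>n p. \<forall>x\<in>S2. W x ^ a * V x ^ b * of_real (x $ 3) ^ c = sph n p x"
    proof (intro exI ballI)
      fix x assume x: "x \<in> S2"
      have "W x ^ a * V x ^ b = W x ^ (a - b) * (W x * V x) ^ b"
        using True by (simp add: power_mult_distrib flip: power_add mult.assoc)
      then show "W x ^ a * V x ^ b * of_real (x $ 3) ^ c = sph (int (a - b)) ([:1, 0, -1:] ^ b * [:0, 1:] ^ c) x"
        unfolding WV[OF x] by (simp add: sph_def W_def poly_power one mult.assoc del: poly_pCons) simp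
    qed
  next
    case False
    then obtain d where d: "b = a + d" "d > 0" by (metis add_diff_inverse_nat le_eq_less_or_eq less_imp_le_nat not_le zero_less_diff le_add_diff_inverse)
    show "\<exists>n p. \<forall>x\<in>S2. W x ^ a * V x ^ b * of_real (x $ 3) ^ c = sph n p x"
    proof (intro exI ballI)
      fix x assume x: "x \<in> S2"
      have "W x ^ a * V x ^ b = V x ^ d * (W x * V x) ^ a"
        using d by (simp add: power_mult_distrib power_add mult_ac)
      then show "W x ^ a * V x ^ b * of_real (x $ 3) ^ c = sph (- int d) ([:1, 0, -1:] ^ a * [:0, 1:] ^ c) x"
        unfolding WV[OF x] using d by (simp add: sph_def V_def poly_power one mult.assoc del: poly_pCons) simp
    qed
  qed
qed

text \<open>As \<open>\<mu>\<close> is finite, \<open>h\<close> is integrable, so an approximation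
  that is uniform on the sphere passes through the integral.\<close>

lemma orthogonal_continuous:
  assumes h: "square_integrable h" and orth: "\<And>n p. (\<integral>x. h x * cnj (sph n p x) \<partial>\<mu>) = 0"
    and G: "continuous_on UNIV G"
  shows "(\<integral>x. h x * cnj (G x) \<partial>\<mu>) = 0"
proof -
  have hm [measurable]: "h \<in> borel_measurable \<mu>" using h by (simp add: square_integrable_def)
  have cont: "continuous_on UNIV F" if "monomial_span F" for F
    using that by induction (auto intro!: continuous_intros)
  note int = square_integrable_mult_integrable[OF h continuous_square_integrable]
  have span: "(\<integral>x. h x * cnj (F x) \<partial>\<mu>) = 0" if "monomial_span F" for F
    using that
  proof induction
    case (monomial a b c)
    obtain n p where np: "\<And>x. x\<in>S2 \<Longrightarrow> (of_real (x $ 1) + \<i> * of_real (x $ 2)) ^ a * (of_real (x $ 1) - \<i> * of_real (x $ 2)) ^ b * of_real (x $ 3) ^ c = sph n p x"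
      using monomial_eq_sph by meson
    have "(\<integral>x. h x * cnj ((of_real (x $ 1) + \<i> * of_real (x $ 2)) ^ a * (of_real (x $ 1) - \<i> * of_real (x $ 2)) ^ b * of_real (x $ 3) ^ c) \<partial>\<mu>)
      = (\<integral>x. h x * cnj (sph n p x) \<partial>\<mu>)"
    proof (rule integral_cong_AE)
      show "AE x in \<mu>. h x * cnj ((of_real (x $ 1) + \<i> * of_real (x $ 2)) ^ a * (of_real (x $ 1) - \<i> * of_real (x $ 2)) ^ b * of_real (x $ 3) ^ c) = h x * cnj (sph n p x)"
        using AE_\<mu>_S2 by eventually_elim (simp only: np)
    qed (rule borel_measurable_integrable, rule int, intro cont monomial_span.monomial, rule borel_measurable_integrable, rule int, rule continuous_sph)
    then show ?case using orth by simp
  next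
    case (add F G)
    then show ?case
      using Bochner_Integration.integral_add[OF int[OF cont[OF add(1)]] int[OF cont[OF add(2)]]]
      by (simp add: distrib_left)
  next
    case (scale F c)
    then show ?case by (simp add: mult.left_commute[of _ "cnj c"])
  qed
  have h1: "integrable \<mu> (\<lambda>x. norm (h x))" using int[OF continuous_on_const[of UNIV 1]] by simp
  define K where "K = (\<integral>x. norm (h x) \<partial>\<mu>)"
  have K: "K \<ge> 0" by (simp add: K_def)
  have "norm (\<integral>x. h x * cnj (G x) \<partial>\<mu>) \<le> e * K" if e: "e > 0" for e
  proof -
    obtain g where g: "polynomial_function g" "\<And>x. x \<in> S2 \<Longrightarrow> norm (G x - g x) < e"
      using Stone_Weierstrass_polynomial_function[OF compact_sphere continuous_on_subset[OF G] e, of 0 1] by auto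
    have "monomial_span (\<lambda>x. of_real (Re (g x)) + \<i> * of_real (Im (g x)))"
      using g(1) bounded_linear_Re bounded_linear_Im unfolding polynomial_function_def o_def
      by (intro monomial_span.add monomial_span.scale monomial_span_real_polynomial) auto
    then have gs: "monomial_span g" by (simp flip: complex_eq)
    have "(\<integral>x. h x * cnj (G x) \<partial>\<mu>) = (\<integral>x. h x * cnj (G x) - h x * cnj (g x) \<partial>\<mu>)"
      using span[OF gs] int[OF G] int[OF cont[OF gs]] by simp
    also have "norm \<dots> \<le> (\<integral>x. norm (h x * cnj (G x) - h x * cnj (g x)) \<partial>\<mu>)"
      by (rule integral_norm_bound)
    also have "\<dots> \<le> (\<integral>x. e * norm (h x) \<partial>\<mu>)"
    proof (rule integral_mono_AE)
      show "integrable \<mu> (\<lambda>x. norm (h x * cnj (G x) - h x * cnj (g x)))" using int[OF G] int[OF cont[OF gs]] by simp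
      show "integrable \<mu> (\<lambda>x. e * norm (h x))" using h1 by simp
      show "AE x in \<mu>. norm (h x * cnj (G x) - h x * cnj (g x)) \<le> e * norm (h x)"
        using AE_\<mu>_S2
      proof eventually_elim
        case (elim x)
        have "norm (h x * cnj (G x) - h x * cnj (g x)) = norm (h x) * norm (G x - g x)"
          by (metis complex_cnj_diff complex_mod_cnj norm_mult right_diff_distrib)
        also have "\<dots> \<le> norm (h x) * e" using g(2)[OF elim] by (intro mult_left_mono) auto
        finally show ?case by (simp add: mult.commute)
      qed
    qed
    finally show ?thesis by (simp add: K_def)
  qed
  note le = this
  have "norm (\<integral>x. h x * cnj (G x) \<partial>\<mu>) \<le> 0"
  proof (rule field_le_epsilon)
    fix d :: real assume d: "d > 0"
    have "norm (\<integral>x. h x * cnj (G x) \<partial>\<mu>) \<le> d / (K + 1) * K" using K d by (intro le) auto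
    also have "\<dots> \<le> d" using K d by (simp add: field_simps)
    finally show "norm (\<integral>x. h x * cnj (G x) \<partial>\<mu>) \<le> 0 + d" by simp
  qed
  then show ?thesis by simp
qed

text \<open>Orthogonality passes from continuous functions to indicators of open sets by truncated
  distance functions, to Borel sets by a Dynkin class argument, and is then applied to the sets
  where the real or imaginary part of \<open>h\<close> or of \<open>- h\<close> is positive.\<close>

lemma orthogonal_imp_zero:
  assumes h: "square_integrable h" and orth: "\<And>n p. (\<integral>x. h x * cnj (sph n p x) \<partial>\<mu>) = 0"
  shows "AE x in \<mu>. h x = 0"
proof -
  have hm: "h \<in> borel_measurable \<mu>" using h by (simp add: square_integrable_def)
  note [measurable] = hm
  have h1: "integrable \<mu> h" using square_integrable_mult_integrable[OF h square_integrable_const[of 1]] by simp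
  have intA: "set_integrable \<mu> A h" if "A \<in> sets borel" for A
    unfolding set_integrable_def by (rule integrable_mult_indicator) (use that h1 in auto)
  \<comment> \<open>\<open>infdist\<close> to the empty set is 0 by convention, so the approximation
    by \<open>F n\<close> fails for \<open>U = UNIV\<close>; there the constant 1 is tested
    instead.\<close>
  have open_zero: "(LINT x:U|\<mu>. h x) = 0" if U: "open U" for U
  proof (cases "U = UNIV")
    case True
    then show ?thesis using orthogonal_continuous[OF h orth, of "\<lambda>_. 1"] by (simp add: set_lebesgue_integral_def)
  next
    case False
    define F where "F n x = min 1 (real n * infdist x (- U))" for n x
    have [measurable]: "U \<in> sets borel" using U by simp
    have Fc: "continuous_on UNIV (F n)" for n
      unfolding F_def by (intro continuous_intros)
    then have Fm [measurable]: "F n \<in> borel_measurable borel" for n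
      by (rule borel_measurable_continuous_onI)
    have zero: "(\<integral>x. F n x *\<^sub>R h x \<partial>\<mu>) = 0" for n
      using orthogonal_continuous[OF h orth continuous_on_of_real[OF Fc[of n]]]
      by (simp add: scaleR_conv_of_real mult.commute)
    have "(\<lambda>n. \<integral>x. F n x *\<^sub>R h x \<partial>\<mu>) \<longlonglongrightarrow> (\<integral>x. indicator U x *\<^sub>R h x \<partial>\<mu>)"
    proof (rule integral_dominated_convergence[where w="\<lambda>x. norm (h x)"])
      show "AE x in \<mu>. (\<lambda>n. F n x *\<^sub>R h x) \<longlonglongrightarrow> indicator U x *\<^sub>R h x"
      proof (rule AE_I2)
        fix x
        have "(\<lambda>n. F n x) \<longlonglongrightarrow> indicator U x"
        proof (cases "x \<in> U")
          case True
          have "closed (- U)" using U by (simp add: closed_def)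
          then have "infdist x (- U) > 0" using True False infdist_pos_not_in_closed[of "- U" x] by auto
          then obtain N :: nat where N: "1 < real N * infdist x (- U)" using reals_Archimedean3 by blast
          have "F n x = 1" if "n \<ge> N" for n
          proof -
            have "real N * infdist x (- U) \<le> real n * infdist x (- U)" using that by (intro mult_right_mono infdist_nonneg) auto
            then show ?thesis using N by (simp add: F_def)
          qed
          then have "\<forall>\<^sub>F n in sequentially. F n x = 1" by (intro eventually_sequentiallyI[of N])
          then show ?thesis using True by (simp add: tendsto_eventually)
        next
          case False
          then have "F n x = 0" for n by (simp add: F_def)
          then show ?thesis using False by simp
        qed
        then show "(\<lambda>n. F n x *\<^sub>R h x) \<longlonglongrightarrow> indicator U x *\<^sub>R h x" by (intro tendsto_intros)
      qed
      show "AE x in \<mu>. norm (F n x *\<^sub>R h x) \<le> norm (h x)" for n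
      proof (rule AE_I2)
        fix x
        have "0 \<le> F n x" "F n x \<le> 1" by (simp_all add: F_def infdist_nonneg)
        then show "norm (F n x *\<^sub>R h x) \<le> norm (h x)" by (simp add: mult_left_le_one_le)
      qed
    qed (use h1 in simp_all)
    then show ?thesis using zero by (simp add: set_lebesgue_integral_def LIMSEQ_const_iff)
  qed
  have borel_zero: "(LINT x:A|\<mu>. h x) = 0" if A: "A \<in> sets borel" for A
  proof -
    have "A \<in> sigma_sets UNIV {U. open U}" using A by (simp add: borel_def)
    moreover have "Int_stable {U::(real^3) set. open U}" by (auto simp: Int_stable_def)
    moreover have "{U::(real^3) set. open U} \<subseteq> Pow UNIV" by simp
    ultimately show ?thesis
    proof (elim sigma_sets_induct_disjoint[rotated 2, where P="\<lambda>A. (LINT x:A|\<mu>. h x) = 0"])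
      fix A
      show "(LINT x:A|\<mu>. h x) = 0" if "A \<in> {U. open U}" using that open_zero by simp
      show "(LINT x:UNIV - A|\<mu>. h x) = 0" if "A \<in> sigma_sets UNIV {U. open U}" "(LINT x:A|\<mu>. h x) = 0"
      proof -
        have A: "A \<in> sets borel" using that(1) by (simp add: borel_def)
        have "(LINT x:(UNIV - A) \<union> A|\<mu>. h x) = (LINT x:UNIV - A|\<mu>. h x) + (LINT x:A|\<mu>. h x)"
          using A by (intro set_integral_Un intA) auto
        then show ?thesis using that(2) open_zero[of UNIV] by simp
      qed
    next
      show "(LINT x:{}|\<mu>. h x) = 0" by (simp add: set_lebesgue_integral_def)
    next
      fix A :: "nat \<Rightarrow> (real^3) set"
      assume A: "disjoint_family A" "range A \<subseteq> sigma_sets UNIV {U. open U}" "\<And>i. (LINT x:A i|\<mu>. h x) = 0"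
      have Ai: "A i \<in> sets borel" for i using A(2) by (auto simp: borel_def)
      have "(LINT x:(\<Union>i. A i)|\<mu>. h x) = (\<Sum>i. (LINT x:(A i)|\<mu>. h x))"
        using A(1) Ai by (intro lebesgue_integral_countable_add intA) (auto simp: disjoint_family_on_def)
      then show "(LINT x:\<Union> (range A)|\<mu>. h x) = 0" using A(3) by simp
    qed
  qed
  have key: "AE x in \<mu>. \<not> T (h x) > 0" if T: "bounded_linear T" for T :: "complex \<Rightarrow> real"
  proof -
    define A where "A = {x. T (h x) > 0}"
    have [measurable]: "T \<in> borel_measurable borel"
      using T by (intro borel_measurable_continuous_onI linear_continuous_on)
    have "{x \<in> space \<mu>. T (h x) > 0} \<in> sets \<mu>" by measurable
    then have A: "A \<in> sets borel" by (simp add: A_def)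
    have "(\<integral>x. indicator A x * T (h x) \<partial>\<mu>) = (\<integral>x. T (indicator A x *\<^sub>R h x) \<partial>\<mu>)"
      by (simp add: linear_cmul bounded_linear.linear[OF T])
    also have "\<dots> = T (LINT x:A|\<mu>. h x)"
      unfolding set_lebesgue_integral_def using intA[OF A] unfolding set_integrable_def
      by (rule integral_bounded_linear[OF T])
    also have "\<dots> = 0" using borel_zero[OF A] T by (simp add: linear_0 bounded_linear.linear)
    finally have "(\<integral>x. indicator A x * T (h x) \<partial>\<mu>) = 0" .
    moreover have "integrable \<mu> (\<lambda>x. indicator A x * T (h x))"
      using integrable_bounded_linear[OF T intA[OF A, unfolded set_integrable_def]]
      by (simp add: linear_cmul bounded_linear.linear[OF T])
    moreover have "AE x in \<mu>. 0 \<le> indicator A x * T (h x)" by (auto simp: A_def indicator_def)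
    ultimately have "AE x in \<mu>. indicator A x * T (h x) = 0"
      by (subst (asm) integral_nonneg_eq_0_iff_AE) auto
    then show ?thesis by eventually_elim (auto simp: A_def indicator_def)
  qed
  from key[OF bounded_linear_Re] key[OF bounded_linear_Im]
    key[OF bounded_linear_minus[OF bounded_linear_Re]] key[OF bounded_linear_minus[OF bounded_linear_Im]]
  show ?thesis by eventually_elim (auto simp: complex_eq_iff)
qed

section \<open>The semigroup in the eigenbasis\<close>

lemma inner_abs_L2:
  assumes "square_integrable f" "square_integrable g"
  shows "abs_L2 f \<bullet> abs_L2 g = Re (\<integral>x. f x * cnj (g x) \<partial>\<mu>)"
proof -
  have "abs_L2 f \<bullet> abs_L2 g = (\<integral>x. Re (f x * cnj (g x)) \<partial>\<mu>)"
    unfolding inner_eq_Re_cnj[symmetric] using assms by (simp add: inner_L2.abs_eq)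
  then show ?thesis by (simp only: integral_Re[OF square_integrable_mult_integrable[OF assms]])
qed

lemma inner_rep_L2:
  assumes "square_integrable g"
  shows "u \<bullet> abs_L2 g = Re (\<integral>x. rep_L2 u x * cnj (g x) \<partial>\<mu>)"
  using inner_abs_L2[OF square_integrable_rep_L2 assms, of u] by simp

definition eigenfun_norm :: "int \<Rightarrow> nat \<Rightarrow> real" where
  "eigenfun_norm n k = norm (abs_L2 (eigenfun n k))"

lemma square_integrable_eigenfun: "square_integrable (eigenfun n k)"
  by (simp add: eigenfun_def square_integrable_sph)

lemma eigenfun_norm_sq: "(eigenfun_norm n k)\<^sup>2 = (\<integral>x. (norm (eigenfun n k x))\<^sup>2 \<partial>\<mu>)"
  unfolding eigenfun_norm_def by (rule norm_abs_L2_sq[OF square_integrable_eigenfun])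

lemma eigenfun_band_lower:
  assumes ab: "0 \<le> a" "a < b" "b \<le> 1" and A: "A \<in> sets borel"
    "\<And>x. x \<in> S2 \<Longrightarrow> a < x $ 3 \<Longrightarrow> x $ 3 < b \<Longrightarrow> x \<in> A"
  shows "2 * pi * (1 - b\<^sup>2) ^ nat \<bar>n\<bar> * ((b - a) ^ (2 * k + 1) / 2 ^ (k * k + 3 * k))
    \<le> (\<integral>x. indicator A x * (norm (eigenfun n k x))\<^sup>2 \<partial>\<mu>)"
proof -
  have "(b - a) ^ (2 * k + 1) / 2 ^ (k * k + 3 * k) \<le> integral {a..b} (\<lambda>t. (poly (gegenbauer (nat \<bar>n\<bar>) k) t)\<^sup>2)"
    using integral_poly_sq_ge[OF ab(2), of k "gegenbauer (nat \<bar>n\<bar>) k"] coeff_gegenbauer_above coeff_gegenbauer_lead by simp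
  then have "2 * pi * (1 - b\<^sup>2) ^ nat \<bar>n\<bar> * ((b - a) ^ (2 * k + 1) / 2 ^ (k * k + 3 * k))
    \<le> 2 * pi * (1 - b\<^sup>2) ^ nat \<bar>n\<bar> * integral {a..b} (\<lambda>t. (poly (gegenbauer (nat \<bar>n\<bar>) k) t)\<^sup>2)"
    using ab by (intro mult_left_mono) (auto simp: power_le_one)
  also have "\<dots> \<le> (\<integral>x. indicator A x * (norm (eigenfun n k x))\<^sup>2 \<partial>\<mu>)"
    unfolding eigenfun_def by (rule band_lower_bound[OF ab A])
  finally show ?thesis .
qed

lemma eigenfun_norm_pos: "eigenfun_norm n k > 0"
proof -
  have "0 < 2 * pi * (1 - (1/2)\<^sup>2) ^ nat \<bar>n\<bar> * ((1/2 - 0) ^ (2 * k + 1) / 2 ^ (k * k + 3 * k) :: real)"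
    by (simp add: power2_eq_square)
  also have "\<dots> \<le> (\<integral>x. indicator UNIV x * (norm (eigenfun n k x))\<^sup>2 \<partial>\<mu>)"
    by (rule eigenfun_band_lower) auto
  also have "\<dots> = (eigenfun_norm n k)\<^sup>2" by (simp add: eigenfun_norm_sq)
  finally show ?thesis by (simp add: eigenfun_norm_def)
qed

text \<open>\<^typ>\<open>L2\<close> is only a real Hilbert space. A mode \<open>((n, c), k)\<close> consists of the angular momentum \<open>n\<close>, a flag \<open>c\<close> for
  multiplication by \<open>\<i>\<close>, and the degree \<open>k\<close>.\<close>

type_synonym mode = "(int \<times> bool) \<times> nat"

fun basis_fun :: "mode \<Rightarrow> real^3 \<Rightarrow> complex" where
  "basis_fun ((n, c), k) = (\<lambda>x. (if c then \<i> else 1) / of_real (eigenfun_norm n k) * eigenfun n k x)"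

fun mode_eigval :: "mode \<Rightarrow> real" where
  "mode_eigval ((n, c), k) = eigval n k"

definition basis_vec :: "mode \<Rightarrow> L2" where
  "basis_vec j = abs_L2 (basis_fun j)"

lemma smooth_eigenfun: "smooth (eigenfun n k)"
  by (simp add: eigenfun_def smooth_sph)

lemma smooth_basis_fun: "smooth (basis_fun j)"
  by (cases j rule: basis_fun.cases) (simp only: basis_fun.simps, intro smooth_mult smooth_const smooth_eigenfun)

lemma square_integrable_basis_fun: "square_integrable (basis_fun j)"
  by (rule smooth_square_integrable[OF smooth_basis_fun])

lemma sph_mult_cnj_real: "Im (sph n p x * cnj (sph n q x)) = 0"
proof -
  define W where "W = of_real (x $ 1) + (if n \<ge> 0 then \<i> else - \<i>) * complex_of_real (x $ 2)"
  have "sph n p x * cnj (sph n q x) = of_real ((norm (W ^ nat \<bar>n\<bar>))\<^sup>2 * poly p (x $ 3) * poly q (x $ 3))"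
    unfolding sph_def W_def[symmetric] by (simp add: complex_norm_square[symmetric] mult_ac flip: of_real_power)
      (simp add: mult.left_commute[of "W ^ _"] complex_norm_square[of "W ^ _", simplified] mult_ac)
  then show ?thesis by simp
qed

text \<open>Two mechanisms are combined: different \<open>n\<close> vanish by integration over
  \<open>\<phi>\<close>, while for equal \<open>n\<close> and different flags the integral is real
  up to a factor \<open>\<i>\<close>, so its real part is 0. The weight \<open>1\<close> gives
  orthonormality, an indicator in \<open>x3\<close> gives orthogonality on the control
  region.\<close>

lemma basis_fun_orthogonal_weight:
  fixes g :: "real \<Rightarrow> real"
  assumes ne: "fst j \<noteq> fst j'" and g [measurable]: "g \<in> borel_measurable borel" and g1: "\<And>t. \<bar>g t\<bar> \<le> 1"
  shows "Re (\<integral>x. of_real (g (x $ 3)) * (basis_fun j x * cnj (basis_fun j' x)) \<partial>\<mu>) = 0"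
proof -
  obtain n c k where j: "j = ((n, c), k)" by (cases j rule: basis_fun.cases)
  obtain n' c' k' where j': "j' = ((n', c'), k')" by (cases j' rule: basis_fun.cases)
  let ?z = "(if c then \<i> else 1) / of_real (eigenfun_norm n k) * cnj ((if c' then \<i> else 1) / of_real (eigenfun_norm n' k'))"
  have eq: "(\<integral>x. of_real (g (x $ 3)) * (basis_fun j x * cnj (basis_fun j' x)) \<partial>\<mu>) =
    ?z * (\<integral>x. of_real (g (x $ 3)) * (eigenfun n k x * cnj (eigenfun n' k' x)) \<partial>\<mu>)"
    unfolding j j' integral_mult_right_zero[symmetric]
    by (rule Bochner_Integration.integral_cong) (auto simp: mult_ac)
  show ?thesis
  proof (cases "n = n'")
    case False
    have gm: "(\<lambda>t. complex_of_real (g t)) \<in> borel_measurable borel" by measurable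
    show ?thesis unfolding eq using sph_orthogonal_mode[OF False gm] g1 by (simp add: eigenfun_def)
  next
    case True
    have cc: "c \<noteq> c'" using ne True by (simp add: j j')
    let ?I = "\<integral>x. of_real (g (x $ 3)) * (eigenfun n k x * cnj (eigenfun n' k' x)) \<partial>\<mu>"
    have prod: "integrable \<mu> (\<lambda>x. eigenfun n k x * cnj (eigenfun n' k' x))"
      by (intro square_integrable_mult_integrable square_integrable_eigenfun)
    have int: "integrable \<mu> (\<lambda>x. of_real (g (x $ 3)) * (eigenfun n k x * cnj (eigenfun n' k' x)))"
    proof (rule Bochner_Integration.integrable_bound[OF prod])
      have "(\<lambda>x. complex_of_real (g (x $ 3))) \<in> borel_measurable \<mu>" by measurable
      then show "(\<lambda>x. of_real (g (x $ 3)) * (eigenfun n k x * cnj (eigenfun n' k' x))) \<in> borel_measurable \<mu>"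
        using borel_measurable_integrable[OF prod] by (rule borel_measurable_times)
      show "AE x in \<mu>. norm (of_real (g (x $ 3)) * (eigenfun n k x * cnj (eigenfun n' k' x))) \<le> norm (eigenfun n k x * cnj (eigenfun n' k' x))"
        using g1 by (intro AE_I2) (simp add: norm_mult mult_left_le_one_le)
    qed
    have "Im ?I = (\<integral>x. Im (of_real (g (x $ 3)) * (eigenfun n k x * cnj (eigenfun n' k' x))) \<partial>\<mu>)"
      by (rule integral_Im[OF int, symmetric])
    also have "\<dots> = 0"
    proof -
      have Im_real: "Im (of_real r * z) = r * Im z" for r z by simp
      show ?thesis using True by (simp only: eigenfun_def Im_real sph_mult_cnj_real mult_zero_right) simp
    qed
    finally have I: "Im ?I = 0" .
    show ?thesis unfolding eq using I cc by (auto simp: Re_divide Im_divide power2_eq_square)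
  qed
qed

lemma basis_vec_orthonormal: "basis_vec j \<bullet> basis_vec j' = (if j = j' then 1 else 0)"
proof (cases "fst j = fst j'")
  case False
  then have "basis_vec j \<bullet> basis_vec j' = 0"
    using basis_fun_orthogonal_weight[OF False, of "\<lambda>_. 1"]
    by (simp add: basis_vec_def inner_abs_L2[OF square_integrable_basis_fun square_integrable_basis_fun])
  then show ?thesis using False by auto
next
  case True
  obtain n c k where j: "j = ((n, c), k)" by (cases j rule: basis_fun.cases)
  obtain k' where j': "j' = ((n, c), k')" using True j by (cases j' rule: basis_fun.cases) auto
  let ?z = "(if c then \<i> else 1) / of_real (eigenfun_norm n k) * cnj ((if c then \<i> else 1) / of_real (eigenfun_norm n k'))"
  have z: "?z = of_real (1 / (eigenfun_norm n k * eigenfun_norm n k'))" by auto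
  have "basis_vec j \<bullet> basis_vec j' = Re (?z * (\<integral>x. eigenfun n k x * cnj (eigenfun n k' x) \<partial>\<mu>))"
    unfolding basis_vec_def inner_abs_L2[OF square_integrable_basis_fun square_integrable_basis_fun]
      j j' integral_mult_right_zero[symmetric]
    by (rule arg_cong[where f=Re], rule Bochner_Integration.integral_cong) (auto simp: mult_ac)
  also have "\<dots> = (if k = k' then 1 else 0)"
  proof (cases "k = k'")
    case True
    have "(\<integral>x. eigenfun n k x * cnj (eigenfun n k x) \<partial>\<mu>) = of_real ((eigenfun_norm n k)\<^sup>2)"
      unfolding eigenfun_norm_sq complex_norm_square[symmetric] of_real_power[symmetric] by (rule integral_complex_of_real)
    then show ?thesis unfolding z using True eigenfun_norm_pos[of n k] by (simp add: power2_eq_square)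
  next
    case False
    then show ?thesis using eigenfun_orthogonal[of n k n k'] by simp
  qed
  finally show ?thesis by (simp add: j j')
qed

lemma norm_basis_vec [simp]: "norm (basis_vec j) = 1"
  by (simp add: norm_eq_sqrt_inner basis_vec_orthonormal)

text \<open>The two flags supply the real and the imaginary part of each complex coefficient, so
  \<open>u\<close> is orthogonal to every \<open>eigenfun\<close> in the complex sense, hence to
  every \<open>sph n p\<close> by expanding \<open>p\<close>.\<close>

lemma basis_vec_total:
  assumes "\<And>j. u \<bullet> basis_vec j = 0" shows "u = 0"
proof -
  let ?h = "rep_L2 u"
  have h: "square_integrable ?h" by simp
  have e: "(\<integral>x. ?h x * cnj (eigenfun n k x) \<partial>\<mu>) = 0" for n k
  proof -
    have pos: "eigenfun_norm n k > 0" by (rule eigenfun_norm_pos)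
    have "Re ((if c then - \<i> else 1) / of_real (eigenfun_norm n k) * (\<integral>x. ?h x * cnj (eigenfun n k x) \<partial>\<mu>)) = 0" for c
    proof -
      have "u \<bullet> basis_vec ((n, c), k) = Re ((if c then - \<i> else 1) / of_real (eigenfun_norm n k) * (\<integral>x. ?h x * cnj (eigenfun n k x) \<partial>\<mu>))"
        unfolding basis_vec_def inner_rep_L2[OF square_integrable_basis_fun] integral_mult_right_zero[symmetric]
        by (rule arg_cong[where f=Re], rule Bochner_Integration.integral_cong) auto
      then show ?thesis using assms by simp
    qed
    from this[of True] this[of False] pos show ?thesis
      by (auto simp: complex_eq_iff Re_divide Im_divide)
  qed
  have "(\<integral>x. ?h x * cnj (sph n p x) \<partial>\<mu>) = 0" for n p
  proof -
    let ?m = "nat \<bar>n\<bar>"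
    define N where "N = Suc (degree p)"
    have "coeff p i = 0" if "i \<ge> N" for i using that by (simp add: N_def coeff_eq_0)
    from gegenbauer_span[OF this] obtain c where c: "p = (\<Sum>k<N. smult (c k) (gegenbauer ?m k))" by blast
    have "sph n p x = (\<Sum>k<N. of_real (c k) * eigenfun n k x)" for x
      by (simp add: c sph_def eigenfun_def poly_sum sum_distrib_left mult_ac)
    then have "(\<integral>x. ?h x * cnj (sph n p x) \<partial>\<mu>) = (\<integral>x. (\<Sum>k<N. of_real (c k) * (?h x * cnj (eigenfun n k x))) \<partial>\<mu>)"
      by (simp add: sum_distrib_left mult_ac)
    also have "\<dots> = (\<Sum>k<N. of_real (c k) * (\<integral>x. ?h x * cnj (eigenfun n k x) \<partial>\<mu>))"
      by (subst Bochner_Integration.integral_sum)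
        (auto intro!: Bochner_Integration.integrable_mult_right square_integrable_mult_integrable square_integrable_eigenfun)
    finally show ?thesis by (simp add: e)
  qed
  then have "AE x in \<mu>. ?h x = 0" by (rule orthogonal_imp_zero[OF h])
  then have "abs_L2 ?h = abs_L2 (\<lambda>_. 0)" by (subst abs_L2_eq_iff) (auto simp: square_integrable_const)
  then show ?thesis by (simp add: zero_L2_def)
qed

section \<open>Enumeration of the modes and growth of the eigenvalues\<close>

definition mode_of_nat :: "nat \<Rightarrow> mode" where
  "mode_of_nat i = (let (a, k) = prod_decode i in ((int_decode (a div 2), odd a), k))"

definition nat_of_mode :: "mode \<Rightarrow> nat" where
  "nat_of_mode = (\<lambda>((n, c), k). prod_encode (2 * int_encode n + (if c then 1 else 0), k))"

lemma mode_of_nat_inverse [simp]: "mode_of_nat (nat_of_mode j) = j"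
  by (cases j rule: basis_fun.cases) (auto simp: mode_of_nat_def nat_of_mode_def)

lemma nat_of_mode_inverse [simp]: "nat_of_mode (mode_of_nat i) = i"
proof -
  obtain a k where ak: "prod_decode i = (a, k)" by (cases "prod_decode i")
  have "2 * (a div 2) + (if odd a then 1 else 0) = a" by presburger
  then have "nat_of_mode (mode_of_nat i) = prod_encode (a, k)"
    by (simp add: mode_of_nat_def nat_of_mode_def ak)
  then show ?thesis by (simp flip: ak)
qed

lemma mode_eigval_ge: "real (nat \<bar>n\<bar>) + real k \<le> mode_eigval ((n, c), k)" "real k * real k \<le> mode_eigval ((n, c), k)"
  and mode_eigval_nonneg: "0 \<le> mode_eigval j"
proof -
  have "real k \<le> kappa m k" "real k * real k \<le> kappa m k" for m
    unfolding kappa_def by (cases k; simp add: algebra_simps)+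
  then show "real (nat \<bar>n\<bar>) + real k \<le> mode_eigval ((n, c), k)" "real k * real k \<le> mode_eigval ((n, c), k)"
    by (auto simp: eigval_def intro: add_increasing)
  show "0 \<le> mode_eigval j" by (cases j rule: basis_fun.cases) (auto simp: eigval_def kappa_def)
qed

text \<open>A crude Weyl law: Cantor pairing grows at most quadratically in its arguments, the
  coding of \<open>n\<close> and its flag is at most \<open>4 * |n| + 1\<close>, and the eigenvalue
  dominates \<open>|n| + k\<close>.\<close>

lemma nat_le_mode_eigval: "real i \<le> (4 * mode_eigval (mode_of_nat i) + 2)\<^sup>2"
proof -
  obtain n c k where j: "mode_of_nat i = ((n, c), k)" by (cases "mode_of_nat i" rule: basis_fun.cases)
  define a where "a = 2 * int_encode n + (if c then 1 else 0 :: nat)"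
  have i: "i = prod_encode (a, k)" using nat_of_mode_inverse[of i] by (simp add: j nat_of_mode_def a_def)
  have "int_encode n \<le> 2 * nat \<bar>n\<bar>" by (auto simp: int_encode_def sum_encode_def)
  then have ak: "a + k + 1 \<le> 4 * nat \<bar>n\<bar> + k + 2" by (simp add: a_def)
  have "triangle (a + k) \<le> (a + k) * Suc (a + k)" unfolding triangle_def by (rule div_le_dividend)
  then have "i \<le> (a + k) * Suc (a + k) + a" unfolding i prod_encode_def by simp
  also have "\<dots> \<le> (a + k + 1)\<^sup>2" by (simp add: power2_eq_square algebra_simps)
  finally have "real i \<le> real ((a + k + 1)\<^sup>2)" by (simp only: of_nat_le_iff)
  also have "\<dots> = (real (a + k + 1))\<^sup>2" by simp
  also have "\<dots> \<le> (4 * mode_eigval (mode_of_nat i) + 2)\<^sup>2"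
  proof (rule power_mono)
    have "real (a + k + 1) \<le> real (4 * nat \<bar>n\<bar> + k + 2)" using ak by (simp only: of_nat_le_iff)
    also have "\<dots> \<le> 4 * (real (nat \<bar>n\<bar>) + real k) + 2" by simp
    also have "\<dots> \<le> 4 * mode_eigval (mode_of_nat i) + 2" using mode_eigval_ge(1)[of n k c] by (simp add: j)
    finally show "real (a + k + 1) \<le> 4 * mode_eigval (mode_of_nat i) + 2" .
  qed simp
  finally show ?thesis .
qed

text \<open>This drives the convergence of the control series: one unit of time left over after all
  costs are paid suffices to sum over the modes.\<close>

lemma summable_exp_mode_eigval: "summable (\<lambda>i. exp (- mode_eigval (mode_of_nat i)))"
proof (rule summable_comparison_test')
  show "summable (\<lambda>i. exp (1/2) * exp (- (sqrt (real i) / 4)))"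
  proof (rule summable_mult, rule summable_comparison_test_bigo)
    show "summable (\<lambda>n. norm (1 / real n ^ 2))"
      using inverse_power_summable[of 2, where 'a=real] by (simp add: field_simps)
    show "(\<lambda>i. exp (- (sqrt (real i) / 4))) \<in> O(\<lambda>n. 1 / real n ^ 2)" by real_asymp
  qed
  fix i
  have "sqrt (real i) \<le> 4 * mode_eigval (mode_of_nat i) + 2"
    using nat_le_mode_eigval[of i] mode_eigval_nonneg[of "mode_of_nat i"] by (intro real_le_lsqrt) auto
  then have "exp (- mode_eigval (mode_of_nat i)) \<le> exp (1/2 - sqrt (real i) / 4)" by simp
  also have "\<dots> = exp (1/2) * exp (- (sqrt (real i) / 4))" by (simp add: mult_exp_exp)
  finally show "norm (exp (- mode_eigval (mode_of_nat i))) \<le> exp (1/2) * exp (- (sqrt (real i) / 4))" by simp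
qed

interpretation heat: diagonal_semigroup "\<lambda>i. basis_vec (mode_of_nat i)" "\<lambda>i. mode_eigval (mode_of_nat i)"
proof
  show "basis_vec (mode_of_nat i) \<bullet> basis_vec (mode_of_nat j) = (if i = j then 1 else 0)" for i j
    by (auto simp: basis_vec_orthonormal) (metis nat_of_mode_inverse)
  show "f = 0" if "\<And>i. f \<bullet> basis_vec (mode_of_nat i) = 0" for f
    by (rule basis_vec_total) (metis mode_of_nat_inverse that)
  show "0 \<le> mode_eigval (mode_of_nat i)" for i by (rule mode_eigval_nonneg)
qed

section \<open>The maximal realization is the diagonal operator\<close>

lemma smooth_L_smooth: assumes "smooth F" shows "smooth (L_smooth F)"
proof -
  have "is_formal_adjoint vecX (formal_adjoint vecX)" "is_formal_adjoint vecY (formal_adjoint vecY)"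
    unfolding formal_adjoint_def
    by (rule someI[of "is_formal_adjoint vecX", OF is_formal_adjoint_vec(1)]
        someI[of "is_formal_adjoint vecY", OF is_formal_adjoint_vec(2)])+
  then show ?thesis
    unfolding L_smooth_def[abs_def] is_formal_adjoint_def
    using assms by (intro smooth_diff smooth_uminus) (auto intro: smooth_vecX smooth_vecY)
qed

lemma abs_L2_L_smooth: "smooth F \<Longrightarrow> abs_L2 (L_smooth F) = abs_L2 (sum_squares F)"
  by (subst abs_L2_eq_iff) (auto intro: AE_L_smooth smooth_square_integrable smooth_L_smooth smooth_sum_squares)

lemma sum_squares_scale:
  assumes "smooth F" shows "sum_squares (\<lambda>x. z * F x) = (\<lambda>x. z * sum_squares F x)"
  by (rule ext) (simp add: sum_squares_def vec_mult smooth_const assms smooth_vecX smooth_vecY vec_const algebra_simps)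

lemma abs_L2_sum_squares_basis_fun: "abs_L2 (sum_squares (basis_fun j)) = - mode_eigval j *\<^sub>R basis_vec j"
proof -
  obtain n c k where j: "j = ((n, c), k)" by (cases j rule: basis_fun.cases)
  let ?z = "(if c then \<i> else 1) / of_real (eigenfun_norm n k)"
  have "sum_squares (basis_fun j) x = - mode_eigval j *\<^sub>R basis_fun j x" if "x \<in> S2" for x
  proof -
    have "sum_squares (basis_fun j) x = ?z * sum_squares (eigenfun n k) x"
      unfolding j basis_fun.simps sum_squares_scale[OF smooth_eigenfun] ..
    then show ?thesis using sum_squares_eigenfun[OF that, of n k] by (simp add: j scaleR_conv_of_real mult_ac)
  qed
  then have "AE x in \<mu>. sum_squares (basis_fun j) x = - mode_eigval j *\<^sub>R basis_fun j x"
    using AE_\<mu>_S2 by (auto elim: eventually_mono)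
  then show ?thesis
    unfolding basis_vec_def abs_L2_scaleR[OF square_integrable_basis_fun]
      abs_L2_eq_iff[OF smooth_square_integrable[OF smooth_sum_squares[OF smooth_basis_fun]]
        square_integrable_scaleR[OF square_integrable_basis_fun]] .
qed

text \<open>Essential self-adjointness in concrete form. One inclusion tests with the basis
  functions, the other is Parseval. The real inner product sees only real parts, so imaginary parts
  are recovered by testing with \<open>\<i> * F\<close>.\<close>

lemma L_graph_eq: "L_graph = {(f, g). \<forall>i. g \<bullet> basis_vec (mode_of_nat i) = - mode_eigval (mode_of_nat i) * (f \<bullet> basis_vec (mode_of_nat i))}"
proof safe
  fix u g i assume ug: "(u, g) \<in> L_graph"
  let ?j = "mode_of_nat i"
  have "u \<bullet> abs_L2 (L_smooth (basis_fun ?j)) = g \<bullet> abs_L2 (basis_fun ?j)"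
    using ug smooth_basis_fun[of ?j] unfolding L_graph_def
    by (simp add: inner_rep_L2 smooth_square_integrable smooth_L_smooth)
  then show "g \<bullet> basis_vec ?j = - mode_eigval ?j * (u \<bullet> basis_vec ?j)"
    by (simp add: abs_L2_L_smooth smooth_basis_fun abs_L2_sum_squares_basis_fun) (simp add: basis_vec_def)
next
  fix u g assume ug: "\<forall>i. g \<bullet> basis_vec (mode_of_nat i) = - mode_eigval (mode_of_nat i) * (u \<bullet> basis_vec (mode_of_nat i))"
  have Re_eq: "Re (\<integral>x. rep_L2 u x * cnj (sum_squares F x) \<partial>\<mu>) = Re (\<integral>x. rep_L2 g x * cnj (F x) \<partial>\<mu>)" if F: "smooth F" for F
  proof -
    have coeff: "abs_L2 (sum_squares F) \<bullet> basis_vec j = - mode_eigval j * (abs_L2 F \<bullet> basis_vec j)" for j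
    proof -
      have "abs_L2 (sum_squares F) \<bullet> basis_vec j = abs_L2 F \<bullet> abs_L2 (sum_squares (basis_fun j))"
        unfolding basis_vec_def
        by (simp add: inner_abs_L2 smooth_square_integrable smooth_sum_squares F smooth_basis_fun sum_squares_symmetric)
      then show ?thesis by (simp add: abs_L2_sum_squares_basis_fun)
    qed
    have "u \<bullet> abs_L2 (sum_squares F) = g \<bullet> abs_L2 F"
      using heat.parseval[of u "abs_L2 (sum_squares F)"] heat.parseval[of g "abs_L2 F"] ug
      by (simp add: coeff mult_ac sums_iff)
    then show ?thesis by (simp add: inner_rep_L2 smooth_square_integrable smooth_sum_squares F)
  qed
  show "(u, g) \<in> L_graph"
    unfolding L_graph_def mem_Collect_eq split_conv
  proof (intro allI impI)
    fix F assume F: "smooth F"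
    have iF: "smooth (\<lambda>x. \<i> * F x)" by (intro smooth_mult smooth_const F)
    have "sum_squares (\<lambda>x. \<i> * F x) = (\<lambda>x. \<i> * sum_squares F x)"
      by (rule sum_squares_scale[OF F])
    then have "Re (- \<i> * (\<integral>x. rep_L2 u x * cnj (sum_squares F x) \<partial>\<mu>)) = Re (- \<i> * (\<integral>x. rep_L2 g x * cnj (F x) \<partial>\<mu>))"
      using Re_eq[OF iF] unfolding integral_mult_right_zero[symmetric] by (simp add: mult_ac)
    then have "(\<integral>x. rep_L2 u x * cnj (sum_squares F x) \<partial>\<mu>) = (\<integral>x. rep_L2 g x * cnj (F x) \<partial>\<mu>)"
      using Re_eq[OF F] by (simp add: complex_eq_iff)
    moreover have "(\<integral>x. rep_L2 u x * cnj (L_smooth F x) \<partial>\<mu>) = (\<integral>x. rep_L2 u x * cnj (sum_squares F x) \<partial>\<mu>)"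
    proof (rule integral_cong_AE)
      show "AE x in \<mu>. rep_L2 u x * cnj (L_smooth F x) = rep_L2 u x * cnj (sum_squares F x)"
        using AE_L_smooth[OF F] by eventually_elim simp
    qed (intro borel_measurable_integrable square_integrable_mult_integrable square_integrable_rep_L2
        smooth_square_integrable smooth_L_smooth smooth_sum_squares F)+
    ultimately show "(\<integral>x. rep_L2 u x * cnj (L_smooth F x) \<partial>\<mu>) = (\<integral>x. rep_L2 g x * cnj (F x) \<partial>\<mu>)" by simp
  qed
qed

lemma exp_L_eq: "t \<ge> 0 \<Longrightarrow> exp_L t = heat.semigroup t"
  unfolding exp_L_def by (rule heat.semigroup_generated_by_eq[OF L_graph_eq])

lemma L2_eqI: "(\<And>j. u \<bullet> basis_vec j = w \<bullet> basis_vec j) \<Longrightarrow> u = w"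
  by (rule heat.eqI) auto

lemma exp_L_inner: "t \<ge> 0 \<Longrightarrow> exp_L t f \<bullet> basis_vec j = exp (- mode_eigval j * t) * (f \<bullet> basis_vec j)"
  using heat.semigroup_inner[of t f "nat_of_mode j"] by (simp add: exp_L_eq)

section \<open>Controllability\<close>

lemma control_region_borel [measurable]: "control_region \<alpha> \<beta> \<in> sets borel"
proof -
  have "control_region \<alpha> \<beta> = S2 \<inter> {x \<in> space borel. \<alpha> < \<bar>x $ 3\<bar> \<and> \<bar>x $ 3\<bar> < \<beta>}"
    by (auto simp: control_region_def)
  also have "\<dots> \<in> sets borel"
  proof (intro sets.Int)
    show "S2 \<in> sets (borel :: (real^3) measure)" by (intro borel_closed closed_sphere)
  qed measurable
  finally show ?thesis .
qed

lemma square_integrable_indicator_mult: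
  assumes [measurable]: "\<omega> \<in> sets borel" and f: "square_integrable f"
  shows "square_integrable (\<lambda>x. indicator \<omega> x * f x)"
proof -
  have [measurable]: "f \<in> borel_measurable \<mu>" using f by (simp add: square_integrable_def)
  have "(\<lambda>x. (norm (indicator \<omega> x * f x))\<^sup>2) = (\<lambda>x. indicator \<omega> x *\<^sub>R (norm (f x))\<^sup>2)"
    by (auto simp: indicator_def)
  moreover have "integrable \<mu> (\<lambda>x. indicator \<omega> x *\<^sub>R (norm (f x))\<^sup>2)"
    using f by (intro integrable_mult_indicator) (auto simp: square_integrable_def)
  ultimately show ?thesis unfolding square_integrable_def by simp
qed

context
  fixes \<omega> :: "(real^3) set"
  assumes \<omega>: "\<omega> \<in> sets borel"
begin

lemma mult_indicator_abs:
  assumes f: "square_integrable f"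
  shows "mult_indicator \<omega> (abs_L2 f) = abs_L2 (\<lambda>x. indicator \<omega> x * f x)"
proof -
  have "AE x in \<mu>. indicator \<omega> x * rep_L2 (abs_L2 f) x = indicator \<omega> x * f x"
    using rep_abs_L2[OF f] by eventually_elim simp
  then show ?thesis
    unfolding mult_indicator_def
    by (subst abs_L2_eq_iff) (auto intro!: square_integrable_indicator_mult \<omega> f)
qed

lemma mult_indicator_inner:
  "mult_indicator \<omega> u \<bullet> w = mult_indicator \<omega> u \<bullet> mult_indicator \<omega> w"
proof -
  obtain f where f: "square_integrable f" "u = abs_L2 f" by (cases u rule: L2_cases)
  obtain g where g: "square_integrable g" "w = abs_L2 g" by (cases w rule: L2_cases)
  note s = square_integrable_indicator_mult[OF \<omega>]
  have "(\<lambda>x. indicator \<omega> x * f x * cnj (g x)) = (\<lambda>x. indicator \<omega> x * f x * cnj (indicator \<omega> x * g x))"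
    by (auto simp: indicator_def)
  then show ?thesis
    unfolding f(2) g(2) mult_indicator_abs[OF f(1)] mult_indicator_abs[OF g(1)]
      inner_abs_L2[OF s[OF f(1)] g(1)] inner_abs_L2[OF s[OF f(1)] s[OF g(1)]] by simp
qed

lemma mult_indicator_idem: "mult_indicator \<omega> (mult_indicator \<omega> u) = mult_indicator \<omega> u"
proof -
  obtain f where f: "square_integrable f" "u = abs_L2 f" by (cases u rule: L2_cases)
  have "(\<lambda>x. indicator \<omega> x * (indicator \<omega> x * f x)) = (\<lambda>x. indicator \<omega> x * f x)"
    by (auto simp: indicator_def)
  then show ?thesis
    unfolding f(2) mult_indicator_abs[OF f(1)] mult_indicator_abs[OF square_integrable_indicator_mult[OF \<omega> f(1)]] by simp
qed

lemma norm_mult_indicator_sq: "square_integrable f \<Longrightarrow> (norm (mult_indicator \<omega> (abs_L2 f)))\<^sup>2 = (\<integral>x. indicator \<omega> x * (norm (f x))\<^sup>2 \<partial>\<mu>)"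
  unfolding mult_indicator_abs
  by (subst norm_abs_L2_sq[OF square_integrable_indicator_mult[OF \<omega>]])
    (auto intro!: Bochner_Integration.integral_cong simp: indicator_def)

lemma norm_mult_indicator_le: "norm (mult_indicator \<omega> u) \<le> norm u"
proof -
  have "(norm (mult_indicator \<omega> u))\<^sup>2 = mult_indicator \<omega> u \<bullet> u"
    unfolding power2_norm_eq_inner by (rule mult_indicator_inner[symmetric])
  also have "\<dots> \<le> norm (mult_indicator \<omega> u) * norm u" by (rule norm_cauchy_schwarz)
  finally have "norm (mult_indicator \<omega> u) * norm (mult_indicator \<omega> u) \<le> norm (mult_indicator \<omega> u) * norm u"
    by (simp add: power2_eq_square)
  then show ?thesis by (cases "norm (mult_indicator \<omega> u) = 0") (auto simp: mult_le_cancel_left)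
qed

lemma mult_indicator_linear: "bounded_linear (mult_indicator \<omega>)"
proof (rule bounded_linear_intro[where K=1])
  note s = square_integrable_indicator_mult[OF \<omega>]
  fix u w :: L2 and r :: real
  obtain f where f: "square_integrable f" "u = abs_L2 f" by (cases u rule: L2_cases)
  obtain g where g: "square_integrable g" "w = abs_L2 g" by (cases w rule: L2_cases)
  show "mult_indicator \<omega> (u + w) = mult_indicator \<omega> u + mult_indicator \<omega> w"
    unfolding f(2) g(2) mult_indicator_abs[OF f(1)] mult_indicator_abs[OF g(1)]
      abs_L2_add[OF f(1) g(1)] abs_L2_add[OF s[OF f(1)] s[OF g(1)]]
      mult_indicator_abs[OF square_integrable_add[OF f(1) g(1)]] by (simp add: distrib_left)
  show "mult_indicator \<omega> (r *\<^sub>R u) = r *\<^sub>R mult_indicator \<omega> u"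
    unfolding f(2) mult_indicator_abs[OF f(1)] abs_L2_scaleR[OF f(1)] abs_L2_scaleR[OF s[OF f(1)]]
      mult_indicator_abs[OF square_integrable_scaleR[OF f(1)]] by simp
  show "norm (mult_indicator \<omega> u) \<le> norm u * 1" using norm_mult_indicator_le by simp
qed

text \<open>Turns the vector-valued equation into scalar moments. Square integrability gives
  integrability by \<open>x \<le> 1 + x^2\<close>; as the semigroup and the cut-off are
  contractions, the Bochner integral exists and commutes with the inner product.\<close>

lemma duhamel_inner:
  assumes T: "T > 0" and u: "square_integrable_in_time T u"
  shows "duhamel \<omega> f u T \<bullet> basis_vec j = exp (- mode_eigval j * T) * (f \<bullet> basis_vec j) +
    (LINT s|lborel. indicator {0<..<T} s * (exp (- mode_eigval j * (T - s)) * (mult_indicator \<omega> (u s) \<bullet> basis_vec j)))"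
    and "integrable lborel (\<lambda>s. indicator {0<..<T} s * norm (u s))"
proof -
  define U where "U s = indicator {0<..<T} s *\<^sub>R u s" for s
  have [measurable]: "U \<in> borel_measurable borel"
    using u unfolding U_def square_integrable_in_time_def set_borel_measurable_def by simp
  have nU: "norm (U s) = indicator {0<..<T} s * norm (u s)" for s by (simp add: U_def indicator_def)
  have "integrable lborel (\<lambda>s. norm (U s))"
  proof (rule Bochner_Integration.integrable_bound)
    have "integrable lborel (indicator {0<..<T} :: real \<Rightarrow> real)" by (rule integrable_real_indicator) (use T in \<open>auto simp: less_top[symmetric]\<close>)
    then show "integrable lborel (\<lambda>s. indicator {0<..<T} s + indicator {0<..<T} s *\<^sub>R (norm (u s))\<^sup>2)"
      using u unfolding square_integrable_in_time_def set_integrable_def by (intro Bochner_Integration.integrable_add) auto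
    show "AE s in lborel. norm (norm (U s)) \<le> norm (indicator {0<..<T} s + indicator {0<..<T} s *\<^sub>R (norm (u s))\<^sup>2 :: real)"
    proof (rule AE_I2)
      fix s
      have "norm (u s) \<le> 1 + (norm (u s))\<^sup>2"
      proof -
        have "0 \<le> (norm (u s) - 1 / 2)\<^sup>2" by simp
        then show ?thesis by (simp add: power2_eq_square algebra_simps)
      qed
      then show "norm (norm (U s)) \<le> norm (indicator {0<..<T} s + indicator {0<..<T} s *\<^sub>R (norm (u s))\<^sup>2 :: real)"
        by (auto simp: U_def indicator_def)
    qed
  qed simp
  then show intU: "integrable lborel (\<lambda>s. indicator {0<..<T} s * norm (u s))" by (simp add: nU)
  have [measurable]: "mult_indicator \<omega> \<in> borel_measurable borel"
    by (intro borel_measurable_continuous_onI linear_continuous_on mult_indicator_linear)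
  define G where "G s = indicator {0<..<T} s *\<^sub>R exp_L (T - s) (mult_indicator \<omega> (u s))" for s
  have G: "G s = indicator {0<..<T} s *\<^sub>R heat.semigroup (T - s) (mult_indicator \<omega> (U s))" for s
    by (auto simp: G_def U_def indicator_def exp_L_eq)
  \<comment> \<open>The time enters both the operator and its argument. Measurability is read off
    the eigenfunction series, whose coefficients are measurable functions of
    \<open>s\<close>.\<close>
  have [measurable]: "(\<lambda>s. heat.semigroup (T - s) (mult_indicator \<omega> (U s))) \<in> borel_measurable borel"
    unfolding heat.semigroup_def heat.multiplier_def
    by (intro borel_measurable_suminf borel_measurable_scaleR borel_measurable_times borel_measurable_inner
        borel_measurable_const) measurable
  have Gm: "G \<in> borel_measurable borel" unfolding G[abs_def] by measurable
  have intG: "integrable lborel G"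
  proof (rule Bochner_Integration.integrable_bound[OF intU])
    show "AE s in lborel. norm (G s) \<le> norm (indicator {0<..<T} s * norm (u s))"
      unfolding G using order_trans[OF heat.norm_semigroup_le norm_mult_indicator_le]
      by (intro AE_I2) (auto simp: indicator_def U_def)
  qed (use Gm in simp)
  have "duhamel \<omega> f u T \<bullet> basis_vec j = exp_L T f \<bullet> basis_vec j + integral\<^sup>L lborel G \<bullet> basis_vec j"
    unfolding duhamel_def set_lebesgue_integral_def G_def by (rule inner_add_left)
  also have "integral\<^sup>L lborel G \<bullet> basis_vec j = (LINT s|lborel. G s \<bullet> basis_vec j)"
    using intG by (rule integral_inner_left[symmetric])
  also have "\<dots> = (LINT s|lborel. indicator {0<..<T} s * (exp (- mode_eigval j * (T - s)) * (mult_indicator \<omega> (u s) \<bullet> basis_vec j)))"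
    by (intro Bochner_Integration.integral_cong refl) (auto simp: G_def indicator_def exp_L_inner)
  finally show "duhamel \<omega> f u T \<bullet> basis_vec j = exp (- mode_eigval j * T) * (f \<bullet> basis_vec j) +
    (LINT s|lborel. indicator {0<..<T} s * (exp (- mode_eigval j * (T - s)) * (mult_indicator \<omega> (u s) \<bullet> basis_vec j)))"
    using T by (simp add: exp_L_inner)
qed

text \<open>A one-vector form of observability: \<open>K\<close> is the \<open>L^1\<close> norm in
  time of some control steering \<open>f\<close> to zero, so it depends on \<open>f\<close> but not
  on \<open>j\<close>. The cut-off is a projection and can be moved onto the eigenvector.\<close>

lemma controllable_observable:
  assumes T: "T > 0" and nc: "null_controllable \<omega> T"
  shows "\<exists>K. \<forall>j. exp (- mode_eigval j * T) * \<bar>f \<bullet> basis_vec j\<bar> \<le> K * norm (mult_indicator \<omega> (basis_vec j))"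
proof -
  obtain u where u: "square_integrable_in_time T u" "duhamel \<omega> f u T = 0"
    using nc unfolding null_controllable_def by blast
  define K where "K = (LINT s|lborel. indicator {0<..<T} s * norm (u s))"
  note int = duhamel_inner(2)[OF T u(1)]
  have "exp (- mode_eigval j * T) * \<bar>f \<bullet> basis_vec j\<bar> \<le> K * norm (mult_indicator \<omega> (basis_vec j))" for j
  proof -
    let ?w = "norm (mult_indicator \<omega> (basis_vec j))"
    let ?g = "\<lambda>s. indicator {0<..<T} s * (exp (- mode_eigval j * (T - s)) * (mult_indicator \<omega> (u s) \<bullet> basis_vec j))"
    have "exp (- mode_eigval j * T) * (f \<bullet> basis_vec j) = - (LINT s|lborel. ?g s)"
      using duhamel_inner(1)[OF T u(1), of f j] u(2) by simp
    then have "\<bar>exp (- mode_eigval j * T) * (f \<bullet> basis_vec j)\<bar> = norm (LINT s|lborel. ?g s)"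
      by (simp only: abs_minus_cancel real_norm_def)
    then have "exp (- mode_eigval j * T) * \<bar>f \<bullet> basis_vec j\<bar> = norm (LINT s|lborel. ?g s)"
      by (simp only: abs_mult abs_exp_cancel)
    also have "\<dots> \<le> (LINT s|lborel. norm (?g s))" by (rule integral_norm_bound)
    also have "\<dots> \<le> (LINT s|lborel. (indicator {0<..<T} s * norm (u s)) * ?w)"
    proof (rule integral_mono')
      show "integrable lborel (\<lambda>s. (indicator {0<..<T} s * norm (u s)) * ?w)" using int by (rule integrable_mult_left)
      show "0 \<le> (indicator {0<..<T} s * norm (u s)) * ?w" for s by simp
      show "norm (?g s) \<le> (indicator {0<..<T} s * norm (u s)) * ?w" for s
      proof (cases "s \<in> {0<..<T}")
        case True
        have "\<bar>mult_indicator \<omega> (u s) \<bullet> basis_vec j\<bar> = \<bar>mult_indicator \<omega> (u s) \<bullet> mult_indicator \<omega> (basis_vec j)\<bar>"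
          by (simp only: mult_indicator_inner[of "u s" "basis_vec j"])
        also have "\<dots> \<le> norm (mult_indicator \<omega> (u s)) * ?w" by (rule Cauchy_Schwarz_ineq2)
        also have "\<dots> \<le> norm (u s) * ?w" by (intro mult_right_mono norm_mult_indicator_le) auto
        finally have "exp (- mode_eigval j * (T - s)) * \<bar>mult_indicator \<omega> (u s) \<bullet> basis_vec j\<bar> \<le> 1 * (norm (u s) * ?w)"
          using True mode_eigval_nonneg[of j] by (intro mult_mono) auto
        then show ?thesis using True by (simp add: abs_mult)
      qed simp
    qed
    also have "\<dots> = K * ?w" unfolding K_def by (rule integral_mult_left_zero)
    finally show ?thesis .
  qed
  then show ?thesis by blast
qed

end

lemma norm_mult_indicator_basis_vec:
  assumes "\<omega> \<in> sets borel"
  shows "(norm (mult_indicator \<omega> (basis_vec ((n, c), k))))\<^sup>2 = (\<integral>x. indicator \<omega> x * (norm (eigenfun n k x))\<^sup>2 \<partial>\<mu>) / (eigenfun_norm n k)\<^sup>2"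
proof -
  have "(norm (mult_indicator \<omega> (basis_vec ((n, c), k))))\<^sup>2 = (\<integral>x. indicator \<omega> x * (norm (basis_fun ((n, c), k) x))\<^sup>2 \<partial>\<mu>)"
    unfolding basis_vec_def by (rule norm_mult_indicator_sq[OF assms square_integrable_basis_fun])
  also have "(\<lambda>x. indicator \<omega> x * (norm (basis_fun ((n, c), k) x))\<^sup>2) = (\<lambda>x. indicator \<omega> x * (norm (eigenfun n k x))\<^sup>2 / (eigenfun_norm n k)\<^sup>2)"
    using eigenfun_norm_pos[of n k] by (auto simp: norm_mult norm_divide power_mult_distrib power_divide)
  finally show ?thesis by simp
qed

section \<open>The lower bound for the control time\<close>

lemma null_controllable_time_bound:
  assumes \<alpha>: "0 \<le> \<alpha>" "\<alpha> < 1" and T: "T > 0" and nc: "null_controllable (control_region \<alpha> \<beta>) T"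
  shows "1 \<le> exp (2 * T) * (1 - \<alpha>\<^sup>2)"
proof (rule ccontr)
  assume "\<not> ?thesis"
  define \<rho> where "\<rho> = exp (2 * T) * (1 - \<alpha>\<^sup>2)"
  have \<alpha>2: "\<alpha>\<^sup>2 < 1" using \<alpha> by (simp add: power_less_one_iff abs_square_less_1)
  have \<rho>: "0 < \<rho>" "\<rho> < 1" using \<open>\<not> _\<close> \<alpha>2 by (auto simp: \<rho>_def)
  \<comment> \<open>Chosen so that \<open>r = 1 - (1 - \<rho>) / 4\<close>, whose cube exceeds
    \<open>1 - 3 * (1 - \<rho>) / 4 > \<rho>\<close>. Three powers of \<open>r\<close> occur below:
    two from the squared coefficients of \<open>f\<close>, one from the mass of the eigenfunction in
    the band of height \<open>\<epsilon>\<close> at the equator.\<close>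
  define \<epsilon> where "\<epsilon> = sqrt ((1 - \<rho>) / 4)"
  have \<epsilon>: "0 < \<epsilon>" "\<epsilon> \<le> 1" "\<epsilon>\<^sup>2 = (1 - \<rho>) / 4" using \<rho> by (auto simp: \<epsilon>_def)
  define r where "r = 1 - \<epsilon>\<^sup>2"
  have r: "0 < r" "r < 1" "\<rho> < r ^ 3"
  proof -
    have "r = (3 + \<rho>) / 4" by (simp add: r_def \<epsilon>(3) field_simps)
    then show "0 < r" "r < 1" using \<rho> by auto
    have "(3 + \<rho>) ^ 3 - 64 * \<rho> = (1 - \<rho>) * (26 - 10 * \<rho> + (1 - \<rho> * \<rho>))" by (simp add: power3_eq_cube algebra_simps)
    moreover have "(1 - \<rho>) * (26 - 10 * \<rho> + (1 - \<rho> * \<rho>)) > 0"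
    proof (rule mult_pos_pos)
      have "\<rho> * \<rho> \<le> 1 * 1" using \<rho> by (intro mult_mono) auto
      then show "26 - 10 * \<rho> + (1 - \<rho> * \<rho>) > 0" using \<rho> by linarith
    qed (use \<rho> in simp)
    moreover have "64 * r ^ 3 = (3 + \<rho>) ^ 3" unfolding \<open>r = (3 + \<rho>) / 4\<close> by (simp add: power_divide)
    ultimately show "\<rho> < r ^ 3" by linarith
  qed
  let ?\<omega> = "control_region \<alpha> \<beta>"
  define b where "b l = basis_vec ((int l, False), 0)" for l :: nat
  have bb: "b l \<bullet> b l' = (if l = l' then 1 else 0)" for l l' by (simp add: b_def basis_vec_orthonormal)
  have sr: "summable (\<lambda>l. r ^ l *\<^sub>R b l)"
    by (rule summable_norm_cancel) (use r in \<open>simp add: b_def\<close>)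
  define f where "f = (\<Sum>l. r ^ l *\<^sub>R b l)"
  have fb: "f \<bullet> b l = r ^ l" for l
  proof -
    have "(\<lambda>i. (r ^ i *\<^sub>R b i) \<bullet> b l) sums (f \<bullet> b l)"
      unfolding f_def by (intro bounded_linear.sums[OF bounded_linear_inner_left] summable_sums sr)
    moreover have "(\<lambda>i. (r ^ i *\<^sub>R b i) \<bullet> b l) sums r ^ l"
      using sums_single[of l "\<lambda>i. r ^ i"] by (simp add: bb if_distrib cong: if_cong)
    ultimately show ?thesis by (rule sums_unique2)
  qed
  obtain K where K: "\<And>j. exp (- mode_eigval j * T) * \<bar>f \<bullet> basis_vec j\<bar> \<le> K * norm (mult_indicator ?\<omega> (basis_vec j))"
    using controllable_observable[OF control_region_borel T nc, of f] by blast
  define M where "M = measure \<mu> UNIV"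
  have M: "M \<ge> 0" by (simp add: M_def)
  have wn: "(norm (mult_indicator ?\<omega> (b l)))\<^sup>2 * (2 * pi * r ^ l * \<epsilon>) \<le> (1 - \<alpha>\<^sup>2) ^ l * M" for l
  proof -
    have e0: "eigenfun (int l) 0 = sph (int l) 1" by (simp add: eigenfun_def gegenbauer_0)
    have int: "integrable \<mu> (\<lambda>x. (norm (eigenfun (int l) 0 x))\<^sup>2)"
      using square_integrable_eigenfun by (simp add: square_integrable_def)
    have "2 * pi * (1 - \<epsilon>\<^sup>2) ^ nat \<bar>int l\<bar> * ((\<epsilon> - 0) ^ (2 * 0 + 1) / 2 ^ (0 * 0 + 3 * 0)) \<le> (\<integral>x. indicator UNIV x * (norm (eigenfun (int l) 0 x))\<^sup>2 \<partial>\<mu>)"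
      by (rule eigenfun_band_lower) (use \<epsilon> in auto)
    then have lo: "2 * pi * r ^ l * \<epsilon> \<le> (eigenfun_norm (int l) 0)\<^sup>2" by (simp add: r_def eigenfun_norm_sq)
    have "(\<integral>x. indicator ?\<omega> x * (norm (eigenfun (int l) 0 x))\<^sup>2 \<partial>\<mu>) \<le> (\<integral>x. (1 - \<alpha>\<^sup>2) ^ l \<partial>\<mu>)"
    proof (rule integral_mono_AE)
      show "integrable \<mu> (\<lambda>x. indicator ?\<omega> x * (norm (eigenfun (int l) 0 x))\<^sup>2)"
        using integrable_mult_indicator[OF _ int, of ?\<omega>] by simp
      show "AE x in \<mu>. indicator ?\<omega> x * (norm (eigenfun (int l) 0 x))\<^sup>2 \<le> (1 - \<alpha>\<^sup>2) ^ l"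
        using AE_\<mu>_S2
      proof eventually_elim
        case (elim x)
        show ?case
        proof (cases "x \<in> ?\<omega>")
          case True
          then have "\<alpha>\<^sup>2 \<le> \<bar>x $ 3\<bar>\<^sup>2" using \<alpha> by (intro power_mono) (auto simp: control_region_def)
          moreover have "(x $ 3)\<^sup>2 \<le> 1"
          proof -
            have "0 \<le> (x $ 1)\<^sup>2" "0 \<le> (x $ 2)\<^sup>2" by simp_all
            then show ?thesis using S2_coord[OF elim] by linarith
          qed
          ultimately have "(1 - (x $ 3)\<^sup>2) ^ l \<le> (1 - \<alpha>\<^sup>2) ^ l" by (intro power_mono) auto
          then show ?thesis using True norm_sph[OF elim, of "int l" 1] by (simp add: e0)
        next
          case False
          then show ?thesis using \<alpha>2 by simp
        qed
      qed
    qed simp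
    then have hi: "(\<integral>x. indicator ?\<omega> x * (norm (eigenfun (int l) 0 x))\<^sup>2 \<partial>\<mu>) \<le> (1 - \<alpha>\<^sup>2) ^ l * M" by (simp add: M_def mult.commute)
    have "(norm (mult_indicator ?\<omega> (b l)))\<^sup>2 * (2 * pi * r ^ l * \<epsilon>) \<le> (norm (mult_indicator ?\<omega> (b l)))\<^sup>2 * (eigenfun_norm (int l) 0)\<^sup>2"
      using lo by (intro mult_left_mono) auto
    also have "\<dots> = (\<integral>x. indicator ?\<omega> x * (norm (eigenfun (int l) 0 x))\<^sup>2 \<partial>\<mu>)"
      using eigenfun_norm_pos[of "int l" 0] unfolding b_def norm_mult_indicator_basis_vec[OF control_region_borel] by simp
    finally show ?thesis using hi by linarith
  qed
  \<comment> \<open>The observability estimate is squared, which explains \<open>exp (2 * T)\<close>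
    in \<open>\<rho>\<close>, and multiplied by the lower bound for the squared eigenfunction norm
    to remove the normalisation.\<close>
  have bound: "(r ^ 3 / \<rho>) ^ l \<le> K\<^sup>2 * M / (2 * pi * \<epsilon>)" for l
  proof -
    have ev: "eigval (int l) 0 = real l" by (simp add: eigval_def kappa_def)
    have "(exp (- real l * T) * r ^ l)\<^sup>2 \<le> (K * norm (mult_indicator ?\<omega> (b l)))\<^sup>2"
      using K[of "((int l, False), 0)"] fb[of l] r by (intro power_mono) (auto simp: ev b_def)
    also have "\<dots> = K\<^sup>2 * (norm (mult_indicator ?\<omega> (b l)))\<^sup>2" by (simp add: power_mult_distrib)
    finally have "(exp (- real l * T) * r ^ l)\<^sup>2 * (2 * pi * r ^ l * \<epsilon>) \<le> K\<^sup>2 * (norm (mult_indicator ?\<omega> (b l)))\<^sup>2 * (2 * pi * r ^ l * \<epsilon>)"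
      using r \<epsilon> by (intro mult_right_mono) auto
    also have "\<dots> \<le> K\<^sup>2 * ((1 - \<alpha>\<^sup>2) ^ l * M)"
      unfolding mult.assoc[of "K\<^sup>2"] by (intro mult_left_mono wn) auto
    finally have main: "(exp (- real l * T) * r ^ l)\<^sup>2 * (2 * pi * r ^ l * \<epsilon>) \<le> K\<^sup>2 * ((1 - \<alpha>\<^sup>2) ^ l * M)" .
    have e: "(exp (- real l * T))\<^sup>2 = 1 / exp (2 * T) ^ l"
      by (simp add: exp_of_nat_mult[symmetric] exp_minus power2_eq_square mult_exp_exp divide_inverse flip: exp_minus)
    have "(r\<^sup>2 * r) ^ l * (2 * pi * \<epsilon>) \<le> K\<^sup>2 * (\<rho> ^ l * M)"
    proof -
      have "(r\<^sup>2 * r) ^ l * (2 * pi * \<epsilon>) = exp (2 * T) ^ l * ((exp (- real l * T) * r ^ l)\<^sup>2 * (2 * pi * r ^ l * \<epsilon>))"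
        unfolding power_mult_distrib e by (simp add: power_mult[symmetric] mult_ac)
      also have "\<dots> \<le> exp (2 * T) ^ l * (K\<^sup>2 * ((1 - \<alpha>\<^sup>2) ^ l * M))" by (intro mult_left_mono main) auto
      also have "\<dots> = K\<^sup>2 * (\<rho> ^ l * M)" by (simp add: \<rho>_def power_mult_distrib mult_ac)
      finally show ?thesis .
    qed
    moreover have "r\<^sup>2 * r = r ^ 3" by (simp add: power2_eq_square power3_eq_cube)
    ultimately show ?thesis
      using \<rho> \<epsilon> by (simp add: power_divide divide_le_eq le_divide_eq mult_ac)
  qed
  obtain l where "(r ^ 3 / \<rho>) ^ l > K\<^sup>2 * M / (2 * pi * \<epsilon>)"
    using real_arch_pow[of "r ^ 3 / \<rho>"] r \<rho> by auto
  then show False using bound[of l] by simp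
qed

section \<open>Construction of the control for large times\<close>

text \<open>The polynomial bound on the upper band loses \<open>(1 - \<beta>^2)^m\<close>, a power
  of \<open>\<beta> - \<alpha>\<close> linear in \<open>k\<close>, and
  \<open>2 ^ (k * k + 3 * k)\<close>. The eigenvalue controls all three exponents, and
  \<open>\<beta> < 1\<close> makes the first loss exponential rather than total. Minimality of the
  monic eigenfunctions bounds the normalisation by the area of the sphere.\<close>

lemma control_region_lower_bound:
  assumes ab: "0 \<le> \<alpha>" "\<alpha> < \<beta>" "\<beta> < 1"
  shows "\<exists>C\<ge>0. \<forall>j. exp (- C * (1 + mode_eigval j)) \<le> (norm (mult_indicator (control_region \<alpha> \<beta>) (basis_vec j)))\<^sup>2"
proof -
  let ?\<omega> = "control_region \<alpha> \<beta>"
  define M where "M = measure \<mu> UNIV"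
  have M: "M > 0"
    using norm_eigenfun_le[of 0 0] eigenfun_norm_pos[of 0 0] by (simp add: eigenfun_norm_sq[symmetric] M_def less_le_trans[OF zero_less_power])
  define a b d where "a = - ln (1 - \<beta>\<^sup>2)" and "b = - ln (\<beta> - \<alpha>)" and "d = \<bar>ln (M / (2 * pi))\<bar>"
  have \<beta>2: "0 < 1 - \<beta>\<^sup>2" using ab by (simp add: abs_square_less_1)
  have ea: "exp (- a) = 1 - \<beta>\<^sup>2" and eb: "exp (- b) = \<beta> - \<alpha>" using \<beta>2 ab by (auto simp: a_def b_def)
  have a0: "a \<ge> 0" "b \<ge> 0" "d \<ge> 0" using \<beta>2 ab by (auto simp: a_def b_def d_def)
  have ed: "exp (- d) \<le> 2 * pi / M"
  proof -
    have "exp (- d) \<le> exp (- ln (M / (2 * pi)))" unfolding d_def by simp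
    also have "\<dots> = 2 * pi / M" using M by (simp add: exp_minus)
    finally show ?thesis .
  qed
  \<comment> \<open>Here \<open>d\<close> stands for the constant \<open>2 * pi / M\<close>,
    \<open>a\<close> for the exponent \<open>m\<close>, \<open>3 * b\<close> for
    \<open>2 * k + 1\<close>, and 4 for \<open>k * k + 3 * k\<close>, as both \<open>k * k\<close>
    and \<open>k\<close> are at most the eigenvalue.\<close>
  define C where "C = d + a + 3 * b + 4"
  have "exp (- C * (1 + mode_eigval j)) \<le> (norm (mult_indicator ?\<omega> (basis_vec j)))\<^sup>2" for j
  proof -
    obtain n c k where j: "j = ((n, c), k)" by (cases j rule: basis_fun.cases)
    define m where "m = nat \<bar>n\<bar>"
    define l where "l = mode_eigval j"
    have l: "real m \<le> l" "real k \<le> l" "real k * real k \<le> l" "0 \<le> l"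
      using mode_eigval_ge(1)[of n k c] mode_eigval_ge(2)[of k n c] by (auto simp: l_def j m_def mode_eigval_nonneg simp del: mode_eigval.simps)
    have "d + a * real m + b * real (2 * k + 1) + real (k * k + 3 * k) \<le> C * (1 + l)"
    proof -
      have "a * real m \<le> a * l" "b * real k \<le> b * l" using l a0 by (auto intro: mult_left_mono)
      moreover have "0 \<le> d * l" "0 \<le> b * l" using l a0 by auto
      moreover have "C * (1 + l) = d + a + 3 * b + 4 + d * l + a * l + 3 * (b * l) + 4 * l"
        by (simp add: C_def algebra_simps)
      moreover have "b * real (2 * k + 1) = 2 * (b * real k) + b" "real (k * k + 3 * k) = real k * real k + 3 * real k"
        by (simp_all add: algebra_simps)
      ultimately show ?thesis using l a0 by linarith
    qed
    then have "exp (- C * (1 + l)) \<le> exp (- d + (real m * (- a) + (real (2 * k + 1) * (- b) + - real (k * k + 3 * k))))"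
      by (simp add: algebra_simps)
    also have "\<dots> = exp (- d) * ((1 - \<beta>\<^sup>2) ^ m * ((\<beta> - \<alpha>) ^ (2 * k + 1) * (1 / exp 1 ^ (k * k + 3 * k))))"
    proof -
      have "exp (- real (k * k + 3 * k)) = 1 / exp 1 ^ (k * k + 3 * k)"
        using exp_of_nat_mult[of "k * k + 3 * k" "1::real"] by (simp add: exp_minus divide_inverse del: of_nat_add of_nat_mult)
      then show ?thesis unfolding exp_add exp_of_nat_mult ea eb by simp
    qed
    also have "\<dots> \<le> (2 * pi / M) * ((1 - \<beta>\<^sup>2) ^ m * ((\<beta> - \<alpha>) ^ (2 * k + 1) * (1 / 2 ^ (k * k + 3 * k))))"
    proof (intro mult_mono ed mult_left_mono)
      have "2 ^ (k * k + 3 * k) \<le> exp (1::real) ^ (k * k + 3 * k)"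
        using exp_ge_add_one_self[of "1::real"] by (intro power_mono) auto
      then show "1 / exp 1 ^ (k * k + 3 * k) \<le> (1 / 2 ^ (k * k + 3 * k) :: real)" by (intro divide_left_mono) auto
    qed (use \<beta>2 ab M in auto)
    also have "\<dots> = 2 * pi * (1 - \<beta>\<^sup>2) ^ m * ((\<beta> - \<alpha>) ^ (2 * k + 1) / 2 ^ (k * k + 3 * k)) / M" by (simp add: mult_ac)
    also have "\<dots> \<le> (\<integral>x. indicator ?\<omega> x * (norm (eigenfun n k x))\<^sup>2 \<partial>\<mu>) / M"
      unfolding m_def using M ab by (intro divide_right_mono eigenfun_band_lower) (auto simp: control_region_def)
    also have "\<dots> \<le> (\<integral>x. indicator ?\<omega> x * (norm (eigenfun n k x))\<^sup>2 \<partial>\<mu>) / (eigenfun_norm n k)\<^sup>2"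
      using norm_eigenfun_le[of n k] eigenfun_norm_pos[of n k] M
      by (intro divide_left_mono integral_nonneg) (auto simp: eigenfun_norm_sq[symmetric] M_def)
    also have "\<dots> = (norm (mult_indicator ?\<omega> (basis_vec j)))\<^sup>2"
      unfolding j norm_mult_indicator_basis_vec[OF control_region_borel] ..
    finally show ?thesis by (simp add: l_def)
  qed
  moreover have "C \<ge> 0" using a0 by (simp add: C_def)
  ultimately show ?thesis by blast
qed

lemma control_region_orthogonal:
  assumes "fst j \<noteq> fst j'"
  shows "mult_indicator (control_region \<alpha> \<beta>) (basis_vec j) \<bullet> basis_vec j' = 0"
proof -
  let ?\<omega> = "control_region \<alpha> \<beta>"
  define g :: "real \<Rightarrow> real" where "g = indicator {t. \<alpha> < \<bar>t\<bar> \<and> \<bar>t\<bar> < \<beta>}"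
  have gm [measurable]: "g \<in> borel_measurable borel" unfolding g_def by measurable
  note s = square_integrable_indicator_mult[OF control_region_borel[of \<alpha> \<beta>] square_integrable_basis_fun[of j]]
  have m: "(\<lambda>x. basis_fun j x * cnj (basis_fun j' x)) \<in> borel_measurable \<mu>"
    by (intro borel_measurable_integrable square_integrable_mult_integrable square_integrable_basis_fun)
  have "(\<integral>x. indicator ?\<omega> x * basis_fun j x * cnj (basis_fun j' x) \<partial>\<mu>) = (\<integral>x. of_real (g (x $ 3)) * (basis_fun j x * cnj (basis_fun j' x)) \<partial>\<mu>)"
  proof (rule integral_cong_AE)
    show "AE x in \<mu>. indicator ?\<omega> x * basis_fun j x * cnj (basis_fun j' x) = of_real (g (x $ 3)) * (basis_fun j x * cnj (basis_fun j' x))"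
      using AE_\<mu>_S2 by eventually_elim (auto simp: g_def indicator_def control_region_def)
    show "(\<lambda>x. indicator ?\<omega> x * basis_fun j x * cnj (basis_fun j' x)) \<in> borel_measurable \<mu>"
      by (intro borel_measurable_integrable square_integrable_mult_integrable square_integrable_basis_fun s)
    have "(\<lambda>x. complex_of_real (g (x $ 3))) \<in> borel_measurable \<mu>" by measurable
    then show "(\<lambda>x. of_real (g (x $ 3)) * (basis_fun j x * cnj (basis_fun j' x))) \<in> borel_measurable \<mu>"
      using m by (rule borel_measurable_times)
  qed
  then show ?thesis
    using basis_fun_orthogonal_weight[OF assms gm]
    unfolding basis_vec_def mult_indicator_abs[OF control_region_borel square_integrable_basis_fun]
      inner_abs_L2[OF s square_integrable_basis_fun]
    by (simp add: g_def)
qed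

text \<open>Continuity from the left closes the endpoint that the support condition leaves open.
  Integrals over the open time interval can then be rewritten pointwise as integrals over the
  line.\<close>

lemma lip_supp_0:
  assumes "lip_supp B S f" shows "f 0 = 0"
proof (rule ccontr)
  assume f0: "f 0 \<noteq> 0"
  have B: "B \<ge> 0" using assms unfolding lip_supp_def by (meson abs_ge_zero order_trans)
  define d where "d = \<bar>f 0\<bar> / (2 * (B + 1))"
  have d: "d > 0" using f0 B by (simp add: d_def)
  have "f (- d) = 0" using assms d by (simp add: lip_supp_def)
  moreover have "\<bar>f 0 - f (- d)\<bar> \<le> B * \<bar>0 - (- d)\<bar>" using assms unfolding lip_supp_def by blast
  ultimately have "\<bar>f 0\<bar> \<le> B * d" using d by simp
  also have "\<dots> < \<bar>f 0\<bar>" using B f0 by (auto simp: d_def field_simps intro: add_nonneg_pos)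
  finally show False by simp
qed

text \<open>Beyond \<open>q^2 - p^2\<close> the gap of the eigenvalues is
  \<open>(2 * |n| + 1) * (q - p)\<close>, which is nonnegative, so one pair of constants serves all
  \<open>n\<close>.\<close>

lemma mode_biorthogonal_family:
  "\<exists>C T0 \<sigma>. 0 \<le> C \<and> 0 \<le> T0 \<and> (\<forall>j. lip_supp (exp (C * (1 + mode_eigval j))) T0 (\<sigma> j) \<and>
     (\<forall>k. lap (\<sigma> j) (mode_eigval (fst j, k)) = (if k = snd j then 1 else 0)))"
proof -
  obtain C T0 where C: "0 \<le> C" "0 \<le> T0" and fam: "\<And>L :: nat \<Rightarrow> real. L 0 \<ge> 0 \<Longrightarrow>
     (\<And>i j. i < j \<Longrightarrow> L j - L i \<ge> real j ^ 2 - real i ^ 2) \<Longrightarrow>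
     (\<forall>k. \<exists>\<sigma>. lip_supp (exp (C * (1 + L k))) T0 \<sigma> \<and> (\<forall>j. lap \<sigma> (L j) = (if j = k then 1 else 0)))"
    using biorthogonal_family by (elim exE conjE) blast
  have "\<exists>\<sigma>. lip_supp (exp (C * (1 + mode_eigval j))) T0 \<sigma> \<and>
     (\<forall>k. lap \<sigma> (mode_eigval (fst j, k)) = (if k = snd j then 1 else 0))" for j
  proof -
    obtain n c k where j: "j = ((n, c), k)" by (cases j rule: basis_fun.cases)
    have gap: "real q ^ 2 - real p ^ 2 \<le> eigval n q - eigval n p" if "p < q" for p q
    proof -
      have "eigval n q - eigval n p - (real q ^ 2 - real p ^ 2) = (2 * real (nat \<bar>n\<bar>) + 1) * (real q - real p)"
        by (simp add: eigval_def kappa_def power2_eq_square algebra_simps)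
      also have "\<dots> \<ge> 0" using that by simp
      finally show ?thesis by simp
    qed
    have "eigval n 0 \<ge> 0" by (simp add: eigval_def kappa_def)
    from fam[of "eigval n", OF this gap] show ?thesis by (auto simp: j)
  qed
  then obtain \<sigma> where "\<And>j. lip_supp (exp (C * (1 + mode_eigval j))) T0 (\<sigma> j) \<and>
     (\<forall>k. lap (\<sigma> j) (mode_eigval (fst j, k)) = (if k = snd j then 1 else 0))" by metis
  then show ?thesis using C by blast
qed

lemma controllable_large_time:
  assumes ab: "0 \<le> \<alpha>" "\<alpha> < \<beta>" "\<beta> < 1"
  shows "\<exists>Tstar>0. \<forall>T\<ge>Tstar. null_controllable (control_region \<alpha> \<beta>) T"
proof -
  let ?\<omega> = "control_region \<alpha> \<beta>"
  note \<omega> = control_region_borel[of \<alpha> \<beta>]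
  interpret mi: bounded_linear "mult_indicator ?\<omega>" by (rule mult_indicator_linear[OF \<omega>])
  define w where "w j = mult_indicator ?\<omega> (basis_vec j)" for j
  obtain C2 where C2: "C2 \<ge> 0" "\<And>j. exp (- C2 * (1 + mode_eigval j)) \<le> (norm (w j))\<^sup>2"
    using control_region_lower_bound[OF ab] unfolding w_def by blast
  obtain C1 T0 \<sigma> where C1: "0 \<le> C1" and T0: "0 \<le> T0"
    and lip: "\<And>j. lip_supp (exp (C1 * (1 + mode_eigval j))) T0 (\<sigma> j)"
    and lap: "\<And>j k. lap (\<sigma> j) (mode_eigval (fst j, k)) = (if k = snd j then 1 else 0)"
    using mode_biorthogonal_family by metis
  have wpos: "0 < (norm (w j))\<^sup>2" for j using C2(2)[of j] exp_gt_zero less_le_trans by blast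
  have w1: "norm (w j) \<le> 1" for j
    using norm_mult_indicator_le[OF \<omega>, of "basis_vec j"] by (simp add: w_def)
  have wb: "w j \<bullet> basis_vec j = (norm (w j))\<^sup>2" for j
    unfolding w_def power2_norm_eq_inner by (rule mult_indicator_inner[OF \<omega>])
  have wo: "w j \<bullet> basis_vec j' = 0" if "fst j \<noteq> fst j'" for j j'
    unfolding w_def by (rule control_region_orthogonal[OF that])
  \<comment> \<open>\<open>T0\<close> makes room for the support of the \<open>\<sigma> j\<close>;
    multiplied by the eigenvalue, \<open>C1\<close> pays for their size, \<open>C2\<close> for the
    small mass on the region, and 1 for summation over the modes.\<close>
  have null: "null_controllable ?\<omega> T" if T: "T \<ge> T0 + C1 + C2 + 1" for T
    unfolding null_controllable_def
  proof
    fix f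
    have Tpos: "T > 0" and TT0: "T0 < T" using T T0 C1 C2 by linarith+
    \<comment> \<open>The division normalises the moment, because
      \<open>w j \<bullet> basis_vec j\<close> is the squared norm of \<open>w j\<close>, the
      cut-off being a projection.\<close>
    define a where "a j = - exp (- mode_eigval j * T) * (f \<bullet> basis_vec j) / (norm (w j))\<^sup>2" for j
    define J where "J = mode_of_nat"
    define summand where "summand i s = (a (J i) * \<sigma> (J i) (T - s)) *\<^sub>R w (J i)" for i s
    define u where "u s = (\<Sum>i. summand i s)" for s
    define M where "M i = norm f * exp (C1 + C2) * exp (- mode_eigval (J i))" for i
    have M0: "M i \<ge> 0" for i by (simp add: M_def)
    have sM: "summable M" unfolding M_def J_def by (intro summable_mult summable_exp_mode_eigval)
    have tM: "norm (summand i s) \<le> M i" for i s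
    proof -
      let ?j = "J i" and ?l = "mode_eigval (J i)"
      have l: "?l \<ge> 0" by (rule mode_eigval_nonneg)
      have inv: "1 / (norm (w ?j))\<^sup>2 \<le> exp (C2 * (1 + ?l))"
      proof -
        have "1 / (norm (w ?j))\<^sup>2 \<le> 1 / exp (- C2 * (1 + ?l))" using C2(2)[of ?j] wpos[of ?j] by (intro divide_left_mono) auto
        then show ?thesis by (simp add: exp_minus divide_inverse)
      qed
      have fb: "\<bar>f \<bullet> basis_vec ?j\<bar> \<le> norm f" using Cauchy_Schwarz_ineq2[of f "basis_vec ?j"] by simp
      have "\<bar>a ?j\<bar> = exp (- ?l * T) * \<bar>f \<bullet> basis_vec ?j\<bar> * (1 / (norm (w ?j))\<^sup>2)"
        by (simp add: a_def abs_mult)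
      also have "\<dots> \<le> exp (- ?l * T) * norm f * exp (C2 * (1 + ?l))"
        by (intro mult_mono fb inv) auto
      finally have a: "\<bar>a ?j\<bar> \<le> exp (- ?l * T) * norm f * exp (C2 * (1 + ?l))" .
      have "norm (summand i s) = \<bar>a ?j\<bar> * \<bar>\<sigma> ?j (T - s)\<bar> * norm (w ?j)" by (simp add: summand_def abs_mult)
      also have "\<dots> \<le> (exp (- ?l * T) * norm f * exp (C2 * (1 + ?l))) * exp (C1 * (1 + ?l)) * 1"
        using lip[of ?j] by (intro mult_mono a w1) (auto simp: lip_supp_def)
      also have "\<dots> = norm f * exp (- ?l * T + C2 * (1 + ?l) + C1 * (1 + ?l))" by (simp only: exp_add mult_1_right mult.assoc mult.left_commute[of _ "norm f"])
      also have "\<dots> \<le> norm f * exp (C1 + C2 - ?l)"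
      proof -
        have "(C1 + C2 + 1) * ?l \<le> T * ?l" using T T0 l by (intro mult_right_mono) auto
        then show ?thesis by (intro mult_left_mono) (auto simp: algebra_simps)
      qed
      also have "\<dots> = M i" by (simp add: M_def exp_diff exp_minus divide_inverse)
      finally show ?thesis .
    qed
    have sn: "summable (\<lambda>i. norm (summand i s))" for s
      by (rule summable_comparison_test'[OF sM]) (use tM in simp)
    then have st: "summable (\<lambda>i. summand i s)" for s by (rule summable_norm_cancel)
    have [measurable]: "\<sigma> j \<in> borel_measurable borel" for j by (rule lip_supp_measurable[OF lip])
    have tm [measurable]: "summand i \<in> borel_measurable borel" for i unfolding summand_def by measurable
    have um [measurable]: "u \<in> borel_measurable borel" unfolding u_def by measurable
    have uM: "norm (u s) \<le> suminf M" for s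
      unfolding u_def using sn by (intro order_trans[OF summable_norm] suminf_le tM sM)
    have ind: "integrable lborel (indicator {0<..<T} :: real \<Rightarrow> real)"
      by (rule integrable_real_indicator) (use Tpos in \<open>auto simp: less_top[symmetric]\<close>)
    have sqi: "square_integrable_in_time T u"
      unfolding square_integrable_in_time_def set_borel_measurable_def set_integrable_def
    proof
      show "(\<lambda>s. indicator {0<..<T} s *\<^sub>R u s) \<in> borel_measurable lborel" by measurable
      show "integrable lborel (\<lambda>s. indicator {0<..<T} s *\<^sub>R (norm (u s))\<^sup>2)"
      proof (rule Bochner_Integration.integrable_bound[OF integrable_mult_left[OF ind]])
        show "AE s in lborel. norm (indicator {0<..<T} s *\<^sub>R (norm (u s))\<^sup>2) \<le> norm (indicator {0<..<T} s * (suminf M)\<^sup>2)"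
          using uM by (intro AE_I2) (auto simp: indicator_def intro: power_mono)
      qed measurable
    qed
    \<comment> \<open>The profiles \<open>w j\<close> are already cut off to the region, so the
      cut-off in Duhamel's formula leaves the control unchanged; the support condition follows from
      the same identity.\<close>
    have fix_u: "mult_indicator ?\<omega> (u s) = u s" for s
    proof -
      have "mult_indicator ?\<omega> (summand i s) = summand i s" for i
        unfolding summand_def w_def by (simp only: mi.scaleR mult_indicator_idem[OF \<omega>])
      then show ?thesis unfolding u_def using mi.suminf[OF st[of s]] by simp
    qed
    have sup: "supported_in T ?\<omega> u"
      unfolding supported_in_def
    proof (rule AE_I2, rule impI)
      fix s
      have "square_integrable (\<lambda>x. indicator ?\<omega> x * rep_L2 (u s) x)"
        by (intro square_integrable_indicator_mult \<omega>) simp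
      from rep_abs_L2[OF this] have "AE x in \<mu>. rep_L2 (mult_indicator ?\<omega> (u s)) x = indicator ?\<omega> x * rep_L2 (u s) x"
        unfolding mult_indicator_def .
      then show "AE x in \<mu>. x \<notin> ?\<omega> \<longrightarrow> rep_L2 (u s) x = 0"
        unfolding fix_u by eventually_elim auto
    qed
    have "duhamel ?\<omega> f u T = 0"
    proof (rule L2_eqI)
      fix j'
      let ?l = "mode_eigval j'"
      define g where "g i s = indicator {0<..<T} s * (exp (- ?l * (T - s)) * (summand i s \<bullet> basis_vec j'))" for i s
      have gsum: "(\<lambda>i. g i s) sums (indicator {0<..<T} s * (exp (- ?l * (T - s)) * (mult_indicator ?\<omega> (u s) \<bullet> basis_vec j')))" for s
        unfolding g_def fix_u unfolding u_def
        by (intro sums_mult bounded_linear.sums[OF bounded_linear_inner_left] summable_sums st)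
      have gM: "norm (g i s) \<le> indicator {0<..<T} s * M i" for i s
      proof (cases "s \<in> {0<..<T}")
        case True
        have "\<bar>summand i s \<bullet> basis_vec j'\<bar> \<le> M i"
          using Cauchy_Schwarz_ineq2[of "summand i s" "basis_vec j'"] tM[of i s] by simp
        then have "exp (- ?l * (T - s)) * \<bar>summand i s \<bullet> basis_vec j'\<bar> \<le> 1 * M i"
          using True mode_eigval_nonneg[of j'] by (intro mult_mono) auto
        then show ?thesis using True by (simp add: g_def abs_mult)
      qed (simp add: g_def)
      have gm [measurable]: "g i \<in> borel_measurable borel" for i unfolding g_def by measurable
      have gint: "integrable lborel (g i)" for i
        by (rule Bochner_Integration.integrable_bound[OF integrable_mult_left[OF ind, of "M i"]])
          (use gM M0 in \<open>auto simp: abs_mult\<close>)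
      \<comment> \<open>Reversing time turns the integral into a Laplace transform. A mode with
        another \<open>n\<close> or flag drops out because \<open>w\<close> is orthogonal, a mode
        with another \<open>k\<close> by biorthogonality, and the mode \<open>j'\<close> itself
        leaves exactly the free evolution with opposite sign.\<close>
      have int_g: "integral\<^sup>L lborel (g i) = (if J i = j' then - exp (- ?l * T) * (f \<bullet> basis_vec j') else 0)" for i
      proof -
        let ?j = "J i"
        have zero: "\<sigma> ?j t = 0" if "t \<notin> {0<..<T}" for t
          using that lip[of ?j] lip_supp_0[OF lip[of ?j]] TT0 unfolding lip_supp_def by (cases "t = 0") auto
        have "g i s = a ?j * (w ?j \<bullet> basis_vec j') * (\<sigma> ?j (T + -1 * s) * exp (- ?l * (T + -1 * s)))" for s
          using zero[of "T - s"] by (cases "s \<in> {0<..<T}") (auto simp: g_def summand_def)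
        then have "integral\<^sup>L lborel (g i) = a ?j * (w ?j \<bullet> basis_vec j') * (LINT s|lborel. \<sigma> ?j (T + -1 * s) * exp (- ?l * (T + -1 * s)))"
          unfolding integral_mult_right_zero[symmetric] by presburger
        also have "(LINT s|lborel. \<sigma> ?j (T + -1 * s) * exp (- ?l * (T + -1 * s))) = lap (\<sigma> ?j) ?l"
          unfolding lap_def using lborel_integral_real_affine[of "-1" "\<lambda>t. \<sigma> ?j t * exp (- ?l * t)" T] by simp
        also have "a ?j * (w ?j \<bullet> basis_vec j') * lap (\<sigma> ?j) ?l = (if ?j = j' then - exp (- ?l * T) * (f \<bullet> basis_vec j') else 0)"
        proof (cases "fst ?j = fst j'")
          case True
          then have "lap (\<sigma> ?j) ?l = (if ?j = j' then 1 else 0)"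
            using lap[of ?j "snd j'"] by (simp add: prod_eq_iff[of ?j] eq_commute[of "snd ?j"])
          then show ?thesis using wpos[of j'] by (auto simp: wb a_def)
        next
          case False
          then show ?thesis using wo[OF False] by auto
        qed
        finally show ?thesis .
      qed
      have "(\<lambda>i. integral\<^sup>L lborel (g i)) sums (LINT s|lborel. (\<Sum>i. g i s))"
      proof (rule sums_integral[OF gint])
        show "AE s in lborel. summable (\<lambda>i. norm (g i s))"
        proof (rule AE_I2, rule summable_comparison_test'[OF sM])
          show "norm (norm (g i s)) \<le> M i" for i s using gM[of i s] M0[of i] by (cases "s \<in> {0<..<T}") auto
        qed
        show "summable (\<lambda>i. LINT s|lborel. norm (g i s))"
        proof (rule summable_comparison_test'[OF summable_mult[OF sM, of T]])
          fix i
          have "(LINT s|lborel. norm (g i s)) \<le> (LINT s|lborel. indicator {0<..<T} s * M i)"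
            using gM gint by (intro integral_mono integrable_mult_left ind) auto
          then show "norm (LINT s|lborel. norm (g i s)) \<le> T * M i" using Tpos by (simp add: abs_of_nonneg integral_nonneg)
        qed
      qed
      moreover have "(\<lambda>i. integral\<^sup>L lborel (g i)) sums (- exp (- ?l * T) * (f \<bullet> basis_vec j'))"
      proof -
        have "J i = j' \<longleftrightarrow> i = nat_of_mode j'" for i unfolding J_def by auto
        then show ?thesis unfolding int_g
          using sums_single[of "nat_of_mode j'" "\<lambda>_. - exp (- ?l * T) * (f \<bullet> basis_vec j')"] by simp
      qed
      ultimately have "(LINT s|lborel. (\<Sum>i. g i s)) = - exp (- ?l * T) * (f \<bullet> basis_vec j')" by (rule sums_unique2)
      then show "duhamel ?\<omega> f u T \<bullet> basis_vec j' = 0 \<bullet> basis_vec j'"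
        unfolding duhamel_inner(1)[OF \<omega> Tpos sqi] sums_unique[OF gsum] by simp
    qed
    then show "\<exists>u. square_integrable_in_time T u \<and> supported_in T ?\<omega> u \<and> duhamel ?\<omega> f u T = 0"
      using sqi sup by blast
  qed
  have "T0 + C1 + C2 + 1 > 0" using T0 C1 C2 by linarith
  then show ?thesis using null by blast
qed

theorem theorem1:
  fixes \<alpha> \<beta> :: real
  assumes "0 \<le> \<alpha>" and "\<alpha> < \<beta>" and "\<beta> < 1"
  shows "T_min (control_region \<alpha> \<beta>) \<ge> ereal (ln (1 / sqrt (1 - \<alpha>\<^sup>2))) \<and>
    (\<exists>Tstar > 0. \<forall>T \<ge> Tstar. null_controllable (control_region \<alpha> \<beta>) T)"
proof
  show "T_min (control_region \<alpha> \<beta>) \<ge> ereal (ln (1 / sqrt (1 - \<alpha>\<^sup>2)))"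
    unfolding T_min_def
  proof (rule Inf_greatest, clarify)
    fix T :: real assume T: "0 < T" "null_controllable (control_region \<alpha> \<beta>) T"
    have \<alpha>2: "0 < 1 - \<alpha>\<^sup>2" using assms by (simp add: abs_square_less_1)
    have "1 \<le> exp (2 * T) * (1 - \<alpha>\<^sup>2)" using null_controllable_time_bound[OF _ _ T] assms by simp
    then have "ln 1 \<le> ln (exp (2 * T) * (1 - \<alpha>\<^sup>2))" using \<alpha>2 by (subst ln_le_cancel_iff) auto
    also have "\<dots> = 2 * T + ln (1 - \<alpha>\<^sup>2)" using \<alpha>2 by (simp add: ln_mult)
    finally have "- (ln (1 - \<alpha>\<^sup>2) / 2) \<le> T" by simp
    moreover have "ln (1 / sqrt (1 - \<alpha>\<^sup>2)) = - (ln (1 - \<alpha>\<^sup>2) / 2)" using \<alpha>2 by (simp add: ln_div ln_sqrt)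
    ultimately show "ereal (ln (1 / sqrt (1 - \<alpha>\<^sup>2))) \<le> ereal T" by simp
  qed
  show "\<exists>Tstar > 0. \<forall>T \<ge> Tstar. null_controllable (control_region \<alpha> \<beta>) T"
    by (rule controllable_large_time[OF assms])
qed

end
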